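(* Let $\ell,r$ be positive integers. If $M$ is a simple rank-$r$ frame matroid with no $U_{2,\ell+2}$-minor, then $|M| \le r + (\ell-1)\binom{r}{2}$. If $\ell \ne 1$, $r \ne 3$ and equality holds, then $M \cong \mathrm{DG}(r,\Gamma)$ for some group $\Gamma$ of order $\ell-1$.
   Context: Matroids are finite. A matroid $M$ is framed by a set $B$ if $B$ is a basis of $M$ and every element of $M$ is spanned by a subset of $B$ of size at most $2$. A frame matroid is a restriction of a matroid that is framed by some set $B$. $|M|$ is the number of elements of $M$. "No $N$-minor" means no minor isomorphic to $N$. Dowling geometry $\mathrm{DG}(n,\Gamma)$, for a finite group $\Gamma$: let $G$ be the graph with vertex set $\{1,\dots,n\}$ having exactly one loop at each vertex and, for each pair $i<j$ and each $g\in\Gamma$, one edge directed from $i$ to $j$ with gain $g$ (so $|\Gamma|$ parallel edges between each pair of vertices). Every loop is declared unbalanced. A nonloop cycle (cycles of length 2 are allowed) is balanced if, traversing it, the product in order of the gains of its edges (inverting the gain of an edge traversed against its direction) is the identity of $\Gamma$; otherwise it is unbalanced. A theta is a subgraph consisting of two distinct vertices and three internally disjoint paths between them; a handcuff is a minimal connected subgraph containing exactly two cycles (two cycles that either meet in exactly one vertex, or are vertex-disjoint and joined by a path). $\mathrm{DG}(n,\Gamma)$ is the matroid on the edge set of $G$ whose circuits are the edge sets of balanced cycles, together with the edge sets of thetas and handcuffs that contain no balanced cycle. It has rank $n$ and $n+|\Gamma|\binom n2$ elements. *)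

theory Defs
  imports "HOL-Algebra.Coset"
begin

section \<open>Finite matroids\<close>

record 'a indep_system =
  ground :: "'a set"
  indep :: "'a set set"

locale matroid =
  fixes M :: "'a indep_system"
  assumes finite_ground: "finite (ground M)"
    and indep_subset_ground: "I \<in> indep M \<Longrightarrow> I \<subseteq> ground M"
    and empty_indep: "{} \<in> indep M"
    and indep_subset: "J \<in> indep M \<Longrightarrow> I \<subseteq> J \<Longrightarrow> I \<in> indep M"
    and augment: "I \<in> indep M \<Longrightarrow> J \<in> indep M \<Longrightarrow> card I < card J \<Longrightarrow>
      \<exists>e\<in>J - I. insert e I \<in> indep M"

definition rank_of :: "'a indep_system \<Rightarrow> 'a set \<Rightarrow> nat" where
  "rank_of M X = Max (card ` {I \<in> indep M. I \<subseteq> X})"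

definition matroid_rank :: "'a indep_system \<Rightarrow> nat" where
  "matroid_rank M = rank_of M (ground M)"

definition basis :: "'a indep_system \<Rightarrow> 'a set \<Rightarrow> bool" where
  "basis M B \<longleftrightarrow> B \<in> indep M \<and> (\<forall>I\<in>indep M. B \<subseteq> I \<longrightarrow> I = B)"

definition cl :: "'a indep_system \<Rightarrow> 'a set \<Rightarrow> 'a set" where
  "cl M X = {e \<in> ground M. rank_of M (insert e X) = rank_of M X}"

text \<open>No loops and no parallel pairs.\<close>

definition simple_matroid :: "'a indep_system \<Rightarrow> bool" where
  "simple_matroid M \<longleftrightarrow> (\<forall>e\<in>ground M. \<forall>f\<in>ground M. {e, f} \<in> indep M)"

definition isomorphic :: "'a indep_system \<Rightarrow> 'b indep_system \<Rightarrow> bool" where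
  "isomorphic M N \<longleftrightarrow> (\<exists>f. bij_betw f (ground M) (ground N) \<and>
    (\<forall>X. X \<subseteq> ground M \<longrightarrow> (X \<in> indep M \<longleftrightarrow> f ` X \<in> indep N)))"

definition restriction :: "'a indep_system \<Rightarrow> 'a set \<Rightarrow> 'a indep_system" where
  "restriction M X = \<lparr>ground = X, indep = {I \<in> indep M. I \<subseteq> X}\<rparr>"

definition delete :: "'a indep_system \<Rightarrow> 'a set \<Rightarrow> 'a indep_system" where
  "delete M D = restriction M (ground M - D)"

text \<open>The rank function of \<open>M / C\<close> is \<open>X \<mapsto> r(X \<union> C) - r(C)\<close>.\<close>

definition contract :: "'a indep_system \<Rightarrow> 'a set \<Rightarrow> 'a indep_system" where
  "contract M C = \<lparr>ground = ground M - C,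
     indep = {X. X \<subseteq> ground M - C \<and> rank_of M (X \<union> C) = card X + rank_of M C}\<rparr>"

definition has_minor :: "'a indep_system \<Rightarrow> 'b indep_system \<Rightarrow> bool" where
  "has_minor M N \<longleftrightarrow> (\<exists>C D. C \<subseteq> ground M \<and> D \<subseteq> ground M \<and> C \<inter> D = {} \<and>
    isomorphic (delete (contract M C) D) N)"

definition uniform :: "nat \<Rightarrow> nat \<Rightarrow> nat indep_system" where
  "uniform k n = \<lparr>ground = {..<n}, indep = {X. X \<subseteq> {..<n} \<and> card X \<le> k}\<rparr>"

definition framed_by :: "'a indep_system \<Rightarrow> 'a set \<Rightarrow> bool" where
  "framed_by N B \<longleftrightarrow> basis N B \<and>
    (\<forall>e\<in>ground N. \<exists>S. S \<subseteq> B \<and> card S \<le> 2 \<and> e \<in> cl N S)"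

text \<open>The framed matroid may need more elements than the type \<open>'a\<close> has to offer. Every finite
  matroid is isomorphic to one with elements in \<open>nat\<close>, so the framed matroid is taken over \<open>nat\<close>
  and \<open>M\<close> is identified with its restriction by an isomorphism.\<close>

definition frame_matroid :: "'a indep_system \<Rightarrow> bool" where
  "frame_matroid M \<longleftrightarrow> (\<exists>(N :: nat indep_system) B X. matroid N \<and> framed_by N B \<and>
    X \<subseteq> ground N \<and> isomorphic M (restriction N X))"


section \<open>Dowling geometries\<close>

text \<open>\<open>Link i j g\<close>, with \<open>i < j\<close>, is the edge directed from \<open>i\<close> to \<open>j\<close> with gain \<open>g\<close>.\<close>

datatype 'g dedge = Loop nat | Link nat nat 'g

definition dowling_edges :: "nat \<Rightarrow> ('g, 'm) monoid_scheme \<Rightarrow> 'g dedge set" where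
  "dowling_edges n \<Gamma> = {Loop i |i. i \<in> {1..n}} \<union>
     {Link i j g |i j g. i \<in> {1..n} \<and> j \<in> {1..n} \<and> i < j \<and> g \<in> carrier \<Gamma>}"

fun ends :: "'g dedge \<Rightarrow> nat set" where
  "ends (Loop i) = {i}"
| "ends (Link i j g) = {i, j}"

text \<open>The gain picked up when an edge is traversed starting from the vertex \<open>u\<close>. The value for
  loops is irrelevant: only nonloop cycles can be balanced.\<close>

fun gain_from :: "('g, 'm) monoid_scheme \<Rightarrow> nat \<Rightarrow> 'g dedge \<Rightarrow> 'g" where
  "gain_from \<Gamma> u (Loop i) = \<one>\<^bsub>\<Gamma>\<^esub>"
| "gain_from \<Gamma> u (Link i j g) = (if u = i then g else inv\<^bsub>\<Gamma>\<^esub> g)"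

text \<open>\<open>es ! k\<close> joins \<open>vs ! k\<close> to the cyclically next vertex. A loop is a cycle with one vertex, and
  two parallel edges form a cycle with two vertices.\<close>

definition cycle_seq :: "nat list \<Rightarrow> 'g dedge list \<Rightarrow> bool" where
  "cycle_seq vs es \<longleftrightarrow> es \<noteq> [] \<and> length vs = length es \<and> distinct vs \<and> distinct es \<and>
    (\<forall>k<length es. ends (es ! k) = {vs ! k, vs ! (Suc k mod length es)})"

definition cycle :: "nat set \<Rightarrow> 'g dedge set \<Rightarrow> bool" where
  "cycle V C \<longleftrightarrow> (\<exists>vs es. cycle_seq vs es \<and> V = set vs \<and> C = set es)"

definition balanced_cycle :: "('g, 'm) monoid_scheme \<Rightarrow> 'g dedge set \<Rightarrow> bool" where
  "balanced_cycle \<Gamma> C \<longleftrightarrow> (\<exists>vs es. cycle_seq vs es \<and> 2 \<le> length es \<and> C = set es \<and>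
    foldr (mult \<Gamma>) (map2 (gain_from \<Gamma>) vs es) \<one>\<^bsub>\<Gamma>\<^esub> = \<one>\<^bsub>\<Gamma>\<^esub>)"

definition path :: "nat \<Rightarrow> nat \<Rightarrow> nat set \<Rightarrow> 'g dedge set \<Rightarrow> bool" where
  "path u v V P \<longleftrightarrow> (\<exists>vs es. length vs = Suc (length es) \<and> distinct vs \<and>
    hd vs = u \<and> last vs = v \<and> V = set vs \<and> P = set es \<and>
    (\<forall>k<length es. ends (es ! k) = {vs ! k, vs ! Suc k}))"

text \<open>The paths must be edge-disjoint as well: otherwise a single edge could serve as several of
  them.\<close>

definition theta :: "'g dedge set \<Rightarrow> bool" where
  "theta T \<longleftrightarrow> (\<exists>u v V\<^sub>1 V\<^sub>2 V\<^sub>3 P\<^sub>1 P\<^sub>2 P\<^sub>3. u \<noteq> v \<and>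
    path u v V\<^sub>1 P\<^sub>1 \<and> path u v V\<^sub>2 P\<^sub>2 \<and> path u v V\<^sub>3 P\<^sub>3 \<and>
    V\<^sub>1 \<inter> V\<^sub>2 = {u, v} \<and> V\<^sub>1 \<inter> V\<^sub>3 = {u, v} \<and> V\<^sub>2 \<inter> V\<^sub>3 = {u, v} \<and>
    P\<^sub>1 \<inter> P\<^sub>2 = {} \<and> P\<^sub>1 \<inter> P\<^sub>3 = {} \<and> P\<^sub>2 \<inter> P\<^sub>3 = {} \<and>
    T = P\<^sub>1 \<union> P\<^sub>2 \<union> P\<^sub>3)"

text \<open>The condition \<open>C\<^sub>1 \<noteq> C\<^sub>2\<close> excludes a loop meeting itself in its only vertex. The joining path
  meets each of the two cycles only in its end.\<close>

definition handcuff :: "'g dedge set \<Rightarrow> bool" where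
  "handcuff H \<longleftrightarrow> (\<exists>V\<^sub>1 V\<^sub>2 C\<^sub>1 C\<^sub>2. cycle V\<^sub>1 C\<^sub>1 \<and> cycle V\<^sub>2 C\<^sub>2 \<and> C\<^sub>1 \<noteq> C\<^sub>2 \<and>
    ((\<exists>u. V\<^sub>1 \<inter> V\<^sub>2 = {u}) \<and> H = C\<^sub>1 \<union> C\<^sub>2 \<or>
     V\<^sub>1 \<inter> V\<^sub>2 = {} \<and> (\<exists>u v V P. path u v V P \<and> V \<inter> V\<^sub>1 = {u} \<and> V \<inter> V\<^sub>2 = {v} \<and>
       H = C\<^sub>1 \<union> C\<^sub>2 \<union> P)))"

definition dowling_circuit :: "nat \<Rightarrow> ('g, 'm) monoid_scheme \<Rightarrow> 'g dedge set \<Rightarrow> bool" where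
  "dowling_circuit n \<Gamma> X \<longleftrightarrow> X \<subseteq> dowling_edges n \<Gamma> \<and>
    (balanced_cycle \<Gamma> X \<or>
     (theta X \<or> handcuff X) \<and> \<not> (\<exists>C\<subseteq>X. balanced_cycle \<Gamma> C))"

definition DG :: "nat \<Rightarrow> ('g, 'm) monoid_scheme \<Rightarrow> 'g dedge indep_system" where
  "DG n \<Gamma> = \<lparr>ground = dowling_edges n \<Gamma>,
     indep = {X. X \<subseteq> dowling_edges n \<Gamma> \<and> \<not> (\<exists>C\<subseteq>X. dowling_circuit n \<Gamma> C)}\<rparr>"

end

(* A frame matroid is a restriction of a matroid framed by a set B with as many elements as its rank:
   elements of the framing basis that are skew to the ground set can be contracted. The matroid then
   becomes a graph on B with joints (loops) and lines of parallel edges, where a line has at most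
   l + 1 points together with its joints. Only the pairs with at least l edges exceed the average
   l - 1. Minors produced from such heavy pairs exclude heavy paths with three edges and force missing
   joints at the ends of heavy pairs, so that the missing joints pay for the surplus edges.
   In the case of equality with rank at least 4, heavy pairs occur only for l = 2, as a star, and
   the frame can be changed to one inside the matroid. Then all joints are present and all lines have
   l - 1 interior points, any two edges of a triangle determine a balanced third one, and four
   vertices give associativity, hence a group. The independent sets of DG(r, G) are those of every
   matroid with the closures of a Dowling geometry: thetas and handcuffs have more edges than
   vertices, and a graph without theta and handcuff reduces to disjoint unbalanced cycles by
   removing pendant edges. *)

theory Submission
  imports Defs
begin

section \<open>Rank functions\<close>

text \<open>A framing element outside \<open>X\<close> is no element of the matroid, so it can
  neither be contracted nor counted as a point of a forbidden line. Every minor is built from points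
  of \<open>X\<close> alone: of two points on one pair, contracting one identifies the two ends and
  turns the other into a joint. The threshold for a heavy pair fits this, since \<open>l\<close>
  points and joints at both ends would make a line of l + 2 points. A missing joint may have to be
  shared between two heavy pairs of a triangle, which is why everything is counted twice. Rank 3 is
  exceptional because three frame elements only yield a Latin square; the associative law is read
  off from a fourth one, which provides two planes meeting in a line. In rank at most 2 there are no
  triangles, and any group of the right order serves. That \<open>DG r \<Gamma>\<close> is a matroid
  is never shown by itself: its independent sets are recovered from any rank function with the right
  loops, links and triangles, and the rank function of \<open>M\<close>, written in coordinates, is
  one.\<close>

locale rank_function =
  fixes \<rho> :: "'a set \<Rightarrow> nat" and E :: "'a set"
  assumes finite_E: "finite E"
    and rank_Int_E: "\<rho> (X \<inter> E) = \<rho> X"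
    and rank_le_card: "finite X \<Longrightarrow> \<rho> X \<le> card X"
    and rank_mono: "X \<subseteq> Y \<Longrightarrow> \<rho> X \<le> \<rho> Y"
    and submodular: "\<rho> (X \<union> Y) + \<rho> (X \<inter> Y) \<le> \<rho> X + \<rho> Y"
begin

text \<open>Not cut down to \<open>E\<close>, so everything outside \<open>E\<close> lies in every
  closure. Closures may be infinite; finiteness is regained by intersecting with
  \<open>E\<close>.\<close>

definition clos :: "'a set \<Rightarrow> 'a set" where
  "clos X = {e. \<rho> (insert e X) = \<rho> X}"

lemma rank_empty [simp]: "\<rho> {} = 0"
  using rank_le_card [of "{}"] by simp

lemma rank_insert_le: "\<rho> (insert e X) \<le> Suc (\<rho> X)"
  using submodular [of "{e}" X] rank_le_card [of "{e}"] by simp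

lemma clos_iff: "e \<in> clos X \<longleftrightarrow> \<rho> (insert e X) \<le> \<rho> X"
  using rank_mono [OF subset_insertI, of X e] by (auto simp: clos_def)

lemma rank_insert_notin: "e \<notin> clos X \<Longrightarrow> \<rho> (insert e X) = Suc (\<rho> X)"
  using rank_insert_le [of e X] by (simp add: clos_iff)

lemma subset_clos: "X \<subseteq> clos X"
  by (auto simp: clos_def insert_absorb)

lemma in_clos: "e \<in> X \<Longrightarrow> e \<in> clos X"
  using subset_clos by blast

lemma clos_mono:
  assumes "X \<subseteq> Y" shows "clos X \<subseteq> clos Y"
proof
  fix e assume "e \<in> clos X"
  have "insert e X \<union> Y = insert e Y" using assms by auto
  moreover have "\<rho> X \<le> \<rho> (insert e X \<inter> Y)" using assms by (intro rank_mono) auto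
  ultimately show "e \<in> clos Y"
    using submodular [of "insert e X" Y] \<open>e \<in> clos X\<close> by (simp add: clos_iff)
qed

lemma rank_Un_clos:
  assumes "finite Y" "Y \<subseteq> clos X" shows "\<rho> (X \<union> Y) = \<rho> X"
  using assms
proof (induction Y)
  case (insert e Y)
  then have "e \<in> clos (X \<union> Y)" using clos_mono [of X "X \<union> Y"] by auto
  with insert show ?case by (simp add: clos_def)
qed simp

lemma rank_le_of_subset_clos:
  assumes "Y \<subseteq> clos X" shows "\<rho> Y \<le> \<rho> X"
proof -
  have "\<rho> Y = \<rho> (Y \<inter> E)" by (simp add: rank_Int_E)
  also have "\<dots> \<le> \<rho> (X \<union> (Y \<inter> E))" by (intro rank_mono) auto
  also have "\<dots> = \<rho> X" using assms finite_E by (intro rank_Un_clos) auto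
  finally show ?thesis .
qed

lemma clos_trans:
  assumes "Y \<subseteq> clos X" shows "clos Y \<subseteq> clos X"
proof
  fix e assume "e \<in> clos Y"
  then have "e \<in> clos (X \<union> Y)" using clos_mono [of Y "X \<union> Y"] by blast
  then have "\<rho> (insert e (X \<union> Y)) \<le> \<rho> (X \<union> Y)" by (simp add: clos_iff)
  also have "\<dots> \<le> \<rho> X" using assms subset_clos by (intro rank_le_of_subset_clos) auto
  finally have "\<rho> (insert e (X \<union> Y)) \<le> \<rho> X" .
  moreover have "\<rho> (insert e X) \<le> \<rho> (insert e (X \<union> Y))" by (rule rank_mono) auto
  ultimately show "e \<in> clos X" by (simp add: clos_iff)
qed

lemma clos_exchange:
  assumes "f \<in> clos (insert e X)" "f \<notin> clos X"
  shows "e \<in> clos (insert f X)"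
proof -
  have "\<rho> (insert e (insert f X)) = \<rho> (insert e X)"
    using assms(1) by (simp add: clos_def insert_commute)
  also have "\<dots> \<le> \<rho> (insert f X)"
    using rank_insert_notin [OF assms(2)] rank_insert_le [of e X] by simp
  finally show ?thesis by (simp add: clos_iff)
qed

lemma clos_of_rank_le:
  assumes "X \<subseteq> Y" "\<rho> Y \<le> \<rho> X" shows "Y \<subseteq> clos X"
proof
  fix e assume "e \<in> Y"
  then have "\<rho> (insert e X) \<le> \<rho> Y" using assms by (intro rank_mono) auto
  with assms show "e \<in> clos X" by (simp add: clos_iff)
qed

text \<open>A subset of a flat that already has the rank of the flat spans it.\<close>

lemma clos_eqI: "X \<subseteq> clos Y \<Longrightarrow> \<rho> Y \<le> \<rho> X \<Longrightarrow> clos Y \<subseteq> clos X"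
  using clos_of_rank_le [of X "X \<union> Y"] rank_le_of_subset_clos [of "X \<union> Y" Y]
    subset_clos [of Y] clos_trans [of Y X] by auto

lemma indep_subset:
  assumes "\<rho> Y = card Y" "finite Y" "X \<subseteq> Y" shows "\<rho> X = card X"
proof -
  have "\<rho> (X \<union> (Y - X)) \<le> \<rho> X + \<rho> (Y - X)" using submodular [of X "Y - X"] by simp
  moreover have "X \<union> (Y - X) = Y" "card Y = card X + card (Y - X)"
    using assms by (auto simp: card_Diff_subset finite_subset card_mono)
  ultimately show ?thesis
    using assms rank_le_card [of X] rank_le_card [of "Y - X"] finite_subset [of X Y] by simp
qed

text \<open>Subsets of an independent set form a modular pair, so submodularity for
  \<open>insert x S\<close> and \<open>insert x T\<close> leaves no room for \<open>x\<close> to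
  raise the rank of the intersection.\<close>

lemma indep_clos_Int:
  assumes "\<rho> B = card B" "finite B" "S \<subseteq> B" "T \<subseteq> B" "x \<in> clos S" "x \<in> clos T"
  shows "x \<in> clos (S \<inter> T)"
proof -
  have r: "\<rho> S = card S" "\<rho> T = card T" "\<rho> (S \<inter> T) = card (S \<inter> T)" "\<rho> (S \<union> T) = card (S \<union> T)"
    using assms by (auto intro!: indep_subset [of B])
  have "card S + card T = card (S \<union> T) + card (S \<inter> T)"
    using assms by (intro card_Un_Int) (auto intro: finite_subset)
  moreover have "\<rho> (insert x S \<union> insert x T) + \<rho> (insert x S \<inter> insert x T)
      \<le> \<rho> (insert x S) + \<rho> (insert x T)" by (rule submodular)
  moreover have "insert x S \<inter> insert x T = insert x (S \<inter> T)" by auto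
  moreover have "\<rho> (S \<union> T) \<le> \<rho> (insert x S \<union> insert x T)" by (rule rank_mono) auto
  ultimately have "\<rho> (insert x (S \<inter> T)) \<le> \<rho> (S \<inter> T)" using assms r by (simp add: clos_def)
  then show ?thesis by (simp add: clos_iff)
qed

lemma basis_exists:
  assumes "finite X"
  shows "\<exists>I\<subseteq>X. \<rho> I = card I \<and> X \<subseteq> clos I"
  using assms
proof (induction X)
  case (insert e X)
  then obtain I where I: "I \<subseteq> X" "\<rho> I = card I" "X \<subseteq> clos I" by blast
  show ?case
  proof (cases "e \<in> clos I")
    case True with I show ?thesis by blast
  next
    case False
    then have "\<rho> (insert e I) = card (insert e I)"
      using I insert finite_subset [of I X] rank_insert_notin [of e I]
      by (subst card_insert_disjoint) auto
    moreover have "insert e X \<subseteq> clos (insert e I)"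
      using I clos_mono [of I "insert e I"] in_clos by blast
    ultimately show ?thesis using I by (intro exI [of _ "insert e I"]) auto
  qed
qed simp

text \<open>Contraction of \<open>Z\<close> with the elements of \<open>Z\<close> kept as loops,
  which leaves the ground set unchanged.\<close>

lemma rank_function_quotient: "rank_function (\<lambda>Y. \<rho> (Y \<union> Z) - \<rho> Z) E"
proof
  show "finite E" by (rule finite_E)
  show "\<rho> (X \<inter> E \<union> Z) - \<rho> Z = \<rho> (X \<union> Z) - \<rho> Z" for X
  proof -
    have "(X \<inter> E \<union> Z) \<inter> E = (X \<union> Z) \<inter> E" by auto
    then show ?thesis by (metis rank_Int_E)
  qed
  show "\<rho> (X \<union> Z) - \<rho> Z \<le> card X" if "finite X" for X
    using submodular [of X Z] rank_le_card [OF that] by simp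
  show "\<rho> (X \<union> Z) - \<rho> Z \<le> \<rho> (Y \<union> Z) - \<rho> Z" if "X \<subseteq> Y" for X Y
    using that by (intro diff_le_mono rank_mono) auto
  show "\<rho> (X \<union> Y \<union> Z) - \<rho> Z + (\<rho> (X \<inter> Y \<union> Z) - \<rho> Z)
      \<le> \<rho> (X \<union> Z) - \<rho> Z + (\<rho> (Y \<union> Z) - \<rho> Z)" for X Y
  proof -
    have "(X \<union> Z) \<union> (Y \<union> Z) = X \<union> Y \<union> Z" "(X \<union> Z) \<inter> (Y \<union> Z) = X \<inter> Y \<union> Z" by auto
    then have "\<rho> (X \<union> Y \<union> Z) + \<rho> (X \<inter> Y \<union> Z) \<le> \<rho> (X \<union> Z) + \<rho> (Y \<union> Z)"
      using submodular [of "X \<union> Z" "Y \<union> Z"] by simp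
    moreover have "\<rho> Z \<le> \<rho> (X \<union> Z)" "\<rho> Z \<le> \<rho> (Y \<union> Z)" "\<rho> Z \<le> \<rho> (X \<union> Y \<union> Z)" "\<rho> Z \<le> \<rho> (X \<inter> Y \<union> Z)"
      by (auto intro: rank_mono)
    ultimately show ?thesis by linarith
  qed
qed

text \<open>\<open>f\<close> may identify elements; submodularity survives because the image of an
  intersection lies in the intersection of the images.\<close>

lemma rank_function_pullback:
  assumes "finite F"
  shows "rank_function (\<lambda>Y. \<rho> (f ` (Y \<inter> F))) F"
proof
  show "\<rho> (f ` (X \<inter> F)) \<le> card X" if "finite X" for X
  proof -
    have "\<rho> (f ` (X \<inter> F)) \<le> card (f ` (X \<inter> F))" using that by (intro rank_le_card) auto
    also have "\<dots> \<le> card (X \<inter> F)" using that by (intro card_image_le) auto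
    also have "\<dots> \<le> card X" using that by (intro card_mono) auto
    finally show ?thesis .
  qed
  show "\<rho> (f ` (X \<inter> F)) \<le> \<rho> (f ` (Y \<inter> F))" if "X \<subseteq> Y" for X Y
    using that by (intro rank_mono) auto
  show "\<rho> (f ` ((X \<union> Y) \<inter> F)) + \<rho> (f ` (X \<inter> Y \<inter> F)) \<le> \<rho> (f ` (X \<inter> F)) + \<rho> (f ` (Y \<inter> F))" for X Y
  proof -
    have "f ` ((X \<union> Y) \<inter> F) = f ` (X \<inter> F) \<union> f ` (Y \<inter> F)" by auto
    moreover have "\<rho> (f ` (X \<inter> Y \<inter> F)) \<le> \<rho> (f ` (X \<inter> F) \<inter> f ` (Y \<inter> F))"
      by (rule rank_mono) auto
    ultimately show ?thesis using submodular [of "f ` (X \<inter> F)" "f ` (Y \<inter> F)"] by simp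
  qed
qed (use assms in auto)

end


section \<open>Matroids\<close>

context matroid
begin

lemma finite_indep: "finite (indep M)"
  using finite_ground indep_subset_ground by (meson Pow_iff finite_Pow_iff finite_subset subsetI)

lemma indep_finite: "I \<in> indep M \<Longrightarrow> finite I"
  using finite_ground indep_subset_ground finite_subset by blast

lemma card_le_rank_of: "I \<in> indep M \<Longrightarrow> I \<subseteq> X \<Longrightarrow> card I \<le> rank_of M X"
  unfolding rank_of_def using finite_indep by (intro Max_ge) auto

lemma rank_of_witness:
  obtains I where "I \<in> indep M" "I \<subseteq> X" "card I = rank_of M X"
proof -
  have "rank_of M X \<in> card ` {I \<in> indep M. I \<subseteq> X}"
    unfolding rank_of_def using finite_indep empty_indep by (intro Max_in) auto
  then show thesis using that by auto
qed

lemma rank_of_leI: "(\<And>I. I \<in> indep M \<Longrightarrow> I \<subseteq> X \<Longrightarrow> card I \<le> k) \<Longrightarrow> rank_of M X \<le> k"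
  by (metis rank_of_witness)

lemma extend_indep:
  assumes "I \<in> indep M" "I \<subseteq> X"
  obtains J where "J \<in> indep M" "I \<subseteq> J" "J \<subseteq> X" "card J = rank_of M X"
proof -
  have "\<exists>J\<in>indep M. I \<subseteq> J \<and> J \<subseteq> X \<and> card J = rank_of M X" using assms
  proof (induction "rank_of M X - card I" arbitrary: I)
    case 0
    then show ?case using card_le_rank_of [of I X] by auto
  next
    case (Suc k)
    obtain K where K: "K \<in> indep M" "K \<subseteq> X" "card K = rank_of M X" by (rule rank_of_witness)
    with Suc obtain e where e: "e \<in> K - I" "insert e I \<in> indep M" using augment [of I K] by fastforce
    moreover have "card (insert e I) = Suc (card I)"
      using e Suc indep_finite by (subst card_insert_disjoint) auto
    ultimately have "\<exists>J\<in>indep M. insert e I \<subseteq> J \<and> J \<subseteq> X \<and> card J = rank_of M X"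
      using Suc K by (intro Suc.hyps(1)) auto
    then show ?case by auto
  qed
  then show thesis using that by auto
qed

lemma indep_iff_rank: "X \<in> indep M \<longleftrightarrow> finite X \<and> rank_of M X = card X"
proof
  assume X: "X \<in> indep M"
  then have "rank_of M X \<le> card X" by (auto intro!: rank_of_leI card_mono indep_finite)
  then show "finite X \<and> rank_of M X = card X" using card_le_rank_of [of X X] X indep_finite by auto
next
  assume X: "finite X \<and> rank_of M X = card X"
  obtain I where "I \<in> indep M" "I \<subseteq> X" "card I = rank_of M X" by (rule rank_of_witness)
  with X show "X \<in> indep M" using card_subset_eq [of X I] by auto
qed

lemma rank_function_rank_of: "rank_function (rank_of M) (ground M)"
proof
  show "finite (ground M)" by (rule finite_ground)
  show "rank_of M (X \<inter> ground M) = rank_of M X" for X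
    unfolding rank_of_def using indep_subset_ground
    by (intro arg_cong [where f = Max] arg_cong [where f = "image card"]) auto
  show "rank_of M X \<le> card X" if "finite X" for X
    using that by (auto intro!: rank_of_leI card_mono)
  show "rank_of M X \<le> rank_of M Y" if "X \<subseteq> Y" for X Y
    using that by (auto intro!: rank_of_leI card_le_rank_of)
  show "rank_of M (X \<union> Y) + rank_of M (X \<inter> Y) \<le> rank_of M X + rank_of M Y" for X Y
  proof -
    \<comment> \<open>A basis of the intersection is extended to one of the union, whose parts in
      \<open>X\<close> and in \<open>Y\<close> then overlap at least in the former.\<close>
    obtain I where I: "I \<in> indep M" "I \<subseteq> X \<inter> Y" "card I = rank_of M (X \<inter> Y)"
      by (rule rank_of_witness)
    then obtain J where J: "J \<in> indep M" "I \<subseteq> J" "J \<subseteq> X \<union> Y" "card J = rank_of M (X \<union> Y)"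
      using extend_indep [of I "X \<union> Y"] by blast
    have fin: "finite J" using J indep_finite by blast
    have "card (J \<inter> X) \<le> rank_of M X" "card (J \<inter> Y) \<le> rank_of M Y"
      using J indep_subset by (auto intro!: card_le_rank_of)
    moreover have "card (J \<inter> X) + card (J \<inter> Y) = card (J \<inter> X \<union> J \<inter> Y) + card (J \<inter> X \<inter> (J \<inter> Y))"
      using fin by (intro card_Un_Int) auto
    moreover have "J \<inter> X \<union> J \<inter> Y = J" using J by auto
    moreover have "card I \<le> card (J \<inter> X \<inter> (J \<inter> Y))" using I J fin by (intro card_mono) auto
    ultimately show ?thesis using I J by simp
  qed
qed

text \<open>After contracting \<open>C\<close>, the points of \<open>S\<close> are pairwise
  independent and of rank at most 2 together; deleting all other elements leaves a uniform
  matroid.\<close>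

lemma has_uniform_minorI:
  assumes "C \<subseteq> ground M" "S \<subseteq> ground M" "card S = k" "2 < k"
    and pairs: "\<And>x y. x \<in> S \<Longrightarrow> y \<in> S \<Longrightarrow> x \<noteq> y \<Longrightarrow> rank_of M (C \<union> {x, y}) = rank_of M C + 2"
    and all: "rank_of M (C \<union> S) \<le> rank_of M C + 2"
  shows "has_minor M (uniform 2 k)"
proof -
  interpret rank_function "rank_of M" "ground M" by (rule rank_function_rank_of)
  have finS: "finite S" using assms finite_ground finite_subset by blast
  have ex: "\<exists>y\<in>S. y \<noteq> x" for x
  proof (rule ccontr)
    assume "\<not> (\<exists>y\<in>S. y \<noteq> x)"
    then have "S \<subseteq> {x}" by auto
    then show False using assms card_mono [of "{x}" S] by simp
  qed
  \<comment> \<open>A common element would belong to a pair that adds at most one to the rank of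
    \<open>C\<close>.\<close>
  have CS: "S \<inter> C = {}"
  proof (rule ccontr)
    assume "S \<inter> C \<noteq> {}"
    then obtain x where x: "x \<in> S" "x \<in> C" by auto
    obtain y where y: "y \<in> S" "y \<noteq> x" using ex by blast
    have "C \<union> {x, y} = insert y C" using x by auto
    then show False using pairs [of x y] x y rank_insert_le [of y C] by simp
  qed
  have one: "rank_of M (insert x C) = Suc (rank_of M C)" if x: "x \<in> S" for x
  proof -
    obtain y where y: "y \<in> S" "y \<noteq> x" using ex by blast
    have "rank_of M (insert y (insert x C)) = rank_of M C + 2"
      using pairs [of x y] x y by (simp add: insert_commute)
    then show ?thesis
      using rank_insert_le [of y "insert x C"] rank_insert_le [of x C] by simp
  qed
  have key: "rank_of M (I \<union> C) = card I + rank_of M C \<longleftrightarrow> card I \<le> 2" if I: "I \<subseteq> S" for I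
  proof
    assume "rank_of M (I \<union> C) = card I + rank_of M C"
    moreover have "rank_of M (I \<union> C) \<le> rank_of M (C \<union> S)" using I by (intro rank_mono) auto
    ultimately show "card I \<le> 2" using all by simp
  next
    have finI: "finite I" using I finS finite_subset by blast
    assume "card I \<le> 2"
    then consider "card I = 0" | "card I = Suc 0" | "card I = 2" by linarith
    then show "rank_of M (I \<union> C) = card I + rank_of M C"
    proof cases
      case 1 then show ?thesis using finI by simp
    next
      case 2
      then obtain x where "I = {x}" by (auto simp: card_Suc_eq)
      then show ?thesis using one [of x] I by simp
    next
      case 3
      then obtain x y where "I = {x, y}" "x \<noteq> y" by (auto simp: card_2_iff)
      then show ?thesis using pairs [of x y] I by (simp add: Un_commute insert_commute)
    qed
  qed
  obtain h where h: "bij_betw h S {..<k}"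
    using ex_bij_betw_finite_nat [OF finS] assms by (auto simp: atLeast0LessThan)
  define D where "D = ground M - C - S"
  have g: "ground M - C - D = S" using assms CS by (auto simp: D_def)
  have "I \<in> indep (delete (contract M C) D) \<longleftrightarrow> h ` I \<in> indep (uniform 2 k)" if I: "I \<subseteq> S" for I
  proof -
    have "card (h ` I) = card I" using h I by (meson bij_betw_def card_image inj_on_subset)
    moreover have "h ` I \<subseteq> {..<k}" using h I by (auto simp: bij_betw_def)
    moreover have "I \<subseteq> ground M - C" using I assms CS by auto
    ultimately show ?thesis
      using key [OF I] I g by (simp add: delete_def contract_def restriction_def uniform_def)
  qed
  moreover have "ground (delete (contract M C) D) = S" "ground (uniform 2 k) = {..<k}"
    using g by (auto simp: delete_def contract_def restriction_def uniform_def)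
  ultimately have "isomorphic (delete (contract M C) D) (uniform 2 k)"
    using h by (auto simp: isomorphic_def)
  then show ?thesis unfolding has_minor_def
    using assms by (intro exI [of _ C] exI [of _ D]) (auto simp: D_def)
qed

end

lemma isomorphic_sym:
  assumes "isomorphic M N" shows "isomorphic N M"
proof -
  obtain f where f: "bij_betw f (ground M) (ground N)"
    "\<And>X. X \<subseteq> ground M \<Longrightarrow> (X \<in> indep M \<longleftrightarrow> f ` X \<in> indep N)"
    using assms by (auto simp: isomorphic_def)
  define g where "g = inv_into (ground M) f"
  have g: "bij_betw g (ground N) (ground M)" unfolding g_def using f(1) by (rule bij_betw_inv_into)
  have "f ` g ` X = X" if "X \<subseteq> ground N" for X
    using that f(1) unfolding g_def bij_betw_def by (metis image_inv_into_cancel)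
  moreover have "g ` X \<subseteq> ground M" if "X \<subseteq> ground N" for X
    using that g by (auto simp: bij_betw_def)
  ultimately have "X \<in> indep N \<longleftrightarrow> g ` X \<in> indep M" if "X \<subseteq> ground N" for X
    using that f(2) [of "g ` X"] by simp
  with g show ?thesis by (auto simp: isomorphic_def)
qed

lemma isomorphic_trans:
  assumes "isomorphic M N" "isomorphic N P" shows "isomorphic M P"
proof -
  obtain f where f: "bij_betw f (ground M) (ground N)"
    "\<And>X. X \<subseteq> ground M \<Longrightarrow> (X \<in> indep M \<longleftrightarrow> f ` X \<in> indep N)"
    using assms by (auto simp: isomorphic_def)
  obtain g where g: "bij_betw g (ground N) (ground P)"
    "\<And>X. X \<subseteq> ground N \<Longrightarrow> (X \<in> indep N \<longleftrightarrow> g ` X \<in> indep P)"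
    using assms by (auto simp: isomorphic_def)
  have "bij_betw (g \<circ> f) (ground M) (ground P)" using f g by (blast intro: bij_betw_trans)
  moreover have "X \<in> indep M \<longleftrightarrow> (g \<circ> f) ` X \<in> indep P" if "X \<subseteq> ground M" for X
  proof -
    have "f ` X \<subseteq> ground N" using f(1) that by (auto simp: bij_betw_def)
    then show ?thesis using f(2) [OF that] g(2) [of "f ` X"] by (simp add: image_comp)
  qed
  ultimately show ?thesis by (auto simp: isomorphic_def)
qed

section \<open>Supports in a basis\<close>

context rank_function
begin

text \<open>For \<open>x\<close> outside an independent \<open>B\<close> that spans it, this is the
  fundamental circuit of \<open>x\<close> without \<open>x\<close>. An element of \<open>B\<close>
  has only itself as support.\<close>

definition supp_in :: "'a set \<Rightarrow> 'a \<Rightarrow> 'a set" where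
  "supp_in B x = {b \<in> B. x \<notin> clos (B - {b})}"

text \<open>Each \<open>b\<close> outside the support can be left out of \<open>B\<close> without
  losing \<open>x\<close>; by \<open>indep_clos_Int\<close> all of them can be left out
  together.\<close>

lemma in_clos_iff_supp_in:
  assumes "\<rho> B = card B" "finite B" "x \<in> clos B" "S \<subseteq> B"
  shows "x \<in> clos S \<longleftrightarrow> supp_in B x \<subseteq> S"
proof
  assume x: "x \<in> clos S"
  show "supp_in B x \<subseteq> S"
  proof
    fix b assume "b \<in> supp_in B x"
    then have "x \<notin> clos (B - {b})" "b \<in> B" by (auto simp: supp_in_def)
    then show "b \<in> S" using x clos_mono [of S "B - {b}"] assms by blast
  qed
next
  have *: "x \<in> clos (B - D)" if "finite D" "\<And>b. b \<in> D \<Longrightarrow> x \<in> clos (B - {b})" for D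
    using that
  proof (induction D)
    case (insert b D)
    then have "x \<in> clos ((B - D) \<inter> (B - {b}))"
      using assms by (intro indep_clos_Int [of B]) auto
    moreover have "(B - D) \<inter> (B - {b}) = B - insert b D" by auto
    ultimately show ?case by simp
  qed (use assms in simp)
  have "x \<in> clos (B - (B - supp_in B x))"
    by (rule *) (use assms in \<open>auto simp: supp_in_def\<close>)
  moreover assume "supp_in B x \<subseteq> S"
  ultimately show "x \<in> clos S"
    using clos_mono [of "B - (B - supp_in B x)" S] by auto
qed

end


section \<open>Frames\<close>

text \<open>\<open>B\<close> may lie outside \<open>X\<close>. The excluded minor is expressed by
  ranks alone: in \<open>short_lines\<close>, \<open>S\<close> consists of pairwise nonparallel
  points on a line of the contraction of \<open>C\<close>, and both sets are taken from
  \<open>X\<close>.\<close>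

locale frame = rank_function \<rho> E for \<rho> :: "'a set \<Rightarrow> nat" and E +
  fixes B X :: "'a set" and l :: nat
  assumes finite_B: "finite B" and indep_B: "\<rho> B = card B"
    and finite_X: "finite X" and rank_X: "\<rho> X = card B"
    and simple: "x \<in> X \<Longrightarrow> y \<in> X \<Longrightarrow> \<rho> {x, y} = card {x, y}"
    and framed: "x \<in> X \<Longrightarrow> \<exists>S\<subseteq>B. card S \<le> 2 \<and> x \<in> clos S"
    and short_lines: "C \<subseteq> X \<Longrightarrow> S \<subseteq> X \<Longrightarrow>
      (\<And>x y. x \<in> S \<Longrightarrow> y \<in> S \<Longrightarrow> x \<noteq> y \<Longrightarrow> \<rho> (C \<union> {x, y}) = \<rho> C + 2) \<Longrightarrow>
      \<rho> (C \<union> S) \<le> \<rho> C + 2 \<Longrightarrow> card S \<le> l + 1"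
    and l_pos: "0 < l"
begin

definition "supp x = supp_in B x"

text \<open>For a pair these are the interior points of the line through two frame elements, for a
  singleton the joint, parallel to the frame element.\<close>

definition "line S = {x \<in> X. supp x = S}"

definition "n S = card (line S)"

definition "pairs = {S. S \<subseteq> B \<and> card S = 2}"

lemma rank_sub_B: "S \<subseteq> B \<Longrightarrow> \<rho> S = card S"
  using indep_subset [OF indep_B finite_B] .

lemma in_clos_B: "x \<in> X \<Longrightarrow> x \<in> clos B"
  using framed clos_mono by blast

lemma in_clos_iff: "x \<in> X \<Longrightarrow> S \<subseteq> B \<Longrightarrow> x \<in> clos S \<longleftrightarrow> supp x \<subseteq> S"
  unfolding supp_def using in_clos_iff_supp_in [OF indep_B finite_B in_clos_B] .

lemma supp_sub_B: "supp x \<subseteq> B"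
  by (auto simp: supp_def supp_in_def)

lemma finite_supp: "finite (supp x)"
  using supp_sub_B finite_B finite_subset by blast

lemma not_loop: "x \<in> X \<Longrightarrow> x \<notin> clos {}"
  using simple [of x x] by (simp add: clos_def)

lemma card_supp: assumes "x \<in> X" shows "card (supp x) \<in> {1, 2}"
proof -
  obtain S where "S \<subseteq> B" "card S \<le> 2" "x \<in> clos S" using framed assms by blast
  then have "supp x \<subseteq> S" "card S \<le> 2" "finite S"
    using in_clos_iff assms finite_B finite_subset by auto
  then have "card (supp x) \<le> 2" using card_mono [of S "supp x"] by linarith
  moreover have "card (supp x) \<noteq> 0"
    using finite_supp not_loop [OF assms] in_clos_iff [OF assms, of "{}"] by auto
  ultimately show ?thesis by auto
qed

text \<open>By simplicity two distinct points have rank 2, which is all that \<open>T\<close> can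
  have.\<close>

lemma clos_pair:
  assumes "x \<in> X" "y \<in> X" "x \<noteq> y" "supp x \<subseteq> T" "supp y \<subseteq> T" "T \<subseteq> B" "card T \<le> 2"
  shows "T \<subseteq> clos {x, y}"
proof -
  have "clos T \<subseteq> clos {x, y}"
    using assms in_clos_iff rank_sub_B [of T] simple [of x y] by (intro clos_eqI) auto
  then show ?thesis using subset_clos by blast
qed

lemma joint_clos:
  assumes "x \<in> X" "supp x = {b}" shows "b \<in> clos {x}"
proof -
  have "x \<in> clos (insert b {})" using assms in_clos_iff [of x "{b}"] supp_sub_B [of x] by auto
  then show ?thesis using not_loop assms clos_exchange [of x b "{}"] by auto
qed

lemma edge_clos:
  assumes "x \<in> X" "supp x = {b, c}" "b \<noteq> c" shows "c \<in> clos {x, b}"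
proof -
  have "x \<in> clos (insert c {b})" "x \<notin> clos {b}"
    using assms in_clos_iff [of x "{c, b}"] in_clos_iff [of x "{b}"] supp_sub_B [of x] by auto
  then show ?thesis using clos_exchange [of x c "{b}"] by auto
qed

lemma joint_in_clos:
  assumes "x \<in> X" "supp x = {b}" "x \<in> clos Y" shows "b \<in> clos Y"
  using joint_clos [OF assms(1,2)] clos_trans [of "{x}" Y] assms by auto

lemma edge_in_clos:
  assumes "x \<in> X" "supp x = {b, c}" "b \<noteq> c" "x \<in> clos Y" "b \<in> clos Y" shows "c \<in> clos Y"
  using edge_clos [OF assms(1-3)] clos_trans [of "{x, b}" Y] assms by auto

lemma edge_in_clos':
  assumes "x \<in> X" "supp x = {b, c}" "b \<noteq> c" "x \<in> clos Y" "c \<in> clos Y" shows "b \<in> clos Y"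
  using edge_in_clos [of x c b Y] assms by (simp add: insert_commute)

lemma pair_in_clos:
  assumes "x \<in> X" "y \<in> X" "x \<noteq> y" "supp x \<subseteq> {b, c}" "supp y \<subseteq> {b, c}" "b \<in> B" "c \<in> B"
    "x \<in> clos Y" "y \<in> clos Y"
  shows "b \<in> clos Y" "c \<in> clos Y"
proof -
  have "{b, c} \<subseteq> clos {x, y}" using assms by (intro clos_pair) (auto simp: card_insert_if)
  moreover have "clos {x, y} \<subseteq> clos Y" using assms by (intro clos_trans) auto
  ultimately show "b \<in> clos Y" "c \<in> clos Y" by auto
qed

section \<open>Bounds on lines from excluded uniform minors\<close>

definition spanning :: "'a set \<Rightarrow> 'a set \<Rightarrow> 'a \<Rightarrow> 'a \<Rightarrow> bool" where
  "spanning C T x y \<longleftrightarrow> T \<subseteq> clos (insert x (insert y C))"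

lemma spanning_commute: "spanning C T x y \<longleftrightarrow> spanning C T y x"
  by (simp add: spanning_def insert_commute)

lemma pairwise_spanning_insertI:
  assumes "\<And>x. x \<in> S \<Longrightarrow> spanning C T f x" "pairwise (spanning C T) S"
  shows "pairwise (spanning C T) (insert f S)"
  using assms spanning_commute [of C T f] by (simp add: pairwise_insert)

text \<open>All points lie in the closure of \<open>T\<close>, which has rank \<open>card T\<close>;
  hence two points of \<open>S\<close> that span \<open>T\<close> together with \<open>C\<close>
  have rank exactly 2 over \<open>C\<close>. This replaces rank computations in minors by closure
  computations along edges.\<close>

lemma line_bound:
  assumes "C \<subseteq> X" "S \<subseteq> X" "T \<subseteq> B" and supp: "\<And>x. x \<in> C \<union> S \<Longrightarrow> supp x \<subseteq> T"
    and "\<rho> C + 2 \<le> card T" and "pairwise (spanning C T) S"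
  shows "card S \<le> l + 1"
proof (cases "\<exists>x\<in>S. \<exists>y\<in>S. x \<noteq> y")
  case False
  then have "card S \<le> 1"
    using card_le_Suc0_iff_eq [of S] assms(2) finite_X finite_subset by (metis One_nat_def)
  then show ?thesis by simp
next
  case True
  have ge: "card T \<le> \<rho> (C \<union> {x, y})" if "x \<in> S" "y \<in> S" "x \<noteq> y" for x y
  proof -
    have "T \<subseteq> clos (C \<union> {x, y})" using assms that by (auto simp: pairwise_def spanning_def)
    then show ?thesis using rank_le_of_subset_clos rank_sub_B assms by metis
  qed
  have le: "\<rho> (C \<union> {x, y}) \<le> \<rho> C + 2" for x y
    using rank_insert_le [of x "insert y C"] rank_insert_le [of y C] by simp
  have "C \<union> S \<subseteq> clos T" using assms in_clos_iff by blast
  then have "\<rho> (C \<union> S) \<le> card T" using rank_le_of_subset_clos rank_sub_B assms by metis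
  moreover have "card T = \<rho> C + 2" using True ge le assms(5) by (metis le_antisym order.trans)
  ultimately show ?thesis
    using assms ge le by (intro short_lines [of C S]) (auto intro: le_antisym)
qed

lemma finite_line: "finite (line S)"
  using finite_X by (simp add: line_def)

lemma card_line_Un: "S \<noteq> T \<Longrightarrow> card (line S \<union> line T) = n S + n T"
  unfolding n_def using finite_line by (intro card_Un_disjoint) (auto simp: line_def)

lemma lineD: "x \<in> line S \<Longrightarrow> x \<in> X" "x \<in> line S \<Longrightarrow> supp x = S"
  by (auto simp: line_def)

lemma two_on_line: assumes "2 \<le> n S" obtains x y where "x \<in> line S" "y \<in> line S" "x \<noteq> y"
proof -
  obtain T where "T \<subseteq> line S" "card T = 2" using assms unfolding n_def
    by (metis obtain_subset_with_card_n)
  then show thesis using that by (auto simp: card_2_iff)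
qed

lemma one_on_line: assumes "1 \<le> n S" obtains x where "x \<in> line S"
  using assms by (metis card.empty ex_in_conv n_def not_one_le_zero)

lemma n_joint_le: assumes "b \<in> B" shows "n {b} \<le> 1"
proof (rule ccontr)
  assume "\<not> n {b} \<le> 1"
  then obtain x y where xy: "x \<in> line {b}" "y \<in> line {b}" "x \<noteq> y" using two_on_line [of "{b}"] by auto
  then have "\<rho> {x, y} \<le> \<rho> {b}"
    using in_clos_iff [of _ "{b}"] lineD assms by (intro rank_le_of_subset_clos) auto
  then show False using xy simple [of x y] rank_sub_B [of "{b}"] assms lineD by auto
qed

lemma n_line_le:
  assumes "b \<in> B" "c \<in> B" "b \<noteq> c" shows "n {b, c} + n {b} + n {c} \<le> l + 1"
proof -
  let ?S = "line {b, c} \<union> (line {b} \<union> line {c})"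
  have "card ?S = n {b, c} + card (line {b} \<union> line {c})"
    unfolding n_def using assms finite_line by (intro card_Un_disjoint) (auto simp: line_def)
  then have "card ?S = n {b, c} + n {b} + n {c}" using assms by (simp add: card_line_Un)
  moreover have "card ?S \<le> l + 1"
  proof (rule line_bound [of "{}" _ "{b, c}"])
    have "spanning {} {b, c} x y" if "x \<in> ?S" "y \<in> ?S" "x \<noteq> y" for x y
      using pair_in_clos [of x y b c "{x, y}"] that assms
      by (auto simp: spanning_def line_def in_clos)
    then show "pairwise (spanning {} {b, c}) ?S" by (rule pairwiseI)
  qed (use assms in \<open>auto simp: line_def\<close>)
  ultimately show ?thesis by simp
qed

text \<open>Contracting a point \<open>e\<close> of \<open>{b, c}\<close> identifies
  \<open>b\<close> with \<open>c\<close>, and a second point \<open>f\<close> of that pair becomes a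
  joint there, in place of a joint at \<open>c\<close>. This is one more point on the line of
  \<open>c\<close> and \<open>d\<close>.\<close>

lemma n_adjacent:
  assumes "b \<in> B" "c \<in> B" "d \<in> B" "b \<noteq> c" "c \<noteq> d" "b \<noteq> d" "2 \<le> n {b, c}"
  shows "n {c, d} + n {d} \<le> l"
proof -
  obtain e f where ef: "e \<in> line {b, c}" "f \<in> line {b, c}" "e \<noteq> f" using two_on_line assms by metis
  note ef' = lineD [OF ef(1)] lineD [OF ef(2)]
  let ?S = "line {c, d} \<union> line {d}" and ?T = "{b, c, d}"
  have "spanning {e} ?T x y" if "x \<in> ?S" "y \<in> ?S" "x \<noteq> y" for x y
  proof -
    let ?Y = "insert x (insert y {e})"
    have "c \<in> clos ?Y" "d \<in> clos ?Y"
      using pair_in_clos [of x y c d ?Y] that assms by (auto simp: line_def in_clos)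
    moreover then have "b \<in> clos ?Y" using edge_in_clos' [of e b c ?Y] ef' assms by (auto simp: in_clos)
    ultimately show ?thesis by (simp add: spanning_def)
  qed
  moreover have "spanning {e} ?T f x" if "x \<in> ?S" for x
  proof -
    let ?Y = "insert f (insert x {e})"
    have "b \<in> clos ?Y" "c \<in> clos ?Y"
      using pair_in_clos [of e f b c ?Y] ef ef' assms by (auto simp: in_clos)
    moreover then have "d \<in> clos ?Y"
      using that edge_in_clos [of x c d ?Y] joint_in_clos [of x d ?Y] assms
      by (auto simp: in_clos line_def)
    ultimately show ?thesis by (simp add: spanning_def)
  qed
  ultimately have "pairwise (spanning {e} ?T) (insert f ?S)"
    by (intro pairwise_spanning_insertI pairwiseI)
  moreover have "supp x \<subseteq> ?T" if "x \<in> {e} \<union> insert f ?S" for x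
    using that ef' by (auto simp: line_def)
  moreover have "insert f ?S \<subseteq> X" using ef' by (auto simp: line_def)
  ultimately have "card (insert f ?S) \<le> l + 1"
    using assms ef' rank_le_card [of "{e}"] by (intro line_bound [of "{e}" _ ?T]) auto
  moreover have "f \<notin> ?S" using ef' assms by (auto simp: line_def doubleton_eq_iff)
  ultimately show ?thesis using finite_line card_line_Un [of "{c, d}" "{d}"] assms
    by (simp add: doubleton_eq_iff)
qed

text \<open>The contraction of \<open>n_adjacent\<close> on both sides: one point each of
  \<open>{a, b}\<close> and \<open>{c, d}\<close> is contracted, and the second points become joints
  at \<open>b\<close> and \<open>c\<close>, two more points on their line.\<close>

lemma n_middle:
  assumes "a \<in> B" "b \<in> B" "c \<in> B" "d \<in> B" "distinct [a, b, c, d]" "2 \<le> n {a, b}" "2 \<le> n {c, d}"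
  shows "n {b, c} + 1 \<le> l"
proof -
  obtain e f where ef: "e \<in> line {a, b}" "f \<in> line {a, b}" "e \<noteq> f" using two_on_line assms by metis
  obtain g h where gh: "g \<in> line {c, d}" "h \<in> line {c, d}" "g \<noteq> h" using two_on_line assms by metis
  note ef' = lineD [OF ef(1)] lineD [OF ef(2)] and gh' = lineD [OF gh(1)] lineD [OF gh(2)]
  let ?S = "line {b, c}" and ?T = "{a, b, c, d}"
  have "spanning {e, g} ?T x y" if "x \<in> ?S" "y \<in> ?S" "x \<noteq> y" for x y
  proof -
    let ?Y = "insert x (insert y {e, g})"
    have "b \<in> clos ?Y" "c \<in> clos ?Y"
      using pair_in_clos [of x y b c ?Y] that assms by (auto simp: line_def in_clos)
    moreover then have "a \<in> clos ?Y" "d \<in> clos ?Y"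
      using edge_in_clos' [of e a b ?Y] edge_in_clos [of g c d ?Y] ef' gh' assms
      by (auto simp: in_clos)
    ultimately show ?thesis by (simp add: spanning_def)
  qed
  moreover have "spanning {e, g} ?T f x" if "x \<in> ?S" for x
  proof -
    let ?Y = "insert f (insert x {e, g})"
    have 1: "a \<in> clos ?Y" "b \<in> clos ?Y"
      using pair_in_clos [of e f a b ?Y] ef ef' assms by (auto simp: in_clos)
    then have 2: "c \<in> clos ?Y"
      using that edge_in_clos [of x b c ?Y] assms by (auto simp: in_clos line_def)
    then have "d \<in> clos ?Y"
      using gh' edge_in_clos [of g c d ?Y] assms by (auto simp: in_clos line_def)
    with 1 2 show ?thesis by (simp add: spanning_def)
  qed
  moreover have "spanning {e, g} ?T h x" if "x \<in> ?S" for x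
  proof -
    let ?Y = "insert h (insert x {e, g})"
    have 1: "c \<in> clos ?Y" "d \<in> clos ?Y"
      using pair_in_clos [of g h c d ?Y] gh gh' assms by (auto simp: in_clos)
    then have 2: "b \<in> clos ?Y"
      using that edge_in_clos' [of x b c ?Y] assms by (auto simp: in_clos line_def)
    then have "a \<in> clos ?Y"
      using ef' edge_in_clos' [of e a b ?Y] assms by (auto simp: in_clos line_def)
    with 1 2 show ?thesis by (simp add: spanning_def)
  qed
  moreover have "spanning {e, g} ?T f h"
  proof -
    let ?Y = "insert f (insert h {e, g})"
    have "a \<in> clos ?Y" "b \<in> clos ?Y" "c \<in> clos ?Y" "d \<in> clos ?Y"
      using pair_in_clos [of e f a b ?Y] ef ef' pair_in_clos [of g h c d ?Y] gh gh' assms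
      by (auto simp: in_clos)
    then show ?thesis by (simp add: spanning_def)
  qed
  ultimately have "pairwise (spanning {e, g} ?T) (insert f (insert h ?S))"
    by (intro pairwise_spanning_insertI pairwiseI) blast+
  moreover have "supp x \<subseteq> ?T" if "x \<in> {e, g} \<union> insert f (insert h ?S)" for x
    using that ef' gh' by (auto simp: line_def)
  moreover have "insert f (insert h ?S) \<subseteq> X" using ef' gh' by (auto simp: line_def)
  moreover have "\<rho> {e, g} \<le> 2" using rank_le_card [of "{e, g}"] by (auto simp: card_insert_if split: if_splits)
  ultimately have "card (insert f (insert h ?S)) \<le> l + 1"
    using assms ef' gh' by (intro line_bound [of "{e, g}" _ ?T]) auto
  moreover have "f \<noteq> h" "f \<notin> ?S" "h \<notin> ?S"
    using ef' gh' assms by (auto simp: line_def doubleton_eq_iff)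
  ultimately show ?thesis using finite_line by (simp add: n_def)
qed

text \<open>The elements of \<open>T\<close> are loops after contracting \<open>C\<close>, so a
  point of \<open>{s, p}\<close> becomes a joint at \<open>p\<close> and one of
  \<open>{t, q}\<close> a joint at \<open>q\<close>. The case \<open>s = t\<close> is allowed and is
  the one that occurs later.\<close>

lemma n_contract:
  assumes "C \<subseteq> X" "T \<subseteq> B" "T \<subseteq> clos C" "\<And>x. x \<in> C \<Longrightarrow> supp x \<subseteq> T"
    and "p \<in> B - T" "q \<in> B - T" "p \<noteq> q"
    and "s \<in> T" "1 \<le> n {s, p}" "t \<in> T" "1 \<le> n {t, q}"
  shows "n {p, q} + 1 \<le> l"
proof -
  obtain e where e: "e \<in> line {s, p}" using one_on_line assms by metis
  obtain f where f: "f \<in> line {t, q}" using one_on_line assms by metis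
  note e' = lineD [OF e] and f' = lineD [OF f]
  let ?S = "line {p, q}" and ?T = "insert p (insert q T)"
  have T: "T \<subseteq> clos (insert x (insert y C))" for x y
    using assms clos_mono [of C "insert x (insert y C)"] by auto
  have "spanning C ?T x y" if "x \<in> ?S" "y \<in> ?S" "x \<noteq> y" for x y
    using pair_in_clos [of x y p q "insert x (insert y C)"] T [of x y] assms that
    by (auto simp: spanning_def line_def in_clos)
  moreover have "spanning C ?T e x" if "x \<in> ?S" for x
  proof -
    let ?Y = "insert e (insert x C)"
    have 1: "p \<in> clos ?Y" using edge_in_clos [of e s p ?Y] e' T assms by (auto simp: in_clos)
    then have "q \<in> clos ?Y"
      using edge_in_clos [of x p q ?Y] that assms by (auto simp: in_clos line_def)
    with 1 T show ?thesis by (simp add: spanning_def)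
  qed
  moreover have "spanning C ?T f x" if "x \<in> ?S" for x
  proof -
    let ?Y = "insert f (insert x C)"
    have 1: "q \<in> clos ?Y" using edge_in_clos [of f t q ?Y] f' T assms by (auto simp: in_clos)
    then have "p \<in> clos ?Y"
      using edge_in_clos' [of x p q ?Y] that assms by (auto simp: in_clos line_def)
    with 1 T show ?thesis by (simp add: spanning_def)
  qed
  moreover have "spanning C ?T e f"
  proof -
    let ?Y = "insert e (insert f C)"
    have "q \<in> clos ?Y" using edge_in_clos [of f t q ?Y] f' T assms by (auto simp: in_clos)
    moreover have "p \<in> clos ?Y" using edge_in_clos [of e s p ?Y] e' T assms by (auto simp: in_clos)
    ultimately show ?thesis using T by (simp add: spanning_def)
  qed
  ultimately have P: "pairwise (spanning C ?T) (insert e (insert f ?S))"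
    by (intro pairwise_spanning_insertI pairwiseI) blast+
  have supp: "supp x \<subseteq> ?T" if "x \<in> C \<union> insert e (insert f ?S)" for x
  proof (cases "x \<in> C")
    case True then show ?thesis using assms(4) by blast
  next
    case False then show ?thesis using that e' f' assms(8,10) by (auto simp: line_def)
  qed
  have SX: "insert e (insert f ?S) \<subseteq> X" using e' f' by (auto simp: line_def)
  have "\<rho> C \<le> card T"
    using assms in_clos_iff rank_sub_B [of T] rank_le_of_subset_clos [of C T] by (metis subset_eq)
  moreover have "card ?T = card T + 2" using assms finite_B finite_subset [of T B] by auto
  ultimately have "card (insert e (insert f ?S)) \<le> l + 1"
    using assms P supp SX by (intro line_bound [of C _ ?T]) auto
  moreover have "e \<noteq> f" "e \<notin> ?S" "f \<notin> ?S"
    using e' f' assms by (auto simp: line_def doubleton_eq_iff)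
  ultimately show ?thesis using finite_line by (simp add: n_def)
qed

section \<open>The upper bound by discharging\<close>

lemma finite_pairs: "finite pairs"
  using finite_B by (simp add: pairs_def)

lemma card_pairs: "card pairs = card B choose 2"
  unfolding pairs_def using n_subsets [OF finite_B] .

lemma card_X: "card X = (\<Sum>b\<in>B. n {b}) + (\<Sum>S\<in>pairs. n S)"
proof -
  let ?U = "(\<lambda>b. {b}) ` B"
  have "X = (\<Union>S\<in>?U \<union> pairs. line S)"
  proof -
    have "supp x \<in> ?U \<union> pairs" if x: "x \<in> X" for x
    proof (cases "card (supp x) = 1")
      case True
      then obtain b where "supp x = {b}" by (rule card_1_singletonE)
      then show ?thesis using supp_sub_B [of x] by auto
    next
      case False
      then show ?thesis using card_supp [OF x] supp_sub_B [of x] by (simp add: pairs_def)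
    qed
    then have "x \<in> (\<Union>S\<in>?U \<union> pairs. line S)" if "x \<in> X" for x
      using that by (intro UN_I [of "supp x"]) (simp_all add: line_def)
    then have "X \<subseteq> (\<Union>S\<in>?U \<union> pairs. line S)" by (rule subsetI)
    moreover have "(\<Union>S\<in>?U \<union> pairs. line S) \<subseteq> X" by (rule UN_least) (simp add: line_def)
    ultimately show ?thesis by (rule subset_antisym)
  qed
  then have "card X = card (\<Union>S\<in>?U \<union> pairs. line S)" by simp
  also have "\<dots> = (\<Sum>S\<in>?U \<union> pairs. n S)"
    unfolding n_def using finite_B finite_pairs finite_line
    by (intro card_UN_disjoint) (auto simp: line_def)
  also have "\<dots> = (\<Sum>S\<in>?U. n S) + (\<Sum>S\<in>pairs. n S)"
    using finite_B finite_pairs by (intro sum.union_disjoint) (auto simp: pairs_def)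
  also have "(\<Sum>S\<in>?U. n S) = (\<Sum>b\<in>B. n {b})" by (subst sum.reindex) (auto simp: inj_on_def)
  finally show ?thesis .
qed

text \<open>A circuit has a \<open>U\<^sub>2\<^sub>,\<^sub>3\<close>-minor.\<close>

lemma card_X_le_free:
  assumes "l = 1" shows "card X \<le> card B"
proof (rule ccontr)
  assume less: "\<not> card X \<le> card B"
  obtain I where I: "I \<subseteq> X" "\<rho> I = card I" "X \<subseteq> clos I" using basis_exists finite_X by blast
  then have finI: "finite I" using finite_X finite_subset by blast
  have "card I = card B" using I rank_X rank_mono [of I X] rank_le_of_subset_clos [of X I] by auto
  then have "\<not> X \<subseteq> I" using less card_mono [OF finI, of X] by auto
  then obtain x where x: "x \<in> X" "x \<notin> I" by auto
  let ?J = "supp_in I x"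
  have J: "x \<in> clos S \<longleftrightarrow> ?J \<subseteq> S" if "S \<subseteq> I" for S
    using in_clos_iff_supp_in [OF I(2) finI] I(3) x(1) that by blast
  have sub: "?J \<subseteq> I" by (auto simp: supp_in_def)
  \<comment> \<open>By simplicity \<open>x\<close> is not parallel to an element of
    \<open>I\<close>, so its fundamental circuit has at least three elements.\<close>
  have "\<not> ?J \<subseteq> {u}" if "u \<in> I" for u
  proof
    assume "?J \<subseteq> {u}"
    then have "\<rho> {x, u} = \<rho> {u}" using J [of "{u}"] that by (simp add: clos_def)
    moreover have "\<rho> {x, u} = 2" "\<rho> {u} = 1"
      using simple [of x u] simple [of u u] x that I by (auto simp: card_insert_if)
    ultimately show False by simp
  qed
  moreover have "?J \<noteq> {}" using J [of "{}"] not_loop x by auto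
  ultimately obtain u v where uv: "u \<in> ?J" "v \<in> ?J" "u \<noteq> v" using sub by blast
  \<comment> \<open>Contracting the rest of the basis leaves \<open>u\<close>, \<open>v\<close> and
    \<open>x\<close> as three points of one line.\<close>
  let ?C = "I - {u, v}"
  have C: "\<rho> ?C + 2 = card I"
  proof -
    have "card {u, v} \<le> card I" using uv sub finI by (intro card_mono) auto
    moreover have "\<rho> ?C = card ?C" by (rule indep_subset [OF I(2) finI Diff_subset])
    moreover have "card ?C = card I - card {u, v}" using uv sub by (intro card_Diff_subset) auto
    ultimately show ?thesis using uv by simp
  qed
  have *: "\<rho> (insert x (I - {w})) = card I" if "w \<in> ?J" for w
  proof -
    have "x \<notin> clos (I - {w})" "w \<in> I" using that unfolding supp_in_def by blast+
    moreover have "\<rho> (I - {w}) = card (I - {w})" by (rule indep_subset [OF I(2) finI Diff_subset])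
    ultimately show ?thesis
      using rank_insert_notin [of x "I - {w}"] card_Suc_Diff1 [OF finI, of w] by simp
  qed
  have "?C \<union> {u, v} = I" "?C \<union> {u, x} = insert x (I - {v})" "?C \<union> {v, x} = insert x (I - {u})"
    using uv sub x by blast+
  then have "\<rho> (?C \<union> {u, v}) = \<rho> ?C + 2" "\<rho> (?C \<union> {u, x}) = \<rho> ?C + 2" "\<rho> (?C \<union> {v, x}) = \<rho> ?C + 2"
    using I(2) C * [OF uv(1)] * [OF uv(2)] by metis+
  then have "\<rho> (?C \<union> {p, q}) = \<rho> ?C + 2" if "p \<in> {u, v, x}" "q \<in> {u, v, x}" "p \<noteq> q" for p q
    using that by (elim insertE emptyE) (simp_all only: insert_commute simp_thms)
  moreover have "\<rho> (?C \<union> {u, v, x}) \<le> \<rho> ?C + 2"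
  proof -
    have "?C \<union> {u, v, x} \<subseteq> clos I" using I x uv sub subset_clos [of I] by blast
    then show ?thesis using rank_le_of_subset_clos I C by metis
  qed
  moreover have "?C \<subseteq> X" "{u, v, x} \<subseteq> X" using I x uv sub by blast+
  ultimately have "card {u, v, x} \<le> l + 1" using short_lines by blast
  moreover have "u \<noteq> x" "v \<noteq> x" using uv x sub by blast+
  ultimately show False using assms uv by simp
qed

lemma bij_pairs_neighbours:
  "{S \<in> pairs. z \<in> S \<and> P S} = (\<lambda>d. {z, d}) ` {d \<in> B. d \<noteq> z \<and> z \<in> B \<and> P {z, d}}"
  (is "?L = ?R")
proof (intro subset_antisym subsetI)
  fix S assume "S \<in> ?L"
  then have S: "S \<subseteq> B" "card S = 2" "z \<in> S" "P S" by (auto simp: pairs_def)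
  then obtain d where "S = {z, d}" "d \<noteq> z" by (auto simp: card_2_iff)
  with S show "S \<in> ?R" by blast
qed (auto simp: pairs_def)

definition nbr :: "'a \<Rightarrow> 'a set" where
  "nbr z = {d \<in> B. d \<noteq> z \<and> l \<le> n {z, d}}"

lemma nbr_sym: "z \<in> B \<Longrightarrow> d \<in> nbr z \<Longrightarrow> z \<in> nbr d"
  by (auto simp: nbr_def insert_commute)

lemma finite_nbr: "finite (nbr z)"
  using finite_B by (simp add: nbr_def)

text \<open>Each vertex of the graph of heavy pairs distributes a total charge of at most 2 to its pairs.
  This graph has no path with three edges, so its components are triangles and stars.\<close>

definition charge :: "'a \<Rightarrow> nat" where
  "charge z = (if n {z} \<noteq> 0 then 0 else if card (nbr z) = 1 then 2 else if card (nbr z) = 2 then 1 else 0)"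

text \<open>If \<open>b\<close> has a second heavy neighbour, \<open>n_adjacent\<close> leaves a
  surplus of exactly one, and \<open>c\<close> lacks its joint. Either \<open>b\<close> is the only
  heavy neighbour of \<open>c\<close>, and \<open>c\<close> pays the doubled surplus 2 alone; or
  both ends lack joints, their further neighbours coincide by \<open>n_middle\<close>, and each end
  of this triangle edge pays 1.\<close>

lemma charge_pair_aux:
  assumes l: "2 \<le> l" and bc: "b \<in> B" "c \<in> nbr b" "nbr b \<noteq> {c}"
  shows "2 * n {b, c} \<le> 2 * (l - 1) + (charge b + charge c)"
proof -
  obtain d where d: "d \<in> nbr b" "d \<noteq> c" using bc by auto
  have in_B: "c \<in> B" "d \<in> B" "b \<noteq> c" "b \<noteq> d" using bc d by (auto simp: nbr_def)
  have "2 \<le> n {d, b}" using d l by (simp add: nbr_def insert_commute)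
  then have "n {b, c} + n {c} \<le> l"
    using n_adjacent [of d b c] in_B bc d by auto
  moreover have "l \<le> n {b, c}" using bc by (simp add: nbr_def)
  ultimately have nc: "n {b, c} = l" "n {c} = 0" by auto
  show ?thesis
  proof (cases "nbr c = {b}")
    case True
    then have "charge c = 2" using nc by (simp add: charge_def)
    then show ?thesis using nc by simp
  next
    case False
    have "b \<in> nbr c" using nbr_sym bc by blast
    then obtain e where e: "e \<in> nbr c" "e \<noteq> b" using False by auto
    have e_in: "e \<in> B" "e \<noteq> c" using e by (auto simp: nbr_def)
    have "2 \<le> n {e, c}" using e l by (simp add: nbr_def insert_commute)
    then have "n {b, c} + n {b} \<le> l"
      using n_adjacent [of e c b] in_B e_in bc e by (auto simp: insert_commute)
    then have nb: "n {b} = 0" using nc by simp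
    have uniq: "d' = e'" if "d' \<in> nbr b" "d' \<noteq> c" "e' \<in> nbr c" "e' \<noteq> b" for d' e'
    proof (rule ccontr)
      assume ne: "d' \<noteq> e'"
      have "n {b, c} + 1 \<le> l"
        using that ne bc in_B l by (intro n_middle [of d' b c e']) (auto simp: nbr_def insert_commute)
      then show False using nc by simp
    qed
    have "nbr b = {c, d}" using uniq [of _ e] d e bc by blast
    moreover have "nbr c = {b, e}" using uniq [of d] d e \<open>b \<in> nbr c\<close> by blast
    ultimately have "card (nbr b) = 2" "card (nbr c) = 2" using d e by auto
    then have "charge b = 1" "charge c = 1" using nb nc by (simp_all add: charge_def)
    then show ?thesis using nc l by simp
  qed
qed

text \<open>For an isolated heavy pair, \<open>n_line_le\<close> trades each missing joint for one
  point of surplus, which is 2 in the doubled count. All other heavy pairs fall under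
  \<open>charge_pair_aux\<close>, seen from one end or the other.\<close>

lemma charge_pair:
  assumes l: "2 \<le> l" and bc: "b \<in> B" "c \<in> nbr b"
  shows "2 * n {b, c} \<le> 2 * (l - 1) + (charge b + charge c)"
proof (cases "nbr b = {c} \<and> nbr c = {b}")
  case True
  have "n {b, c} + n {b} + n {c} \<le> l + 1" using bc by (intro n_line_le) (auto simp: nbr_def)
  then show ?thesis using True l by (auto simp: charge_def)
next
  case False
  have "c \<in> B" "b \<in> nbr c" using bc nbr_sym by (auto simp: nbr_def)
  then show ?thesis
    using False charge_pair_aux [OF l, of b c] charge_pair_aux [OF l, of c b] bc
    by (auto simp: insert_commute add.commute)
qed

lemma heavy_charge:
  assumes l: "2 \<le> l" and S: "S \<in> pairs"
  shows "2 * n S \<le> 2 * (l - 1) + (if l \<le> n S then (\<Sum>z | z \<in> B \<and> z \<in> S. charge z) else 0)"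
proof (cases "l \<le> n S")
  case True
  obtain b c where bc: "S = {b, c}" "b \<noteq> c" using S by (auto simp: pairs_def card_2_iff)
  have "{z. z \<in> B \<and> z \<in> S} = {b, c}" using S bc by (auto simp: pairs_def)
  then have "(\<Sum>z | z \<in> B \<and> z \<in> S. charge z) = charge b + charge c" using bc by simp
  moreover have "b \<in> B" "c \<in> nbr b" using S True bc by (auto simp: pairs_def nbr_def)
  ultimately show ?thesis using charge_pair [OF l, of b c] True bc by simp
qed (use l in auto)

text \<open>A vertex with its joint pays nothing; a vertex without it pays at most 2, the doubled
  value of the missing joint.\<close>

lemma total_charge:
  assumes z: "z \<in> B"
  shows "(\<Sum>S | S \<in> {S \<in> pairs. l \<le> n S} \<and> z \<in> S. charge z) \<le> card (nbr z) * charge z"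
    and "card (nbr z) * charge z + 2 * n {z} \<le> 2"
proof -
  have eq: "{S. S \<in> {S \<in> pairs. l \<le> n S} \<and> z \<in> S} = (\<lambda>d. {z, d}) ` nbr z"
    using bij_pairs_neighbours [of z "\<lambda>S. l \<le> n S"] z
    by (auto simp: nbr_def)
  have "card ((\<lambda>d. {z, d}) ` nbr z) \<le> card (nbr z)" by (rule card_image_le [OF finite_nbr])
  then have "card ((\<lambda>d. {z, d}) ` nbr z) * charge z \<le> card (nbr z) * charge z" by (rule mult_le_mono1)
  then show "(\<Sum>S | S \<in> {S \<in> pairs. l \<le> n S} \<and> z \<in> S. charge z) \<le> card (nbr z) * charge z"
    unfolding eq by simp
  show "card (nbr z) * charge z + 2 * n {z} \<le> 2" using n_joint_le [OF z] by (auto simp: charge_def)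
qed

text \<open>Double counting: what the heavy pairs receive is at most what the vertices pay. The sums
  of \<open>h\<close> and of \<open>2 * n S\<close> stand on opposite sides, so that the bound and
  the analysis of equality both follow by comparing summands.\<close>

lemma card_X_le_aux:
  fixes h :: "'a set \<Rightarrow> nat" and g :: "'a \<Rightarrow> nat"
  defines "h \<equiv> \<lambda>S. 2 * (l - 1) + (if l \<le> n S then (\<Sum>z | z \<in> B \<and> z \<in> S. charge z) else 0)"
    and "g \<equiv> \<lambda>z. card (nbr z) * charge z + 2 * n {z}"
  shows "2 * card X + (\<Sum>S\<in>pairs. h S) \<le>
      (\<Sum>S\<in>pairs. 2 * n S) + card pairs * (2 * (l - 1)) + (\<Sum>z\<in>B. g z)"
proof -
  let ?H = "{S \<in> pairs. l \<le> n S}"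
  have "(\<Sum>S\<in>pairs. h S) = card pairs * (2 * (l - 1)) + (\<Sum>S\<in>?H. \<Sum>z | z \<in> B \<and> z \<in> S. charge z)"
    using finite_pairs by (simp add: h_def sum.distrib sum.inter_filter)
  also have "(\<Sum>S\<in>?H. \<Sum>z | z \<in> B \<and> z \<in> S. charge z) = (\<Sum>z\<in>B. \<Sum>S | S \<in> ?H \<and> z \<in> S. charge z)"
    using finite_B finite_pairs by (intro sum.swap_restrict) auto
  also have "\<dots> \<le> (\<Sum>z\<in>B. card (nbr z) * charge z)"
    using total_charge(1) by (rule sum_mono)
  finally have "(\<Sum>S\<in>pairs. h S) \<le> card pairs * (2 * (l - 1)) + (\<Sum>z\<in>B. card (nbr z) * charge z)"
    by simp
  moreover have "2 * card X = (\<Sum>b\<in>B. 2 * n {b}) + (\<Sum>S\<in>pairs. 2 * n S)"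
    by (simp add: card_X sum_distrib_left)
  moreover have "(\<Sum>z\<in>B. g z) = (\<Sum>z\<in>B. card (nbr z) * charge z) + (\<Sum>b\<in>B. 2 * n {b})"
    by (simp add: g_def sum.distrib)
  ultimately show ?thesis by linarith
qed

lemma card_X_le:
  assumes l: "2 \<le> l" shows "card X \<le> card B + (l - 1) * (card B choose 2)"
proof -
  note card_X_le_aux
  moreover have "(\<Sum>S\<in>pairs. 2 * n S) \<le> (\<Sum>S\<in>pairs. 2 * (l - 1) +
      (if l \<le> n S then (\<Sum>z | z \<in> B \<and> z \<in> S. charge z) else 0))"
    using heavy_charge [OF l] by (rule sum_mono)
  moreover have "(\<Sum>z\<in>B. card (nbr z) * charge z + 2 * n {z}) \<le> (\<Sum>z\<in>B. 2)"
    using total_charge(2) by (rule sum_mono)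
  ultimately have "2 * card X \<le> card pairs * (2 * (l - 1)) + (\<Sum>z\<in>B. 2)" by linarith
  then show ?thesis by (simp add: card_pairs algebra_simps)
qed

text \<open>Equal totals force equality in every summand. In particular a vertex without joint must
  spend its whole charge, so it has one or two heavy neighbours.\<close>

lemma tight_charge:
  assumes l: "2 \<le> l" and eq: "card X = card B + (l - 1) * (card B choose 2)"
  shows "S \<in> pairs \<Longrightarrow> l - 1 \<le> n S" and "z \<in> B \<Longrightarrow> card (nbr z) * charge z + 2 * n {z} = 2"
proof -
  let ?h = "\<lambda>S. 2 * (l - 1) + (if l \<le> n S then (\<Sum>z | z \<in> B \<and> z \<in> S. charge z) else 0)"
  let ?g = "\<lambda>z. card (nbr z) * charge z + 2 * n {z}"
  have 1: "(\<Sum>S\<in>pairs. 2 * n S) \<le> (\<Sum>S\<in>pairs. ?h S)"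
    using heavy_charge [OF l] by (rule sum_mono)
  have 2: "(\<Sum>z\<in>B. ?g z) \<le> (\<Sum>z\<in>B. 2)"
    using total_charge(2) by (rule sum_mono)
  have "2 * card X = card pairs * (2 * (l - 1)) + (\<Sum>z\<in>B. 2)"
    using eq by (simp add: card_pairs algebra_simps)
  then have 3: "(\<Sum>S\<in>pairs. 2 * n S) = (\<Sum>S\<in>pairs. ?h S)" "(\<Sum>z\<in>B. ?g z) = (\<Sum>z\<in>B. 2)"
    using card_X_le_aux 1 2 by linarith+
  show "l - 1 \<le> n S" if "S \<in> pairs"
    using sum_mono_inv [OF 3(1) heavy_charge [OF l] that finite_pairs] by simp
  show "card (nbr z) * charge z + 2 * n {z} = 2" if "z \<in> B"
    using sum_mono_inv [OF 3(2) total_charge(2) that finite_B] .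
qed

lemma tight_lines:
  assumes "card X = card B + (l - 1) * (card B choose 2)" and "\<And>S. S \<in> pairs \<Longrightarrow> n S \<le> l - 1"
  shows "b \<in> B \<Longrightarrow> n {b} = 1" and "S \<in> pairs \<Longrightarrow> n S = l - 1"
proof -
  have 1: "(\<Sum>b\<in>B. n {b}) \<le> (\<Sum>b\<in>B. 1)" using n_joint_le by (rule sum_mono)
  have 2: "(\<Sum>S\<in>pairs. n S) \<le> (\<Sum>S\<in>pairs. l - 1)" using assms(2) by (rule sum_mono)
  have "(\<Sum>b\<in>B. n {b}) + (\<Sum>S\<in>pairs. n S) = (\<Sum>b\<in>B. 1) + (\<Sum>S\<in>pairs. l - 1)"
    using assms(1) card_X card_pairs by (simp add: algebra_simps)
  then have eq: "(\<Sum>b\<in>B. n {b}) = (\<Sum>b\<in>B. 1)" "(\<Sum>S\<in>pairs. n S) = (\<Sum>S\<in>pairs. l - 1)"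
    using 1 2 by linarith+
  show "n {b} = 1" if "b \<in> B"
    using sum_mono_inv [OF eq(1) n_joint_le that finite_B] .
  show "n S = l - 1" if "S \<in> pairs"
    using sum_mono_inv [OF eq(2) assms(2) that finite_pairs] .
qed

section \<open>Collinear triples, and frames inside the matroid in the case of equality\<close>

lemma pairsI: "b \<in> B \<Longrightarrow> c \<in> B \<Longrightarrow> b \<noteq> c \<Longrightarrow> {b, c} \<in> pairs"
  by (simp add: pairs_def)

lemma notin_clos_single: "x \<in> X \<Longrightarrow> y \<in> X \<Longrightarrow> x \<noteq> y \<Longrightarrow> x \<notin> clos {y}"
  using simple [of x y] simple [of y y] by (auto simp: clos_def)

lemma triangle_exchange:
  assumes "x \<in> X" "y \<in> X" "x \<noteq> y" "x \<in> clos {y, z}" shows "z \<in> clos {x, y}"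
  using assms notin_clos_single [of x y] clos_exchange [of x z "{y}"] by (simp add: insert_commute)

lemma clos_of_rank:
  assumes "Y \<subseteq> X" "\<And>y. y \<in> Y \<Longrightarrow> supp y \<subseteq> T" "T \<subseteq> B" "card T \<le> \<rho> Y"
  shows "T \<subseteq> clos Y"
proof -
  have "Y \<subseteq> clos T" using assms in_clos_iff by blast
  then have "clos T \<subseteq> clos Y" using assms rank_sub_B [of T] by (intro clos_eqI) auto
  then show ?thesis using subset_clos by blast
qed

lemma rank_triple:
  assumes "x \<in> X" "y \<in> X" "z \<in> X" "x \<noteq> y" "z \<notin> clos {x, y}"
  shows "\<rho> {z, x, y} = 3"
  using rank_insert_notin [OF assms(5)] simple [of x y] assms by auto

text \<open>Projects \<open>x\<close> from \<open>e\<close> onto the line of \<open>c\<close> and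
  \<open>d\<close>, which already has as many points as possible: in the contraction of
  \<open>e\<close>, the image of \<open>x\<close> must be one of them. It is not a joint, because
  \<open>e\<close>, \<open>x\<close> and a joint at \<open>c\<close> or \<open>d\<close> span all
  three frame elements.\<close>

lemma perspective:
  assumes "b \<in> B" "c \<in> B" "d \<in> B" "b \<noteq> c" "c \<noteq> d" "b \<noteq> d"
    and e: "e \<in> line {b, c}" and x: "x \<in> line {b, d}"
    and "l + 1 \<le> n {c, d} + n {c} + n {d}"
  shows "\<exists>z\<in>line {c, d}. z \<in> clos {x, e}"
proof (rule ccontr)
  assume neg: "\<not> ?thesis"
  let ?S = "line {c, d} \<union> (line {c} \<union> line {d})" and ?T = "{b, c, d}"
  note e' = lineD [OF e] and x' = lineD [OF x]
  have "spanning {e} ?T u v" if "u \<in> ?S" "v \<in> ?S" "u \<noteq> v" for u v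
  proof -
    let ?Y = "insert u (insert v {e})"
    have "c \<in> clos ?Y" "d \<in> clos ?Y"
      using pair_in_clos [of u v c d ?Y] that assms(1-6) by (auto simp: line_def in_clos)
    moreover then have "b \<in> clos ?Y" using edge_in_clos' [of e b c ?Y] e' assms(1-6) by (auto simp: in_clos)
    ultimately show ?thesis by (simp add: spanning_def)
  qed
  moreover have "spanning {e} ?T x u" if u: "u \<in> ?S" for u
  proof -
    let ?Y = "insert x (insert u {e})"
    consider "u \<in> line {c, d}" | "u \<in> line {c}" | "u \<in> line {d}" using u by blast
    then show ?thesis
    proof cases
      case 1
      then have "u \<notin> clos {x, e}" using neg by blast
      moreover have "x \<noteq> e" using x' e' assms(1-6) by (auto simp: doubleton_eq_iff)
      ultimately have "\<rho> {u, x, e} = 3" using 1 x' e' by (intro rank_triple) (auto simp: line_def)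
      then have "?T \<subseteq> clos {u, x, e}" using 1 x' e' assms(1-6)
        by (intro clos_of_rank) (auto simp: line_def)
      then show ?thesis by (simp add: spanning_def insert_commute)
    next
      case 2
      have c: "c \<in> clos ?Y" using 2 joint_in_clos [of u c ?Y] by (auto simp: line_def in_clos)
      then have b: "b \<in> clos ?Y" using edge_in_clos' [of e b c ?Y] e' assms(1-6) by (auto simp: in_clos)
      then have "d \<in> clos ?Y" using edge_in_clos [of x b d ?Y] x' assms(1-6) by (auto simp: in_clos)
      with b c show ?thesis by (simp add: spanning_def)
    next
      case 3
      have d: "d \<in> clos ?Y" using 3 joint_in_clos [of u d ?Y] by (auto simp: line_def in_clos)
      then have b: "b \<in> clos ?Y" using edge_in_clos' [of x b d ?Y] x' assms(1-6) by (auto simp: in_clos)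
      then have "c \<in> clos ?Y" using edge_in_clos [of e b c ?Y] e' assms(1-6) by (auto simp: in_clos)
      with b d show ?thesis by (simp add: spanning_def)
    qed
  qed
  ultimately have "pairwise (spanning {e} ?T) (insert x ?S)"
    by (intro pairwise_spanning_insertI pairwiseI)
  moreover have "supp u \<subseteq> ?T" if "u \<in> {e} \<union> insert x ?S" for u
    using that e' x' by (auto simp: line_def)
  moreover have "insert x ?S \<subseteq> X" using x' by (auto simp: line_def)
  ultimately have "card (insert x ?S) \<le> l + 1"
    using assms(1-6) e' rank_le_card [of "{e}"] by (intro line_bound [of "{e}" _ ?T]) auto
  moreover have "card ?S = n {c, d} + card (line {c} \<union> line {d})"
    unfolding n_def using assms(1-6) finite_line by (intro card_Un_disjoint) (auto simp: line_def)
  moreover have "card (line {c} \<union> line {d}) = n {c} + n {d}" using assms by (simp add: card_line_Un)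
  moreover have "x \<notin> ?S" using x' assms(1-6) by (auto simp: line_def doubleton_eq_iff)
  ultimately show False using assms(9) finite_line by simp
qed

lemma clos_sub_frame:
  assumes "S \<subseteq> B" "S \<subseteq> clos T" "x \<in> X" "supp x = S" shows "x \<in> clos T"
  using in_clos_iff [of x S] clos_trans [of S T] assms by auto

text \<open>Joints are parallel to the frame elements and can replace them.\<close>

lemma frame_of_joints:
  assumes "\<And>b. b \<in> B \<Longrightarrow> n {b} = 1"
  shows "\<exists>B'\<subseteq>X. card B' = card B \<and> \<rho> B' = card B' \<and>
    (\<forall>x\<in>X. \<exists>S\<subseteq>B'. card S \<le> 2 \<and> x \<in> clos S)"
proof -
  have "\<exists>x. x \<in> line {b}" if "b \<in> B" for b
    using one_on_line [of "{b}"] assms [OF that] by auto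
  then obtain j where j: "\<And>b. b \<in> B \<Longrightarrow> j b \<in> line {b}" by metis
  then have jX: "j ` B \<subseteq> X" and supp: "\<And>b. b \<in> B \<Longrightarrow> supp (j b) = {b}" using lineD by blast+
  have "inj_on j B" using supp by (metis inj_onI singleton_inject)
  then have card: "card (j ` B) = card B" by (rule card_image)
  have clos: "S \<subseteq> clos (j ` S)" if "S \<subseteq> B" for S
  proof
    fix b assume "b \<in> S"
    then show "b \<in> clos (j ` S)"
      using joint_clos [of "j b" b] clos_mono [of "{j b}" "j ` S"] jX supp that by blast
  qed
  have "card B \<le> \<rho> (j ` B)" using rank_le_of_subset_clos [OF clos [of B]] indep_B by simp
  then have "\<rho> (j ` B) = card (j ` B)" using card rank_le_card [of "j ` B"] finite_B by simp
  moreover have "\<exists>S\<subseteq>j ` B. card S \<le> 2 \<and> x \<in> clos S" if x: "x \<in> X" for x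
  proof (intro exI [of _ "j ` supp x"] conjI)
    show "card (j ` supp x) \<le> 2"
      using card_supp [OF x] card_image_le [OF finite_supp, of j x] by auto
    show "x \<in> clos (j ` supp x)"
      using clos_sub_frame [of "supp x" "j ` supp x" x] clos [of "supp x"] x supp_sub_B by blast
  qed (use supp_sub_B in auto)
  ultimately show ?thesis using jX card by blast
qed

text \<open>Contracting a joint at \<open>c\<close> turns points of \<open>{c, p}\<close> and
  \<open>{c, q}\<close>, which exist by \<open>low\<close>, into joints at \<open>p\<close> and
  \<open>q\<close>; the pair \<open>{p, q}\<close> would then have too many points to be
  heavy.\<close>

lemma heavy_no_joint:
  assumes "2 \<le> l" "p \<in> B" "q \<in> nbr p" "c \<in> B - {p, q}" and low: "\<And>S. S \<in> pairs \<Longrightarrow> l - 1 \<le> n S"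
  shows "n {c} = 0"
proof (rule ccontr)
  assume "n {c} \<noteq> 0"
  then obtain j where j: "j \<in> line {c}" using one_on_line [of "{c}"] by auto
  have q: "q \<in> B" "p \<noteq> q" "l \<le> n {p, q}" using assms by (auto simp: nbr_def)
  have "1 \<le> n {c, p}" "1 \<le> n {c, q}"
    using low [OF pairsI [of c p]] low [OF pairsI [of c q]] assms(1,2,4) q by auto
  then have "n {p, q} + 1 \<le> l"
    using assms(2,4) q(1,2) j joint_clos [of j c]
    by (intro n_contract [of "{j}" "{c}" p q c c]) (auto simp: line_def)
  then show False using q by simp
qed

text \<open>Two points of \<open>{c, d}\<close> span \<open>c\<close> and \<open>d\<close> and could
  be contracted as a joint is in \<open>heavy_no_joint\<close>. So there is at most one, while
  \<open>low\<close> demands l - 1; this is the origin of \<open>l = 2\<close>.\<close>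

lemma heavy_other_pairs:
  assumes "2 \<le> l" "p \<in> B" "q \<in> nbr p" "c \<in> B - {p, q}" "d \<in> B - {p, q}" "c \<noteq> d"
    and low: "\<And>S. S \<in> pairs \<Longrightarrow> l - 1 \<le> n S"
  shows "l = 2" "n {c, d} = 1"
proof -
  have q: "q \<in> B" "p \<noteq> q" "l \<le> n {p, q}" using assms by (auto simp: nbr_def)
  have "n {c, d} \<le> 1"
  proof (rule ccontr)
    assume "\<not> n {c, d} \<le> 1"
    then obtain e f where ef: "e \<in> line {c, d}" "f \<in> line {c, d}" "e \<noteq> f"
      using two_on_line [of "{c, d}"] by auto
    then have "c \<in> clos {e, f}" "d \<in> clos {e, f}"
      using pair_in_clos [of e f c d "{e, f}"] assms(4,5) by (auto simp: line_def in_clos)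
    moreover have "1 \<le> n {c, p}" "1 \<le> n {c, q}"
      using low [OF pairsI [of c p]] low [OF pairsI [of c q]] assms(1,2,4) q by auto
    ultimately have "n {p, q} + 1 \<le> l"
      using assms(2,4,5) q(1,2) ef
      by (intro n_contract [of "{e, f}" "{c, d}" p q c c]) (auto simp: line_def)
    then show False using q by simp
  qed
  moreover have "l - 1 \<le> n {c, d}" using low [of "{c, d}"] assms(4,5,6) by (auto simp: pairs_def)
  ultimately show "l = 2" "n {c, d} = 1" using assms(1) by auto
qed

lemma nbr_other:
  assumes "2 \<le> l" "p \<in> B" "q \<in> nbr p" "c \<in> B - {p, q}"
    and low: "\<And>S. S \<in> pairs \<Longrightarrow> l - 1 \<le> n S"
  shows "nbr c \<subseteq> {p, q}"
proof
  fix d assume d: "d \<in> nbr c"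
  show "d \<in> {p, q}"
  proof (rule ccontr)
    assume "d \<notin> {p, q}"
    moreover have d': "d \<in> B" "d \<noteq> c" "l \<le> n {c, d}" using d by (auto simp: nbr_def)
    ultimately have "l = 2" "n {c, d} = 1"
      using heavy_other_pairs [OF assms(1-4) _ _ low, of d] by auto
    then show False using d' by linarith
  qed
qed

lemma no_heavy_path:
  assumes "2 \<le> l" "b \<in> B" "a \<in> nbr b" "c \<in> nbr b" "d \<in> nbr c" "distinct [a, b, c, d]"
  shows False
proof -
  have "n {b, c} + 1 \<le> l"
    using assms by (intro n_middle [of a b c d]) (auto simp: nbr_def insert_commute)
  then show False using assms by (simp add: nbr_def)
qed

text \<open>In the tight case with a heavy pair, the heavy pairs are the pairs containing a fixed vertex
  and \<open>l = 2\<close>. This configuration does occur, since the frame of \<open>M(K\<^sub>n)\<close> is not unique.\<close>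

lemma heavy_star:
  assumes l: "2 \<le> l" and B4: "4 \<le> card B" and p: "p \<in> B" and q: "q \<in> nbr p"
    and low: "\<And>S. S \<in> pairs \<Longrightarrow> l - 1 \<le> n S"
    and tight: "\<And>z. z \<in> B \<Longrightarrow> card (nbr z) * charge z + 2 * n {z} = 2"
    and c: "c \<in> B - {p, q}" "p \<in> nbr c"
  shows "l = 2 \<and> n {p} = 1 \<and> (\<forall>d\<in>B - {p}. n {p, d} = 2) \<and>
    (\<forall>d\<in>B - {p}. \<forall>e\<in>B - {p}. d \<noteq> e \<longrightarrow> n {d, e} = 1)"
proof -
  have qB: "q \<in> B" "p \<noteq> q" using q by (auto simp: nbr_def)
  \<comment> \<open>A fourth frame element yields a pair disjoint from \<open>{p, q}\<close>, hence
    \<open>l = 2\<close>.\<close>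
  have "card {p, q, c} \<le> 3" by (auto simp: card_insert_if)
  then have "\<not> B \<subseteq> {p, q, c}" using B4 card_mono [of "{p, q, c}" B] by auto
  then obtain d0 where d0: "d0 \<in> B - {p, q}" "d0 \<noteq> c" by blast
  have l2: "l = 2" using heavy_other_pairs [OF l p q c(1) d0(1)] d0 low by auto
  have cp: "c \<in> nbr p" using c nbr_sym by blast
  \<comment> \<open>\<open>d\<close> has no joint, so tightness gives it a heavy neighbour among
    \<open>p\<close> and \<open>q\<close>; with \<open>q\<close>, the heavy path \<open>c\<close>,
    \<open>p\<close>, \<open>q\<close> would continue to \<open>d\<close>.\<close>
  have adj: "p \<in> nbr d \<and> q \<notin> nbr d" if d: "d \<in> B - {p, q}" "d \<noteq> c" for d
  proof -
    have "n {d} \<noteq> 1" using heavy_no_joint [OF l p q d(1) low] by simp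
    then have "nbr d \<noteq> {}" using tight [of d] d by fastforce
    moreover have "nbr d \<subseteq> {p, q}" using nbr_other [OF l p q d(1) low] .
    moreover have "q \<notin> nbr d"
    proof
      assume "q \<in> nbr d"
      then have "d \<in> nbr q" using nbr_sym d by blast
      then show False using no_heavy_path [of p c q d] l p cp q d c qB by auto
    qed
    ultimately show ?thesis by blast
  qed
  have d0p: "d0 \<in> nbr p" using adj [OF d0] d0 nbr_sym by blast
  have qc: "q \<notin> nbr c"
    using no_heavy_path [of p d0 c q] l p cp d0p d0 c qB by auto
  have adj: "d \<in> nbr p" if "d \<in> B - {p}" for d
    using adj [of d] that q cp nbr_sym by blast
  have one: "n {q, d} = 1" if d: "d \<in> B - {p, q}" for d
  proof -
    obtain e where e: "e \<in> B - {p, q}" "e \<noteq> d" using c d0 by blast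
    have "e \<in> nbr p" using adj e by blast
    then show ?thesis using heavy_other_pairs(2) [OF l p _ _ _ _ low, of e q d] d e qB by auto
  qed
  have "n {d, e} = 1" if "d \<in> B - {p}" "e \<in> B - {p}" "d \<noteq> e" for d e
    using one [of d] one [of e] heavy_other_pairs(2) [OF l p q _ _ _ low, of d e] that
    by (cases "d = q"; cases "e = q") (auto simp: insert_commute)
  \<comment> \<open>Without its joint \<open>p\<close> would have to spend a positive charge, but a
    vertex with three heavy neighbours has charge 0.\<close>
  moreover have np: "n {p} = 1"
  proof (rule ccontr)
    assume "n {p} \<noteq> 1"
    then have n0: "n {p} = 0" using n_joint_le [OF p] by simp
    have "q \<in> nbr p" "c \<in> nbr p" "d0 \<in> nbr p" using q cp d0p by auto
    then have "card {q, c, d0} \<le> card (nbr p)" by (intro card_mono [OF finite_nbr]) auto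
    then have "3 \<le> card (nbr p)" using c d0 by auto
    then have "charge p = 0" by (simp add: charge_def)
    then show False using n0 tight [OF p] by simp
  qed
  moreover have "n {p, d} = 2" if "d \<in> B - {p}" for d
  proof -
    have "l \<le> n {p, d}" using adj that by (auto simp: nbr_def)
    moreover have "n {p, d} + n {p} + n {d} \<le> l + 1" using that p by (intro n_line_le) auto
    ultimately show ?thesis using np l2 by simp
  qed
  ultimately show ?thesis using l2 by blast
qed

text \<open>Otherwise contracting \<open>y\<close> and \<open>w\<close> identifies \<open>a\<close>,
  \<open>c\<close> and \<open>d\<close> and makes \<open>z\<close> a joint there. Together with the
  joint at \<open>p\<close> and the two points of \<open>{p, a}\<close> it forms a line of four
  points, one more than \<open>l + 1\<close>.\<close>

lemma star_triangle:
  assumes l2: "l = 2" and B: "p \<in> B" "a \<in> B" "c \<in> B" "d \<in> B" "distinct [p, a, c, d]"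
    and "n {p} = 1" "n {p, a} = 2"
    and y: "y \<in> line {a, c}" and w: "w \<in> line {a, d}" and z: "z \<in> line {c, d}"
  shows "z \<in> clos {y, w}"
proof (rule ccontr)
  assume neg: "z \<notin> clos {y, w}"
  obtain j where j: "j \<in> line {p}" using assms(7) by (metis one_on_line order_refl)
  note y' = lineD [OF y] and w' = lineD [OF w] and z' = lineD [OF z] and j' = lineD [OF j]
  let ?T = "{p, a, c, d}" and ?C = "{y, w}"
  have "{a, c} \<noteq> {a, d}" using B(5) by (simp add: doubleton_eq_iff)
  then have yw: "y \<noteq> w" using y'(2) w'(2) by metis
  have "\<rho> {z, y, w} = 3" using rank_triple [of y w z] y' w' z' yw neg by blast
  then have "{a, c, d} \<subseteq> clos {z, y, w}"
    using y' w' z' B by (intro clos_of_rank) auto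
  then have acd: "a \<in> clos Y" "c \<in> clos Y" "d \<in> clos Y" if "{z, y, w} \<subseteq> Y" for Y
    using clos_mono [OF that] by auto
  have yw_clos: "c \<in> clos Y" "d \<in> clos Y" if "{y, w} \<subseteq> Y" "a \<in> clos Y" for Y
    using edge_in_clos [of y a c Y] edge_in_clos [of w a d Y] y' w' B(5) that by (auto simp: in_clos)
  have zj: "spanning ?C ?T z j"
  proof -
    let ?Y = "insert z (insert j ?C)"
    have "p \<in> clos ?Y" using joint_in_clos [of j p ?Y] j' by (auto simp: in_clos)
    then show ?thesis using acd [of ?Y] by (auto simp: spanning_def)
  qed
  have zx: "spanning ?C ?T z x" if x: "x \<in> line {p, a}" for x
  proof -
    let ?Y = "insert z (insert x ?C)"
    have a: "a \<in> clos ?Y" "c \<in> clos ?Y" "d \<in> clos ?Y" using acd [of ?Y] by auto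
    then have "p \<in> clos ?Y" using edge_in_clos' [of x p a ?Y] lineD [OF x] B(5) by (auto simp: in_clos)
    then show ?thesis using a by (auto simp: spanning_def)
  qed
  have jx: "spanning ?C ?T j x" if x: "x \<in> line {p, a}" for x
  proof -
    let ?Y = "insert j (insert x ?C)"
    have p: "p \<in> clos ?Y" using joint_in_clos [of j p ?Y] j' by (auto simp: in_clos)
    then have "a \<in> clos ?Y" using edge_in_clos [of x p a ?Y] lineD [OF x] B(5) by (auto simp: in_clos)
    then show ?thesis using p yw_clos [of ?Y] by (auto simp: spanning_def)
  qed
  have xx: "spanning ?C ?T x x'" if x: "x \<in> line {p, a}" "x' \<in> line {p, a}" "x \<noteq> x'" for x x'
  proof -
    let ?Y = "insert x (insert x' ?C)"
    have "p \<in> clos ?Y" "a \<in> clos ?Y"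
      using pair_in_clos [of x x' p a ?Y] x B(1,2) lineD [OF x(1)] lineD [OF x(2)]
      by (auto simp: in_clos)
    then show ?thesis using yw_clos [of ?Y] by (auto simp: spanning_def)
  qed
  have P: "pairwise (spanning ?C ?T) (insert z (insert j (line {p, a})))"
    using zj zx jx xx by (intro pairwise_spanning_insertI pairwiseI) auto
  have supp: "supp x \<subseteq> ?T" if "x \<in> ?C \<union> insert z (insert j (line {p, a}))" for x
    using that y' w' z' j' by (auto simp: line_def)
  have "insert z (insert j (line {p, a})) \<subseteq> X" "?C \<subseteq> X" using y' w' z' j' by (auto simp: line_def)
  moreover have "\<rho> ?C = 2" using simple [of y w] y' w' yw by auto
  ultimately have "card (insert z (insert j (line {p, a}))) \<le> l + 1"
    using supp P B by (intro line_bound [of ?C _ ?T]) auto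
  moreover have "z \<noteq> j" "z \<notin> line {p, a}" "j \<notin> line {p, a}"
    using z' j' B(5) by (auto simp: line_def doubleton_eq_iff)
  ultimately show False using finite_line assms(8) l2 by (simp add: n_def)
qed

text \<open>The new frame is the joint at \<open>p\<close> with one of the two points of each
  \<open>{p, c}\<close>. The choice on \<open>{p, a}\<close> is free and fixes the others by
  projection through the single point of \<open>{a, c}\<close>. The difficulty lies in the pairs
  avoiding \<open>a\<close> and \<open>p\<close>, for which these choices have to fit
  together.\<close>

lemma frame_of_star:
  assumes l2: "l = 2" and B4: "4 \<le> card B" and p: "p \<in> B" "n {p} = 1"
    and two: "\<And>d. d \<in> B - {p} \<Longrightarrow> n {p, d} = 2"
    and one: "\<And>d e. d \<in> B - {p} \<Longrightarrow> e \<in> B - {p} \<Longrightarrow> d \<noteq> e \<Longrightarrow> n {d, e} = 1"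
  shows "\<exists>B'\<subseteq>X. card B' = card B \<and> \<rho> B' = card B' \<and>
    (\<forall>x\<in>X. \<exists>S\<subseteq>B'. card S \<le> 2 \<and> x \<in> clos S)"
proof -
  obtain j where j: "j \<in> line {p}" using p(2) by (metis one_on_line order_refl)
  have "\<not> B \<subseteq> {p}" using B4 card_mono [of "{p}" B] by auto
  then obtain a where a: "a \<in> B - {p}" by blast
  obtain x0 where x0: "x0 \<in> line {p, a}" using two [OF a] by (metis one_on_line one_le_numeral)
  have "\<exists>y x. y \<in> line {a, c} \<and> x \<in> line {p, c} \<and> x \<in> clos {x0, y}" if c: "c \<in> B - {p, a}" for c
  proof -
    have "1 \<le> n {a, c}" using one [of a c] a c by auto
    then obtain y where y: "y \<in> line {a, c}" by (rule one_on_line)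
    have "\<exists>z\<in>line {c, p}. z \<in> clos {x0, y}"
      using a c p l2 two [of c] y x0
      by (intro perspective [of a c p]) (auto simp: insert_commute)
    moreover have "{c, p} = {p, c}" by auto
    ultimately show ?thesis using y by auto
  qed
  then obtain y x' where yx': "\<And>c. c \<in> B - {p, a} \<Longrightarrow> y c \<in> line {a, c}"
    "\<And>c. c \<in> B - {p, a} \<Longrightarrow> x' c \<in> line {p, c}"
    "\<And>c. c \<in> B - {p, a} \<Longrightarrow> x' c \<in> clos {x0, y c}" by metis
  define x where "x c = (if c = a then x0 else x' c)" for c
  have x: "x c \<in> line {p, c}" if "c \<in> B - {p}" for c
    using that x0 yx'(2) [of c] by (auto simp: x_def)
  have xs: "x c \<in> X" "supp (x c) = {p, c}" if "c \<in> B - {p}" for c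
    using x [OF that] by (simp_all add: line_def)
  have js: "j \<in> X" "supp j = {p}" using j by (simp_all add: line_def)
  have x_neq: "x c \<noteq> x d" if "c \<in> B - {p}" "d \<in> B - {p}" "c \<noteq> d" for c d
    using xs(2) [OF that(1)] xs(2) [OF that(2)] that by (auto simp: doubleton_eq_iff)
  have jx: "j \<noteq> x c" if "c \<in> B - {p}" for c
    using xs(2) [OF that] js that by auto
  let ?B = "insert j (x ` (B - {p}))"
  have BX: "?B \<subseteq> X" using xs js by auto
  have "card (x ` (B - {p})) = card (B - {p})" using x_neq by (intro card_image inj_onI) blast
  moreover have "j \<notin> x ` (B - {p})" using jx by blast
  moreover have "card B > 0" using B4 by simp
  ultimately have card: "card ?B = card B" using finite_B p by simp
  have p_clos: "p \<in> clos Y" if "j \<in> Y" for Y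
    using joint_in_clos [OF js] that by (simp add: in_clos)
  have c_clos: "c \<in> clos Y" if "c \<in> B - {p}" "j \<in> Y" "x c \<in> Y" for c Y
    using edge_in_clos [OF xs [OF that(1)], of Y] that p_clos by (auto simp: in_clos)
  have "B \<subseteq> clos ?B"
  proof
    fix c assume "c \<in> B"
    then show "c \<in> clos ?B" using p_clos [of ?B] c_clos [of c ?B] by (cases "c = p") auto
  qed
  then have "card B \<le> \<rho> ?B" using rank_le_of_subset_clos [of B ?B] indep_B by simp
  then have "\<rho> ?B = card ?B" using card rank_le_card [of ?B] finite_B by simp
  moreover have "\<exists>S\<subseteq>?B. card S \<le> 2 \<and> z \<in> clos S" if z: "z \<in> X" for z
  proof -
    have n0: "n {d} = 0" if "d \<in> B - {p}" for d
      using n_line_le [of p d] two [OF that] that p l2 by auto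
    have ay: "z \<in> clos {x a, x c}" if c: "c \<in> B - {p, a}" and zc: "supp z = {a, c}" for c
    proof -
      have "card (line {a, c}) = 1" using one [of a c] a c by (auto simp: n_def)
      moreover have "z \<in> line {a, c}" using z zc by (simp add: line_def)
      ultimately have "z = y c" using yx'(1) [OF c] by (metis card_1_singletonE singletonD)
      then have "x c \<in> clos {x a, z}" using yx'(3) [OF c] c by (auto simp: x_def)
      then show ?thesis
        using triangle_exchange [of "x c" "x a" z] xs [of c] xs [of a] x_neq [of c a] a c
        by (auto simp: insert_commute)
    qed
    have cd: "z \<in> clos {x c, x d}"
      if c: "c \<in> B - {p, a}" and d: "d \<in> B - {p, a}" and cd: "c \<noteq> d" and zc: "supp z = {c, d}" for c d
    proof -
      have zl: "z \<in> line {d, c}" "z \<in> line {c, d}" using z zc by (auto simp: line_def)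
      have "\<exists>w\<in>line {c, p}. w \<in> clos {x d, z}"
        using c d cd p l2 two [of c] zl x [of d]
        by (intro perspective [of d c p]) (auto simp: insert_commute)
      then obtain w where w: "w \<in> line {p, c}" "w \<in> clos {x d, z}" by (auto simp: insert_commute)
      \<comment> \<open>Otherwise \<open>w\<close> and \<open>x c\<close> span \<open>p\<close> and
        \<open>c\<close>. By \<open>star_triangle\<close>, \<open>z\<close> and hence
        \<open>w\<close> lie in the closure of the three points \<open>?F\<close>, which would then
        contain four independent frame elements.\<close>
      have "w = x c"
      proof (rule ccontr)
        assume ne: "w \<noteq> x c"
        let ?F = "{x a, x c, x d}"
        have "y c \<in> clos {x a, x c}" "y d \<in> clos {x a, x d}"
        proof -
          have *: "y e \<in> clos {x a, x e}" if e: "e \<in> B - {p, a}" for e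
          proof -
            have "x e \<in> clos {x a, y e}" using yx'(3) [OF e] e by (auto simp: x_def)
            then show ?thesis
              using triangle_exchange [of "x e" "x a" "y e"] xs [of e] xs [of a] x_neq [of e a] a e
              by (auto simp: insert_commute)
          qed
          then show "y c \<in> clos {x a, x c}" "y d \<in> clos {x a, x d}" using c d by auto
        qed
        then have "{y c, y d} \<subseteq> clos ?F"
          using clos_mono [of "{x a, x c}" ?F] clos_mono [of "{x a, x d}" ?F] by auto
        moreover have "z \<in> clos {y c, y d}"
          using a c d cd p two [of a] yx'(1) [OF c] yx'(1) [OF d] zl
          by (intro star_triangle [OF l2, of p a c d]) auto
        ultimately have "z \<in> clos ?F" using clos_trans [of "{y c, y d}" ?F] by blast
        then have "w \<in> clos ?F" using w(2) clos_trans [of "{x d, z}" ?F] by (auto simp: in_clos)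
        then have pc: "p \<in> clos ?F" "c \<in> clos ?F"
          using pair_in_clos [of w "x c" p c ?F] ne w(1) xs [of c] c p by (auto simp: line_def in_clos)
        then have "a \<in> clos ?F" "d \<in> clos ?F"
          using edge_in_clos [of "x a" p a ?F] edge_in_clos [of "x d" p d ?F] xs [of a] xs [of d] a d
          by (auto simp: in_clos)
        with pc have "{p, a, c, d} \<subseteq> clos ?F" by blast
        then have "\<rho> {p, a, c, d} \<le> card ?F"
          using rank_le_of_subset_clos rank_le_card [of ?F] by (meson finite.intros order_trans)
        moreover have "\<rho> {p, a, c, d} = 4" using rank_sub_B [of "{p, a, c, d}"] p a c d cd by auto
        moreover have "card ?F \<le> 3" by (auto simp: card_insert_if)
        ultimately show False by linarith
      qed
      then show ?thesis
        using w(2) triangle_exchange [of "x c" "x d" z] xs [of c] xs [of d] x_neq [of c d] c d cd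
        by auto
    qed
    have two_sub: "\<exists>S\<subseteq>?B. card S \<le> 2 \<and> z \<in> clos S" if "z \<in> clos {u, v}" "u \<in> ?B" "v \<in> ?B" for u v
      using that by (intro exI [of _ "{u, v}"]) (auto simp: card_insert_if)
    consider b where "supp z = {b}" | c d where "supp z = {c, d}" "c \<noteq> d"
      using card_supp [OF z] by (auto simp: card_1_singleton_iff card_2_iff)
    then show ?thesis
    proof cases
      case 1
      then have "z \<in> line {b}" "b \<in> B" using z supp_sub_B [of z] by (auto simp: line_def)
      then have "n {b} \<noteq> 0" using finite_line [of "{b}"] by (auto simp: n_def)
      then have "b = p" using n0 [of b] \<open>b \<in> B\<close> by auto
      then show ?thesis using clos_sub_frame [of "{p}" "{j, j}" z] 1 p_clos [of "{j, j}"] z p two_sub [of j j] by auto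
    next
      case 2
      then have cdB: "c \<in> B" "d \<in> B" using supp_sub_B [of z] by auto
      have pcase: "z \<in> clos {j, x e}" if "supp z = {p, e}" "e \<in> B - {p}" for e
        using clos_sub_frame [of "{p, e}" "{j, x e}" z] that p_clos [of "{j, x e}"] c_clos [of e "{j, x e}"] z p
        by auto
      consider "c = p" | "d = p" | "c = a" "d \<noteq> p" | "d = a" "c \<noteq> p" | "c \<in> B - {p, a}" "d \<in> B - {p, a}"
        using cdB by blast
      then show ?thesis
      proof cases
        case 1
        then show ?thesis using pcase [of d] 2 cdB by (intro two_sub [of j "x d"]) auto
      next
        case c2: 2
        then show ?thesis using pcase [of c] 2 cdB by (intro two_sub [of j "x c"]) (auto simp: insert_commute)
      next
        case 3
        then show ?thesis using ay [of d] 2 cdB a by (intro two_sub [of "x a" "x d"]) auto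
      next
        case 4
        then show ?thesis using ay [of c] 2 cdB a
          by (intro two_sub [of "x a" "x c"]) (auto simp: insert_commute)
      next
        case 5
        then show ?thesis using cd [of c d] 2 cdB by (intro two_sub [of "x c" "x d"]) auto
      qed
    qed
  qed
  ultimately show ?thesis using BX card by blast
qed

lemma tight_frame:
  assumes l: "2 \<le> l" and B4: "4 \<le> card B" and eq: "card X = card B + (l - 1) * (card B choose 2)"
  shows "\<exists>B'\<subseteq>X. card B' = card B \<and> \<rho> B' = card B' \<and>
    (\<forall>x\<in>X. \<exists>S\<subseteq>B'. card S \<le> 2 \<and> x \<in> clos S)"
proof (cases "\<exists>p\<in>B. \<exists>q. q \<in> nbr p")
  case False
  have "n S \<le> l - 1" if "S \<in> pairs" for S
  proof -
    have "S \<subseteq> B" "card S = 2" using that by (simp_all add: pairs_def)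
    then obtain b c where bc: "S = {b, c}" "b \<noteq> c" "b \<in> B" "c \<in> B" by (auto simp: card_2_iff)
    then have "c \<notin> nbr b" using False by blast
    then show ?thesis using bc by (auto simp: nbr_def)
  qed
  then show ?thesis using tight_lines(1) [OF eq] by (intro frame_of_joints) blast
next
  case True
  then obtain p q where pq: "p \<in> B" "q \<in> nbr p" by blast
  note low = tight_charge(1) [OF l eq] and tight = tight_charge(2) [OF l eq]
  have qB: "q \<in> B" "p \<noteq> q" using pq by (auto simp: nbr_def)
  have "card {p, q} \<le> 2" by (auto simp: card_insert_if)
  then have "\<not> B \<subseteq> {p, q}" using B4 card_mono [of "{p, q}" B] by auto
  then obtain c where c: "c \<in> B - {p, q}" by blast
  \<comment> \<open>A third vertex lacks its joint, so it has a heavy neighbour; that one,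
    \<open>p\<close> or \<open>q\<close>, is the centre of the star.\<close>
  have "n {c} = 0" using heavy_no_joint [OF l pq c low] .
  then have "nbr c \<noteq> {}" using tight [of c] c by fastforce
  then have "p \<in> nbr c \<or> q \<in> nbr c" using nbr_other [OF l pq c low] by blast
  then obtain p' where p': "p' \<in> B" "l = 2 \<and> n {p'} = 1 \<and> (\<forall>d\<in>B - {p'}. n {p', d} = 2) \<and>
    (\<forall>d\<in>B - {p'}. \<forall>e\<in>B - {p'}. d \<noteq> e \<longrightarrow> n {d, e} = 1)"
  proof
    assume "p \<in> nbr c"
    from heavy_star [OF l B4 pq low tight c this] pq that show thesis by blast
  next
    assume "q \<in> nbr c"
    moreover have "c \<in> B - {q, p}" using c by blast
    ultimately have "l = 2 \<and> n {q} = 1 \<and> (\<forall>d\<in>B - {q}. n {q, d} = 2) \<and>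
        (\<forall>d\<in>B - {q}. \<forall>e\<in>B - {q}. d \<noteq> e \<longrightarrow> n {d, e} = 1)"
      by (intro heavy_star [OF l B4 qB(1) nbr_sym [OF pq] low tight])
    then show thesis by (rule that [OF qB(1)])
  qed
  show ?thesis by (rule frame_of_star [of p']) (use p' B4 in blast)+
qed

end

section \<open>Groups from triangles\<close>

text \<open>The points of \<open>L i j\<close> are to become the edges between \<open>i\<close> and \<open>j\<close>, and \<open>D\<close> the balanced
  triangles. With inverses given by reversing the direction, \<open>D\<close> is a composition of edges with
  distinct ends, and it is associative on four distinct vertices.\<close>

locale triangle_system =
  fixes V :: "'v :: linorder set" and L :: "'v \<Rightarrow> 'v \<Rightarrow> 'a set" and D :: "'a \<Rightarrow> 'a \<Rightarrow> 'a \<Rightarrow> bool"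
    and v0 :: 'v and a :: 'v and b :: 'v and c :: 'v
  assumes L_sym: "L i j = L j i"
    and L_nonempty: "i \<in> V \<Longrightarrow> j \<in> V \<Longrightarrow> i \<noteq> j \<Longrightarrow> L i j \<noteq> {}"
    and D_sym12: "D x y z \<Longrightarrow> D y x z"
    and D_sym23: "D x y z \<Longrightarrow> D x z y"
    and third: "i \<in> V \<Longrightarrow> j \<in> V \<Longrightarrow> m \<in> V \<Longrightarrow> distinct [i, j, m] \<Longrightarrow>
      x \<in> L i j \<Longrightarrow> y \<in> L j m \<Longrightarrow> \<exists>!z. z \<in> L i m \<and> D x y z"
    and tetrahedron: "i \<in> V \<Longrightarrow> j \<in> V \<Longrightarrow> m \<in> V \<Longrightarrow> k \<in> V \<Longrightarrow> distinct [i, j, m, k] \<Longrightarrow>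
      x \<in> L i j \<Longrightarrow> y \<in> L j m \<Longrightarrow> z \<in> L i m \<Longrightarrow> w \<in> L m k \<Longrightarrow> t \<in> L i k \<Longrightarrow> s \<in> L j k \<Longrightarrow>
      D x y z \<Longrightarrow> D z w t \<Longrightarrow> D y w s \<Longrightarrow> D x s t"
    and base: "v0 \<in> V" "j \<in> V \<Longrightarrow> v0 \<le> j"
    and others: "a \<in> V" "b \<in> V" "c \<in> V" "distinct [v0, a, b, c]"
begin

text \<open>A point carries no direction; the vertices given as arguments tell how it is traversed.
  The value is meaningful for distinct \<open>i\<close>, \<open>j\<close>, \<open>m\<close>.\<close>

definition comp :: "'v \<Rightarrow> 'v \<Rightarrow> 'v \<Rightarrow> 'a \<Rightarrow> 'a \<Rightarrow> 'a" where
  "comp i j m x y = (THE z. z \<in> L i m \<and> D x y z)"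

definition edge :: "'v \<Rightarrow> 'v \<Rightarrow> 'a \<Rightarrow> bool" where
  "edge i j x \<longleftrightarrow> i \<in> V \<and> j \<in> V \<and> i \<noteq> j \<and> x \<in> L i j"

lemma edge_sym: "edge i j x \<longleftrightarrow> edge j i x"
  using L_sym by (auto simp: edge_def)

lemma comp:
  assumes "edge i j x" "edge j m y" "i \<noteq> m"
  shows edge_comp: "edge i m (comp i j m x y)" and D_comp: "D x y (comp i j m x y)"
proof -
  have "\<exists>!z. z \<in> L i m \<and> D x y z" using assms by (intro third [of i j m]) (auto simp: edge_def)
  from theI' [OF this]
  show "edge i m (comp i j m x y)" "D x y (comp i j m x y)"
    using assms by (auto simp: edge_def comp_def)
qed

lemma comp_eqI:
  assumes "edge i j x" "edge j m y" "edge i m z" "D x y z"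
  shows "comp i j m x y = z"
proof -
  have "\<exists>!z. z \<in> L i m \<and> D x y z" using assms by (intro third [of i j m]) (auto simp: edge_def)
  then show ?thesis unfolding comp_def using assms by (intro the1_equality) (auto simp: edge_def)
qed

lemma D_cycle: "D x y z \<Longrightarrow> D z y x"
  using D_sym12 D_sym23 by blast

lemma comp_rev:
  assumes "edge i j x" "edge j m y" "i \<noteq> m"
  shows "comp m j i y x = comp i j m x y"
  using comp [OF assms] assms D_sym12 by (intro comp_eqI) (auto simp: edge_sym)

lemma cancel_right:
  assumes "edge i j x" "edge j m y" "i \<noteq> m"
  shows "comp i m j (comp i j m x y) y = x"
  using comp [OF assms] assms D_cycle by (intro comp_eqI) (auto simp: edge_sym)

lemma cancel_left:
  assumes "edge i j x" "edge j m y" "i \<noteq> m"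
  shows "comp j i m x (comp i j m x y) = y"
  using comp [OF assms] assms D_sym23 by (intro comp_eqI) (auto simp: edge_sym)

text \<open>Both bracketings give the edge from \<open>i\<close> to \<open>k\<close>, since three
  balanced faces of a tetrahedron make the fourth one balanced.\<close>

lemma comp_assoc:
  assumes "edge i j x" "edge j m y" "edge m k w" "distinct [i, j, m, k]"
  shows "comp i m k (comp i j m x y) w = comp i j k x (comp j m k y w)"
proof -
  let ?z = "comp i j m x y" and ?s = "comp j m k y w"
  have z: "edge i m ?z" "D x y ?z" using comp [of i j x m y] assms by auto
  have s: "edge j k ?s" "D y w ?s" using comp [of j m y k w] assms by auto
  have t: "edge i k (comp i m k ?z w)" "D ?z w (comp i m k ?z w)"
    using comp [of i m ?z k w] z assms by auto
  have "D x ?s (comp i m k ?z w)"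
    by (rule tetrahedron [of i j m k x y ?z w _ ?s])
      (use assms z s t in \<open>auto simp: edge_def\<close>)
  then show ?thesis using comp_eqI [of i j x k ?s] s t assms by auto
qed

section \<open>Reference edges and transport between vertices\<close>

definition W :: "'v set" where "W = V - {v0}"

text \<open>An arbitrary choice, as in switching a gain graph: these edges are declared to have
  trivial gain, and \<open>e j m\<close> below is then the edge of trivial gain from
  \<open>j\<close> to \<open>m\<close>.\<close>

definition u :: "'v \<Rightarrow> 'a" where "u j = (SOME x. x \<in> L v0 j)"

lemma edge_u: "j \<in> W \<Longrightarrow> edge v0 j (u j)"
  unfolding u_def edge_def using L_nonempty [of v0 j] base some_in_eq [of "L v0 j"] by (auto simp: W_def)

lemma edge_u': "j \<in> W \<Longrightarrow> edge j v0 (u j)"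
  using edge_u edge_sym by blast

definition e :: "'v \<Rightarrow> 'v \<Rightarrow> 'a" where "e j m = comp j v0 m (u j) (u m)"

lemma edge_e:
  assumes "j \<in> W" "m \<in> W" "j \<noteq> m"
  shows "edge j m (e j m)" "D (u j) (u m) (e j m)" "e m j = e j m"
  using comp [of j v0 "u j" m "u m"] comp_rev [of j v0 "u j" m "u m"] edge_u edge_u' assms
  by (auto simp: e_def)

text \<open>The triangle of neutral edges is the face opposite \<open>v0\<close> in a tetrahedron
  whose other faces are balanced by the definition of \<open>e\<close>.\<close>

lemma e_comp:
  assumes "j \<in> W" "m \<in> W" "n \<in> W" "distinct [j, m, n]"
  shows "comp j m n (e j m) (e m n) = e j n"
proof (rule comp_eqI)
  show "D (e j m) (e m n) (e j n)"
  proof (rule tetrahedron [of j m v0 n _ "u m" "u j" "u n"])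
    show "D (e j m) (u m) (u j)" using edge_e(2) [of j m] assms D_cycle by auto
    show "D (u j) (u n) (e j n)" "D (u m) (u n) (e m n)" using edge_e(2) assms by auto
  qed (use edge_e(1) edge_u edge_u' assms base in \<open>auto simp: edge_def W_def\<close>)
qed (use edge_e assms in auto)

lemma e_u': "j \<in> W \<Longrightarrow> m \<in> W \<Longrightarrow> j \<noteq> m \<Longrightarrow> comp j m v0 (e j m) (u m) = u j"
  using edge_e [of j m] edge_u' D_cycle by (intro comp_eqI) auto

text \<open>Moves an edge at \<open>v0\<close> from the end \<open>j\<close> to the end
  \<open>m\<close> along the neutral edge, which preserves its gain.\<close>

definition T :: "'v \<Rightarrow> 'v \<Rightarrow> 'a \<Rightarrow> 'a" where
  "T j m x = (if j = m then x else comp v0 j m x (e j m))"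

lemma W_neq: "j \<in> W \<Longrightarrow> j \<noteq> v0" "j \<in> W \<Longrightarrow> v0 \<noteq> j"
  by (auto simp: W_def)

lemma edge_T: "j \<in> W \<Longrightarrow> m \<in> W \<Longrightarrow> edge v0 j x \<Longrightarrow> edge v0 m (T j m x)"
  using edge_comp [of v0 j x m "e j m"] edge_e W_neq by (auto simp: T_def)

lemma T_T:
  assumes "j \<in> W" "m \<in> W" "n \<in> W" "edge v0 j x"
  shows "T m n (T j m x) = T j n x"
proof -
  consider "j = m" | "m = n" | "j = n" "j \<noteq> m" | "distinct [j, m, n]" by auto
  then show ?thesis
  proof cases
    case 3
    then show ?thesis
      using cancel_right [of v0 j x m "e j m"] edge_e [of j m] assms W_neq by (auto simp: T_def)
  next
    case 4
    then have "comp v0 m n (comp v0 j m x (e j m)) (e m n) = comp v0 j n x (comp j m n (e j m) (e m n))"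
      using assms edge_e W_neq by (intro comp_assoc) auto
    then show ?thesis using e_comp assms 4 by (auto simp: T_def)
  qed (auto simp: T_def)
qed

lemma T_refl [simp]: "T j j x = x"
  by (simp add: T_def)

text \<open>The group element of an edge at \<open>v0\<close> is its difference from the reference edge \<open>u\<close> with
  the same ends, so the product of \<open>x\<close> and \<open>v\<close> is \<open>x\<close> followed by \<open>(u j)\<^sup>-\<^sup>1 v\<close>.\<close>

definition mul :: "'v \<Rightarrow> 'v \<Rightarrow> 'a \<Rightarrow> 'a \<Rightarrow> 'a" where
  "mul j m x v = comp v0 j m x (comp j v0 m (u j) v)"

lemma edge_u_comp: "j \<in> W \<Longrightarrow> m \<in> W \<Longrightarrow> j \<noteq> m \<Longrightarrow> edge v0 m v \<Longrightarrow> edge j m (comp j v0 m (u j) v)"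
  using edge_comp [of j v0 "u j" m v] edge_u' by auto

lemma edge_mul:
  "j \<in> W \<Longrightarrow> m \<in> W \<Longrightarrow> j \<noteq> m \<Longrightarrow> edge v0 j x \<Longrightarrow> edge v0 m v \<Longrightarrow> edge v0 m (mul j m x v)"
  unfolding mul_def using edge_comp [of v0 j x m] edge_u_comp W_neq by simp

text \<open>Together with \<open>mul_right\<close>: a product is compatible with moving a factor
  along a neutral edge. This makes multiplication independent of the vertices where it is carried
  out.\<close>

lemma mul_left:
  assumes "j \<in> W" "j' \<in> W" "m \<in> W" "distinct [j, j', m]" "edge v0 j x" "edge v0 m v"
  shows "mul j' m (T j j' x) v = mul j m x v"
proof -
  have "mul j' m (T j j' x) v
      = comp v0 j' m (comp v0 j j' x (e j j')) (comp j' v0 m (u j') v)"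
    using assms by (simp add: mul_def T_def)
  also have "\<dots> = comp v0 j m x (comp j j' m (e j j') (comp j' v0 m (u j') v))"
    using assms edge_e edge_u_comp W_neq by (intro comp_assoc) auto
  also have "comp j j' m (e j j') (comp j' v0 m (u j') v) = comp j v0 m (comp j j' v0 (e j j') (u j')) v"
    using assms edge_e edge_u' W_neq by (intro comp_assoc [symmetric]) auto
  also have "comp j j' v0 (e j j') (u j') = u j" using assms e_u' by auto
  finally show ?thesis by (simp add: mul_def)
qed

lemma mul_right:
  assumes "j \<in> W" "m \<in> W" "m' \<in> W" "distinct [j, m, m']" "edge v0 j x" "edge v0 m v"
  shows "mul j m' x (T m m' v) = T m m' (mul j m x v)"
proof -
  have "comp j v0 m' (u j) (comp v0 m m' v (e m m')) = comp j m m' (comp j v0 m (u j) v) (e m m')"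
    using assms edge_e edge_u' W_neq by (intro comp_assoc [symmetric]) auto
  moreover have "comp v0 m m' (comp v0 j m x (comp j v0 m (u j) v)) (e m m')
      = comp v0 j m' x (comp j m m' (comp j v0 m (u j) v) (e m m'))"
    using assms edge_e edge_u_comp W_neq by (intro comp_assoc) auto
  ultimately show ?thesis using assms by (simp add: mul_def T_def)
qed

lemma mul_assoc:
  assumes "j \<in> W" "m \<in> W" "n \<in> W" "distinct [j, m, n]" "edge v0 j x" "edge v0 m v" "edge v0 n w"
  shows "mul m n (mul j m x v) w = mul j n x (mul m n v w)"
proof -
  have "comp v0 m n (comp v0 j m x (comp j v0 m (u j) v)) (comp m v0 n (u m) w)
      = comp v0 j n x (comp j m n (comp j v0 m (u j) v) (comp m v0 n (u m) w))"
    using assms edge_u_comp W_neq by (intro comp_assoc) auto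
  also have "comp j m n (comp j v0 m (u j) v) (comp m v0 n (u m) w)
      = comp j v0 n (u j) (comp v0 m n v (comp m v0 n (u m) w))"
    using assms edge_u_comp edge_u' W_neq by (intro comp_assoc) auto
  finally show ?thesis by (simp add: mul_def)
qed

lemma mul_one: "j \<in> W \<Longrightarrow> m \<in> W \<Longrightarrow> j \<noteq> m \<Longrightarrow> edge v0 m v \<Longrightarrow> mul j m (u j) v = v"
  unfolding mul_def using cancel_left [of j v0 "u j" m v] edge_u' by auto

text \<open>Two edges between \<open>v0\<close> and \<open>a\<close> cannot be composed directly, as
  composition requires distinct vertices; they are moved to \<open>j\<close> and \<open>m\<close>,
  and the result is moved back to \<open>a\<close>.\<close>

definition op :: "'v \<Rightarrow> 'v \<Rightarrow> 'a \<Rightarrow> 'a \<Rightarrow> 'a" where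
  "op j m g h = T m a (mul j m (T a j g) (T a m h))"

lemma abc: "a \<in> W" "b \<in> W" "c \<in> W" "a \<noteq> b" "a \<noteq> c" "b \<noteq> c" "b \<noteq> a" "c \<noteq> a" "c \<noteq> b"
  using others by (auto simp: W_def)

lemma op_left:
  assumes "j \<in> W" "j' \<in> W" "m \<in> W" "distinct [j, j', m]" "edge v0 a g" "edge v0 a h"
  shows "op j' m g h = op j m g h"
proof -
  have "T a j' g = T j j' (T a j g)" using assms abc T_T by simp
  then show ?thesis using mul_left [of j j' m "T a j g" "T a m h"] assms abc edge_T
    by (simp add: op_def)
qed

lemma op_right:
  assumes "j \<in> W" "m \<in> W" "m' \<in> W" "distinct [j, m, m']" "edge v0 a g" "edge v0 a h"
  shows "op j m' g h = op j m g h"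
proof -
  have "T a m' h = T m m' (T a m h)" using assms abc T_T by simp
  then have "op j m' g h = T m' a (T m m' (mul j m (T a j g) (T a m h)))"
    using mul_right [of j m m' "T a j g" "T a m h"] assms abc edge_T by (simp add: op_def)
  also have "\<dots> = op j m g h"
    using assms abc edge_T edge_mul T_T by (simp add: op_def)
  finally show ?thesis .
qed

text \<open>The two vertices are changed one at a time; a third vertex of \<open>W\<close> keeps
  them distinct on the way.\<close>

lemma op_indep:
  assumes "j \<in> W" "m \<in> W" "j \<noteq> m" "edge v0 a g" "edge v0 a h"
  shows "op j m g h = op a b g h"
proof -
  have 1: "op j m g h = op a b g h" if "j \<in> W" "m \<in> W" "j \<noteq> m" "m \<noteq> a" for j m
  proof -
    have "op j m g h = op a m g h" using op_left [of j a m g h] that assms abc by (cases "j = a") auto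
    also have "\<dots> = op a b g h" using op_right [of a m b g h] that assms abc by (cases "m = b") auto
    finally show ?thesis .
  qed
  show ?thesis
  proof (cases "m = a")
    case True
    obtain m' where m': "m' \<in> W" "m' \<noteq> j" "m' \<noteq> a" using abc by metis
    then have "op j m g h = op j m' g h" using op_right [of j m' m g h] assms True by auto
    then show ?thesis using 1 [of j m'] m' assms by auto
  qed (use 1 assms in auto)
qed

section \<open>The group and the gains\<close>

definition G :: "'a monoid" where
  "G = \<lparr>carrier = L v0 a, mult = op a b, one = u a\<rparr>"

lemma carrier_G: "x \<in> carrier G \<longleftrightarrow> edge v0 a x"
  using base others by (auto simp: G_def edge_def)

lemma mult_G: "j \<in> W \<Longrightarrow> m \<in> W \<Longrightarrow> j \<noteq> m \<Longrightarrow> g \<in> carrier G \<Longrightarrow> h \<in> carrier G \<Longrightarrow> g \<otimes>\<^bsub>G\<^esub> h = op j m g h"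
  using op_indep unfolding carrier_G by (simp add: G_def)

lemma edge_op:
  "j \<in> W \<Longrightarrow> m \<in> W \<Longrightarrow> j \<noteq> m \<Longrightarrow> edge v0 a g \<Longrightarrow> edge v0 a h \<Longrightarrow> edge v0 a (op j m g h)"
  unfolding op_def using abc by (intro edge_T edge_mul) auto

lemma group_G: "group G"
proof (rule groupI)
  show closed: "g \<otimes>\<^bsub>G\<^esub> h \<in> carrier G" if "g \<in> carrier G" "h \<in> carrier G" for g h
    using that edge_op abc by (simp add: mult_G [of a b] carrier_G)
  show one: "\<one>\<^bsub>G\<^esub> \<in> carrier G" unfolding carrier_G using edge_u abc by (simp add: G_def)
  show "\<one>\<^bsub>G\<^esub> \<otimes>\<^bsub>G\<^esub> g = g" if g: "g \<in> carrier G" for g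
  proof -
    have "edge v0 a g" using g carrier_G by simp
    then have "T b a (mul a b (u a) (T a b g)) = g"
      using mul_one [of a b "T a b g"] edge_T [of a b g] T_T [of a b a g] abc by simp
    then show ?thesis using mult_G [of a b "\<one>\<^bsub>G\<^esub>" g] one g abc by (simp add: op_def G_def)
  qed
  show "g \<otimes>\<^bsub>G\<^esub> h \<otimes>\<^bsub>G\<^esub> k = g \<otimes>\<^bsub>G\<^esub> (h \<otimes>\<^bsub>G\<^esub> k)" if ghk: "g \<in> carrier G" "h \<in> carrier G" "k \<in> carrier G" for g h k
  proof -
    \<comment> \<open>The three factors are placed at distinct vertices, where
      \<open>mul_assoc\<close> applies.\<close>
    let ?h = "T a b h" and ?k = "T a c k"
    have e: "edge v0 a g" "edge v0 b ?h" "edge v0 c ?k" "edge v0 a h" "edge v0 a k"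
      using ghk edge_T abc by (auto simp: carrier_G)
    have gh: "g \<otimes>\<^bsub>G\<^esub> h \<in> carrier G" and hk: "h \<otimes>\<^bsub>G\<^esub> k \<in> carrier G" using closed ghk by auto
    have "g \<otimes>\<^bsub>G\<^esub> h = T b a (mul a b g ?h)"
      using mult_G [of a b g h] ghk abc by (simp add: op_def)
    then have 1: "T a b (g \<otimes>\<^bsub>G\<^esub> h) = mul a b g ?h"
      using T_T [of b a b "mul a b g ?h"] edge_mul [of a b g ?h] e abc by simp
    have "h \<otimes>\<^bsub>G\<^esub> k = T c a (mul b c ?h ?k)"
      using mult_G [of b c h k] ghk abc by (simp add: op_def)
    then have 2: "T a c (h \<otimes>\<^bsub>G\<^esub> k) = mul b c ?h ?k"
      using T_T [of c a c "mul b c ?h ?k"] edge_mul [of b c ?h ?k] e abc by simp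
    have "g \<otimes>\<^bsub>G\<^esub> h \<otimes>\<^bsub>G\<^esub> k = T c a (mul b c (mul a b g ?h) ?k)"
      using mult_G [of b c "g \<otimes>\<^bsub>G\<^esub> h" k] gh ghk abc 1 by (simp add: op_def)
    also have "\<dots> = T c a (mul a c g (mul b c ?h ?k))"
      using mul_assoc [of a b c g ?h ?k] e abc by simp
    also have "\<dots> = g \<otimes>\<^bsub>G\<^esub> (h \<otimes>\<^bsub>G\<^esub> k)"
      using mult_G [of a c g "h \<otimes>\<^bsub>G\<^esub> k"] hk ghk abc 2 by (simp add: op_def)
    finally show ?thesis .
  qed
  show "\<exists>h\<in>carrier G. h \<otimes>\<^bsub>G\<^esub> g = \<one>\<^bsub>G\<^esub>" if g: "g \<in> carrier G" for g
  proof -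
    have eg: "edge v0 a g" using g carrier_G by simp
    \<comment> \<open>\<open>?v\<close> represents \<open>g\<close> as an edge from \<open>b\<close>
      to \<open>a\<close>, and \<open>?x\<close> is the edge from \<open>v0\<close> to
      \<open>b\<close> whose composite with \<open>?v\<close> is the unit
      \<open>u a\<close>.\<close>
    let ?v = "comp b v0 a (u b) g"
    let ?x = "comp v0 a b (u a) ?v"
    have v: "edge b a ?v" "edge a b ?v" using edge_u_comp [of b a g] eg abc edge_sym by auto
    have x: "edge v0 b ?x" using edge_comp [of v0 a "u a" b ?v] v edge_u abc W_neq by auto
    have "comp v0 b a ?x ?v = u a"
      using cancel_right [of v0 a "u a" b ?v] v edge_u abc W_neq by auto
    then have "mul b a ?x g = u a" by (simp add: mul_def)
    moreover have "T a b (T b a ?x) = ?x" using T_T [of b a b ?x] x abc by simp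
    moreover have "T b a ?x \<in> carrier G" unfolding carrier_G using edge_T x abc by auto
    ultimately show ?thesis
      using mult_G [of b a "T b a ?x" g] g abc
      by (intro bexI [of _ "T b a ?x"]) (simp_all add: op_def G_def)
  qed
qed

text \<open>The reference edge of the tail turns \<open>x\<close> into an edge at \<open>v0\<close>,
  which is moved to \<open>a\<close>. At the tail \<open>v0\<close> there is no such reference edge,
  hence the case distinction.\<close>

definition \<gamma> :: "'v \<Rightarrow> 'v \<Rightarrow> 'a \<Rightarrow> 'a" where
  "\<gamma> i j x = T j a (if i = v0 then x else comp v0 i j (u i) x)"

lemma mult_comp:
  assumes "j \<in> W" "m \<in> W" "j \<noteq> m" "edge v0 j x" "edge j m y"
  shows "T m a (comp v0 j m x y) = \<gamma> v0 j x \<otimes>\<^bsub>G\<^esub> \<gamma> j m y"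
proof -
  let ?v = "comp v0 j m (u j) y"
  have v: "edge v0 m ?v" using edge_comp [of v0 j "u j" m y] edge_u assms W_neq by auto
  have "\<gamma> v0 j x \<in> carrier G" "\<gamma> j m y \<in> carrier G"
    using assms v edge_T abc W_neq by (auto simp: carrier_G \<gamma>_def)
  then have "\<gamma> v0 j x \<otimes>\<^bsub>G\<^esub> \<gamma> j m y = T m a (mul j m (T a j (T j a x)) (T a m (T m a ?v)))"
    using mult_G [of j m "\<gamma> v0 j x" "\<gamma> j m y"] assms W_neq by (simp add: op_def \<gamma>_def)
  also have "\<dots> = T m a (mul j m x ?v)"
    using T_T [of j a j x] T_T [of m a m ?v] v assms abc by simp
  also have "mul j m x ?v = comp v0 j m x y"
    unfolding mul_def using cancel_left [of v0 j "u j" m y] edge_u assms W_neq by simp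
  finally show ?thesis by simp
qed

lemma bij_T: assumes "j \<in> W" shows "bij_betw (T j a) (L v0 j) (L v0 a)"
proof (rule bij_betw_byWitness [where f' = "T a j"])
  have "x \<in> L v0 j \<longleftrightarrow> edge v0 j x" if "j \<in> W" for x j
    using that base by (auto simp: edge_def W_def)
  then show "\<forall>x\<in>L v0 j. T a j (T j a x) = x" "\<forall>x\<in>L v0 a. T j a (T a j x) = x"
    "T j a ` L v0 j \<subseteq> L v0 a" "T a j ` L v0 a \<subseteq> L v0 j"
    using T_T edge_T assms abc by auto
qed

lemma bij_comp_u:
  assumes "i \<in> W" "j \<in> W" "i \<noteq> j" shows "bij_betw (comp v0 i j (u i)) (L i j) (L v0 j)"
proof (rule bij_betw_byWitness [where f' = "comp i v0 j (u i)"])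
  have *: "x \<in> L v0 j \<longleftrightarrow> edge v0 j x" "x \<in> L i j \<longleftrightarrow> edge i j x" for x
    using assms base by (auto simp: edge_def W_def)
  show "\<forall>x\<in>L i j. comp i v0 j (u i) (comp v0 i j (u i) x) = x"
    "\<forall>x\<in>L v0 j. comp v0 i j (u i) (comp i v0 j (u i) x) = x"
    using cancel_left [of v0 i "u i" j] cancel_left [of i v0 "u i" j] edge_u edge_u' assms W_neq
    by (simp_all add: *)
  show "comp v0 i j (u i) ` L i j \<subseteq> L v0 j" "comp i v0 j (u i) ` L v0 j \<subseteq> L i j"
    using edge_comp [of v0 i "u i" j] edge_comp [of i v0 "u i" j] edge_u edge_u' assms W_neq
    by (auto simp: *)
qed

text \<open>Since \<open>v0\<close> is the least vertex, it is never the head of an ordered pair,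
  and the multiplication rule for increasing triples involves no inverses. Triples that avoid
  \<open>v0\<close> are reduced to \<open>mult_comp\<close> by composing with the reference edge of
  their tail.\<close>

theorem group_of_triangles:
  shows "group G" "carrier G = L v0 a"
    "i \<in> V \<Longrightarrow> j \<in> V \<Longrightarrow> i < j \<Longrightarrow> bij_betw (\<gamma> i j) (L i j) (carrier G)"
    "i \<in> V \<Longrightarrow> j \<in> V \<Longrightarrow> m \<in> V \<Longrightarrow> i < j \<Longrightarrow> j < m \<Longrightarrow> x \<in> L i j \<Longrightarrow> y \<in> L j m \<Longrightarrow> z \<in> L i m \<Longrightarrow>
      D x y z \<Longrightarrow> \<gamma> i m z = \<gamma> i j x \<otimes>\<^bsub>G\<^esub> \<gamma> j m y"
proof -
  show "group G" by (rule group_G)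
  show car: "carrier G = L v0 a" by (simp add: G_def)
  show "bij_betw (\<gamma> i j) (L i j) (carrier G)" if ij: "i \<in> V" "j \<in> V" "i < j"
  proof -
    have j: "j \<in> W" using base(2) [of i] ij by (auto simp: W_def)
    show ?thesis
    proof (cases "i = v0")
      case True
      then have "\<gamma> i j = T j a" by (auto simp: \<gamma>_def)
      then show ?thesis using bij_T [OF j] True car by simp
    next
      case False
      then have "\<gamma> i j = T j a \<circ> comp v0 i j (u i)" by (auto simp: \<gamma>_def)
      moreover have "i \<in> W" using False ij by (simp add: W_def)
      ultimately show ?thesis
        using bij_betw_trans [OF bij_comp_u bij_T] j ij car by auto
    qed
  qed
  show "\<gamma> i m z = \<gamma> i j x \<otimes>\<^bsub>G\<^esub> \<gamma> j m y"
    if ijm: "i \<in> V" "j \<in> V" "m \<in> V" "i < j" "j < m" and xyz: "x \<in> L i j" "y \<in> L j m" "z \<in> L i m" "D x y z"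
  proof -
    have W: "j \<in> W" "m \<in> W" using base(2) [of i] ijm by (auto simp: W_def)
    have edges: "edge i j x" "edge j m y" "edge i m z" using ijm xyz by (auto simp: edge_def)
    then have z: "z = comp i j m x y" using comp_eqI xyz by simp
    show ?thesis
    proof (cases "i = v0")
      case True
      then show ?thesis using mult_comp [of j m x y] W edges ijm z by (simp add: \<gamma>_def)
    next
      case False
      then have i: "i \<in> W" using ijm by (simp add: W_def)
      have "distinct [v0, i, j, m]" using i W W_neq ijm by auto
      then have "comp v0 i m (u i) z = comp v0 j m (comp v0 i j (u i) x) y"
        unfolding z using comp_assoc [of v0 i "u i" j x m y] edges edge_u i by simp
      moreover have "edge v0 j (comp v0 i j (u i) x)"
        using edge_comp edges edge_u i W W_neq by auto
      ultimately show ?thesis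
        using mult_comp [of j m "comp v0 i j (u i) x" y] W edges ijm False by (simp add: \<gamma>_def)
    qed
  qed
qed

end

section \<open>Paths, cycles, thetas and handcuffs\<close>

text \<open>Functions on indices instead of lists: segments become images of intervals, and reversal
  and rotation act on the indices.\<close>

definition fpath :: "nat \<Rightarrow> (nat \<Rightarrow> nat) \<Rightarrow> (nat \<Rightarrow> 'g dedge) \<Rightarrow> bool" where
  "fpath k vs es \<longleftrightarrow> inj_on vs {..k} \<and> (\<forall>t<k. ends (es t) = {vs t, vs (Suc t)})"

lemma fpath_vs_eq: "fpath k vs es \<Longrightarrow> s \<le> k \<Longrightarrow> t \<le> k \<Longrightarrow> vs s = vs t \<longleftrightarrow> s = t"
  by (auto simp: fpath_def inj_on_def)

lemma fpath_ends: "fpath k vs es \<Longrightarrow> t < k \<Longrightarrow> ends (es t) = {vs t, vs (Suc t)}"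
  by (simp add: fpath_def)

lemma fpath_inj_es: assumes "fpath k vs es" shows "inj_on es {..<k}"
proof (rule inj_onI)
  fix s t assume st: "s \<in> {..<k}" "t \<in> {..<k}" "es s = es t"
  then have "{vs s, vs (Suc s)} = {vs t, vs (Suc t)}" 
    using fpath_ends [OF assms, of s] fpath_ends [OF assms, of t] by simp
  then have "vs s = vs t \<or> vs s = vs (Suc t) \<and> vs (Suc s) = vs t" by (auto simp: doubleton_eq_iff)
  then show "s = t" using st by (elim disjE) (auto simp: fpath_vs_eq [OF assms])
qed

lemma fpath_path:
  assumes "fpath k vs es" "i \<le> j" "j \<le> k"
  shows "path (vs i) (vs j) (vs ` {i..j}) (es ` {i..<j})"
  unfolding path_def
proof (intro exI [of _ "map vs [i..<Suc j]"] exI [of _ "map es [i..<j]"] conjI)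
  show "distinct (map vs [i..<Suc j])"
    using assms fpath_vs_eq [OF assms(1)] by (auto simp: distinct_map inj_on_def)
  show "\<forall>t<length (map es [i..<j]). ends (map es [i..<j] ! t) =
      {map vs [i..<Suc j] ! t, map vs [i..<Suc j] ! Suc t}"
    using assms fpath_ends [OF assms(1)] by (simp del: upt_Suc)
  show "vs ` {i..j} = set (map vs [i..<Suc j])"
    by (simp add: atLeastLessThanSuc_atLeastAtMost del: upt_Suc)
  show "hd (map vs [i..<Suc j]) = vs i" using assms by (simp add: hd_map del: upt_Suc)
qed (use assms in auto)

lemma path_rev: assumes "path u v V P" shows "path v u V P"
proof -
  obtain vs es where p: "length vs = Suc (length es)" "distinct vs" "hd vs = u" "last vs = v"
    "V = set vs" "P = set es" "\<And>k. k < length es \<Longrightarrow> ends (es ! k) = {vs ! k, vs ! Suc k}"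
    using assms by (auto simp: path_def)
  have "ends (rev es ! k) = {rev vs ! k, rev vs ! Suc k}" if "k < length es" for k
  proof -
    have "rev es ! k = es ! (length es - Suc k)" using that by (simp add: rev_nth)
    moreover have "rev vs ! k = vs ! Suc (length es - Suc k)" "rev vs ! Suc k = vs ! (length es - Suc k)"
      using that p(1) by (simp_all add: rev_nth Suc_diff_Suc)
    ultimately show ?thesis using p(7) [of "length es - Suc k"] that by (simp add: insert_commute)
  qed
  then show ?thesis unfolding path_def using p
    by (intro exI [of _ "rev vs"] exI [of _ "rev es"]) (auto simp: hd_rev last_rev)
qed

lemma path_Cons:
  assumes "path u v V P" "ends e = {w, u}" "w \<notin> V"
  shows "path w v (insert w V) (insert e P)"
proof -
  obtain vs es where p: "length vs = Suc (length es)" "distinct vs" "hd vs = u" "last vs = v"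
    "V = set vs" "P = set es" "\<And>k. k < length es \<Longrightarrow> ends (es ! k) = {vs ! k, vs ! Suc k}"
    using assms by (auto simp: path_def)
  then have "vs \<noteq> []" by auto
  then have "ends ((e # es) ! k) = {(w # vs) ! k, (w # vs) ! Suc k}" if "k < length (e # es)" for k
    using that p(7) [of "k - 1"] assms(2) p(3) by (cases k) (auto simp: hd_conv_nth)
  then show ?thesis unfolding path_def using p \<open>vs \<noteq> []\<close> assms(3)
    by (intro exI [of _ "w # vs"] exI [of _ "e # es"]) auto
qed

text \<open>For \<open>i = j\<close> the segment is a single vertex and \<open>e\<close> is a loop,
  so cycles with one vertex are covered.\<close>

lemma fpath_cycle_seq:
  assumes "fpath k vs es" "i \<le> j" "j \<le> k" "ends e = {vs i, vs j}" "e \<notin> es ` {i..<j}"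
  shows "cycle_seq (map vs [i..<Suc j]) (map es [i..<j] @ [e])"
  unfolding cycle_seq_def
proof (intro conjI allI impI)
  show "distinct (map vs [i..<Suc j])"
    using assms fpath_vs_eq [OF assms(1)] by (auto simp: distinct_map inj_on_def)
  have "inj_on es {i..<j}" using fpath_inj_es [OF assms(1)] assms(3) by (auto simp: inj_on_def)
  then show "distinct (map es [i..<j] @ [e])" using assms(5) by (auto simp: distinct_map)
  fix t assume t: "t < length (map es [i..<j] @ [e])"
  show "ends ((map es [i..<j] @ [e]) ! t) = {map vs [i..<Suc j] ! t,
      map vs [i..<Suc j] ! (Suc t mod length (map es [i..<j] @ [e]))}"
  proof (cases "t < j - i")
    case True
    then show ?thesis using assms fpath_ends [OF assms(1), of "i + t"]
      by (simp add: nth_append del: upt_Suc)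
  next
    case False
    then have "t = j - i" using t by auto
    then show ?thesis using assms by (simp add: nth_append insert_commute del: upt_Suc)
  qed
qed (use assms in auto)

lemma fpath_cycle:
  assumes "fpath k vs es" "i \<le> j" "j \<le> k" "ends e = {vs i, vs j}" "e \<notin> es ` {i..<j}"
  shows "cycle (vs ` {i..j}) (insert e (es ` {i..<j}))"
  unfolding cycle_def
  using fpath_cycle_seq [OF assms] assms
  by (intro exI [of _ "map vs [i..<Suc j]"] exI [of _ "map es [i..<j] @ [e]"])
    (simp add: atLeastLessThanSuc_atLeastAtMost del: upt_Suc)

text \<open>For \<open>i \<le> j\<close> the two extra edges close cycles at the two ends of the
  path, which meet in one vertex or are joined by the segment between them. For \<open>j < i\<close>
  they overlap, and \<open>vs j\<close> and \<open>vs i\<close> are the branch vertices of a theta.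
  Loops are the cases \<open>i = 0\<close> and \<open>j = k\<close>.\<close>

lemma theta_or_handcuff:
  assumes p: "fpath k vs es" and ij: "i \<le> k" "j \<le> k"
    and e: "ends e = {vs 0, vs i}" "e \<notin> es ` {..<k}"
    and f: "ends f = {vs k, vs j}" "f \<notin> es ` {..<k}" and "e \<noteq> f"
  shows "\<exists>S \<subseteq> insert e (insert f (es ` {..<k})). theta S \<or> handcuff S"
proof -
  note eq = fpath_vs_eq [OF p]
  have es_eq: "es s = es t \<longleftrightarrow> s = t" if "s < k" "t < k" for s t
    using fpath_inj_es [OF p] that by (auto simp: inj_on_def)
  have Int_vs: "vs ` A \<inter> vs ` B = vs ` (A \<inter> B)" if "A \<subseteq> {..k}" "B \<subseteq> {..k}" for A B
    using inj_on_image_Int [of vs "{..k}" A B] p that by (simp add: fpath_def)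
  have ee: "e \<notin> es ` {s..<t}" "f \<notin> es ` {s..<t}" if "t \<le> k" for s t using e(2) f(2) that by auto
  show ?thesis
  proof (cases "i \<le> j")
    case True
    let ?V1 = "vs ` {0..i}" and ?C1 = "insert e (es ` {0..<i})"
    let ?V2 = "vs ` {j..k}" and ?C2 = "insert f (es ` {j..<k})"
    have C1: "cycle ?V1 ?C1" using fpath_cycle [OF p, of 0 i e] ij e ee(1) [of i 0] by simp
    have C2: "cycle ?V2 ?C2" using fpath_cycle [OF p, of j k f] ij f ee(2) [of k j]
      by (simp add: insert_commute)
    have ne: "?C1 \<noteq> ?C2" using \<open>e \<noteq> f\<close> ee(1) [of k j] by auto
    show ?thesis
    proof (cases "i = j")
      case True
      have "?V1 \<inter> ?V2 = vs ` ({0..i} \<inter> {j..k})" using ij by (intro Int_vs) auto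
      also have "{0..i} \<inter> {j..k} = {i}" using ij True by auto
      finally have "?V1 \<inter> ?V2 = {vs i}" by simp
      then have "handcuff (?C1 \<union> ?C2)" unfolding handcuff_def using C1 C2 ne by blast
      moreover have "?C1 \<union> ?C2 \<subseteq> insert e (insert f (es ` {..<k}))" using ij by auto
      ultimately show ?thesis by blast
    next
      case False
      have "?V1 \<inter> ?V2 = vs ` ({0..i} \<inter> {j..k})" using ij by (intro Int_vs) auto
      also have "{0..i} \<inter> {j..k} = {}" using True False by auto
      finally have 0: "?V1 \<inter> ?V2 = {}" by simp
      have "vs ` {i..j} \<inter> ?V1 = vs ` ({i..j} \<inter> {0..i})" using ij by (intro Int_vs) auto
      also have "{i..j} \<inter> {0..i} = {i}" using True by auto
      finally have 1: "vs ` {i..j} \<inter> ?V1 = {vs i}" by simp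
      have "vs ` {i..j} \<inter> ?V2 = vs ` ({i..j} \<inter> {j..k})" using ij by (intro Int_vs) auto
      also have "{i..j} \<inter> {j..k} = {j}" using True ij by auto
      finally have 2: "vs ` {i..j} \<inter> ?V2 = {vs j}" by simp
      have "path (vs i) (vs j) (vs ` {i..j}) (es ` {i..<j})" using fpath_path [OF p] True ij by simp
      then have "handcuff (?C1 \<union> ?C2 \<union> es ` {i..<j})"
        unfolding handcuff_def using C1 C2 ne 0 1 2 by blast
      moreover have "?C1 \<union> ?C2 \<union> es ` {i..<j} \<subseteq> insert e (insert f (es ` {..<k}))" using ij by auto
      ultimately show ?thesis by blast
    qed
  next
    case False
    let ?V1 = "vs ` {j..i}" and ?P1 = "es ` {j..<i}"
    let ?V2 = "insert (vs i) (vs ` {0..j})" and ?P2 = "insert e (es ` {0..<j})"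
    let ?V3 = "insert (vs j) (vs ` {i..k})" and ?P3 = "insert f (es ` {i..<k})"
    have P1: "path (vs j) (vs i) ?V1 ?P1" using fpath_path [OF p, of j i] False ij by simp
    have "path (vs 0) (vs j) (vs ` {0..j}) (es ` {0..<j})" using fpath_path [OF p, of 0 j] ij by simp
    moreover have "vs i \<notin> vs ` {0..j}" using False ij eq by auto
    ultimately have P2: "path (vs j) (vs i) ?V2 ?P2"
      using e(1) by (intro path_rev [OF path_Cons]) (auto simp: insert_commute)
    have "path (vs k) (vs i) (vs ` {i..k}) (es ` {i..<k})"
      using path_rev [OF fpath_path [OF p, of i k]] ij by simp
    moreover have "vs j \<notin> vs ` {i..k}" using False ij eq by auto
    ultimately have P3: "path (vs j) (vs i) ?V3 ?P3"
      using f(1) by (intro path_Cons) (auto simp: insert_commute)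
    have V2: "?V2 = vs ` insert i {0..j}" and V3: "?V3 = vs ` insert j {i..k}" by auto
    have "?V1 \<inter> ?V2 = vs ` ({j..i} \<inter> insert i {0..j})" unfolding V2 using ij by (intro Int_vs) auto
    also have "{j..i} \<inter> insert i {0..j} = {j, i}" using False by auto
    finally have 12: "?V1 \<inter> ?V2 = {vs j, vs i}" by simp
    have "?V1 \<inter> ?V3 = vs ` ({j..i} \<inter> insert j {i..k})" unfolding V3 using ij by (intro Int_vs) auto
    also have "{j..i} \<inter> insert j {i..k} = {j, i}" using False ij by auto
    finally have 13: "?V1 \<inter> ?V3 = {vs j, vs i}" by simp
    have "?V2 \<inter> ?V3 = vs ` (insert i {0..j} \<inter> insert j {i..k})"
      unfolding V2 V3 using ij by (intro Int_vs) auto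
    also have "insert i {0..j} \<inter> insert j {i..k} = {j, i}" using False ij by auto
    finally have 23: "?V2 \<inter> ?V3 = {vs j, vs i}" by simp
    have E: "es ` {j..<i} \<inter> es ` {0..<j} = {}" "es ` {j..<i} \<inter> es ` {i..<k} = {}"
      "es ` {0..<j} \<inter> es ` {i..<k} = {}"
      using False ij by (auto simp: es_eq)
    have D: "?P1 \<inter> ?P2 = {}" "?P1 \<inter> ?P3 = {}" "?P2 \<inter> ?P3 = {}"
      using E ee(1) [of i j] ee(2) [of i j] ee(1) [of k i] ee(2) [of j 0] ij \<open>e \<noteq> f\<close> by auto
    have "vs j \<noteq> vs i" using False ij eq by auto
    then have "theta (?P1 \<union> ?P2 \<union> ?P3)"
      unfolding theta_def using P1 P2 P3 12 13 23 D by blast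
    moreover have "?P1 \<union> ?P2 \<union> ?P3 \<subseteq> insert e (insert f (es ` {..<k}))" using ij by auto
    ultimately show ?thesis by blast
  qed
qed

section \<open>Numbers of vertices and edges\<close>

lemma path_card:
  assumes "path u v V P"
  shows "finite V" "finite P" "card V = Suc (card P)" "\<And>e. e \<in> P \<Longrightarrow> ends e \<subseteq> V"
    "\<And>e. e \<in> P \<Longrightarrow> card (ends e) = 2" "u \<in> V" "v \<in> V"
proof -
  obtain vs es where p: "length vs = Suc (length es)" "distinct vs" "hd vs = u" "last vs = v"
    "V = set vs" "P = set es" "\<And>k. k < length es \<Longrightarrow> ends (es ! k) = {vs ! k, vs ! Suc k}"
    using assms by (auto simp: path_def)
  have eq: "vs ! s = vs ! t \<longleftrightarrow> s = t" if "s < length vs" "t < length vs" for s t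
    using p(2) that by (simp add: nth_eq_iff_index_eq)
  have "distinct es"
    unfolding distinct_conv_nth
  proof (intro allI impI)
    fix s t assume st: "s < length es" "t < length es" "s \<noteq> t"
    show "es ! s \<noteq> es ! t"
    proof
      assume "es ! s = es ! t"
      then have "{vs ! s, vs ! Suc s} = {vs ! t, vs ! Suc t}" 
        using p(7) [of s] p(7) [of t] st by simp
      then have "vs ! s = vs ! t \<or> vs ! s = vs ! Suc t \<and> vs ! Suc s = vs ! t"
        by (auto simp: doubleton_eq_iff)
      then show False using st p(1) by (elim disjE) (auto simp: eq)
    qed
  qed
  then show "card V = Suc (card P)" using p by (simp add: distinct_card)
  show "ends e \<subseteq> V" "card (ends e) = 2" if e: "e \<in> P" for e
  proof -
    obtain t where t: "t < length es" "e = es ! t" using e p(6) by (auto simp: in_set_conv_nth)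
    then have "ends e = {vs ! t, vs ! Suc t}" using p(7) by simp
    moreover have "vs ! t \<noteq> vs ! Suc t" using eq [of t "Suc t"] t p(1) by simp
    ultimately show "ends e \<subseteq> V" "card (ends e) = 2" using t p(1,5) by auto
  qed
  have "vs \<noteq> []" using p(1) by auto
  then show "u \<in> V" "v \<in> V" using p by auto
  show "finite V" "finite P" using p by auto
qed

text \<open>The claim about an edge with one end is used to separate the edge sets of two cycles
  that share a single vertex.\<close>

lemma cycle_card:
  assumes "cycle V C"
  shows "finite V" "finite C" "card V = card C" "\<And>e. e \<in> C \<Longrightarrow> ends e \<subseteq> V" "\<And>e. e \<in> C \<Longrightarrow> ends e \<noteq> {}"
    "\<And>e x. e \<in> C \<Longrightarrow> ends e = {x} \<Longrightarrow> C = {e}"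
proof -
  obtain vs es where c: "cycle_seq vs es" "V = set vs" "C = set es" using assms by (auto simp: cycle_def)
  then have c': "length vs = length es" "distinct vs" "distinct es" "es \<noteq> []"
    "\<And>k. k < length es \<Longrightarrow> ends (es ! k) = {vs ! k, vs ! (Suc k mod length es)}"
    by (auto simp: cycle_seq_def)
  show "finite V" "finite C" "card V = card C" using c c' by (auto simp: distinct_card)
  have *: "\<exists>t<length es. e = es ! t \<and> ends e = {vs ! t, vs ! (Suc t mod length es)}" if "e \<in> C" for e
    using that c c' by (auto simp: in_set_conv_nth)
  show "ends e \<subseteq> V" "ends e \<noteq> {}" if "e \<in> C" for e
    using * [OF that] c c' by (auto intro!: nth_mem)
  show "C = {e}" if e: "e \<in> C" and loop: "ends e = {x}" for e x
  proof -
    obtain t where t: "t < length es" "e = es ! t" "ends e = {vs ! t, vs ! (Suc t mod length es)}"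
      using * [OF e] by blast
    have "vs ! t = vs ! (Suc t mod length es)" using t(3) loop by auto
    moreover have "Suc t mod length es < length es" using c'(4) by simp
    ultimately have "t = Suc t mod length es" using t c'(1,2) by (simp add: nth_eq_iff_index_eq)
    have "length es = 1"
    proof (cases "Suc t < length es")
      case False
      then have "length es = Suc t" using t(1) by simp
      then show ?thesis using \<open>t = Suc t mod length es\<close> by simp
    qed (use \<open>t = Suc t mod length es\<close> in simp)
    then show ?thesis using e c(3) by (cases es) auto
  qed
qed

text \<open>Three paths with common ends have one edge more than vertices. As ranks are bounded by
  numbers of vertices, this makes thetas dependent whatever their gains are;
  \<open>handcuff_card\<close> does the same for handcuffs.\<close>

lemma theta_card:
  assumes "theta S"
  obtains V where "finite V" "finite S" "card V < card S" "\<And>e. e \<in> S \<Longrightarrow> ends e \<subseteq> V"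
proof -
  obtain u v V1 V2 V3 P1 P2 P3 where t: "u \<noteq> v" "path u v V1 P1" "path u v V2 P2" "path u v V3 P3"
    "V1 \<inter> V2 = {u, v}" "V1 \<inter> V3 = {u, v}" "V2 \<inter> V3 = {u, v}"
    "P1 \<inter> P2 = {}" "P1 \<inter> P3 = {}" "P2 \<inter> P3 = {}" "S = P1 \<union> P2 \<union> P3"
    using assms unfolding theta_def by blast
  note c1 = path_card [OF t(2)] and c2 = path_card [OF t(3)] and c3 = path_card [OF t(4)]
  have "(V1 \<union> V2) \<inter> V3 = {u, v}" using t by blast
  then have "card (V1 \<union> V2 \<union> V3) + 2 = card (V1 \<union> V2) + card V3"
    using card_Un_Int [of "V1 \<union> V2" V3] c1(1) c2(1) c3(1) t(1) by simp
  moreover have "card (V1 \<union> V2) + 2 = card V1 + card V2"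
    using card_Un_Int [of V1 V2] c1(1) c2(1) t(1,5) by simp
  moreover have "card S = card P1 + card P2 + card P3"
    unfolding t(11) using c1(2) c2(2) c3(2) t(8-10)
    by (subst card_Un_disjoint) (auto simp: card_Un_disjoint Int_Un_distrib2)
  ultimately have "card (V1 \<union> V2 \<union> V3) < card S" using c1(3) c2(3) c3(3) by linarith
  moreover have "ends e \<subseteq> V1 \<union> V2 \<union> V3" if "e \<in> S" for e
    using that t(11) c1(4) c2(4) c3(4) by blast
  ultimately show thesis using that [of "V1 \<union> V2 \<union> V3"] c1 c2 c3 t(11) by auto
qed

lemma handcuff_card:
  assumes "handcuff S"
  obtains V where "finite V" "finite S" "card V < card S" "\<And>e. e \<in> S \<Longrightarrow> ends e \<subseteq> V"
proof -
  obtain V1 V2 C1 C2 where h: "cycle V1 C1" "cycle V2 C2" "C1 \<noteq> C2"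
    "(\<exists>u. V1 \<inter> V2 = {u}) \<and> S = C1 \<union> C2 \<or>
     V1 \<inter> V2 = {} \<and> (\<exists>u v V P. path u v V P \<and> V \<inter> V1 = {u} \<and> V \<inter> V2 = {v} \<and> S = C1 \<union> C2 \<union> P)"
    using assms unfolding handcuff_def by blast
  note c1 = cycle_card [OF h(1)] and c2 = cycle_card [OF h(2)]
  \<comment> \<open>A common edge would be a loop at \<open>u\<close>, and each of the two cycles
    would consist of it alone.\<close>
  have C: "C1 \<inter> C2 = {}" if "V1 \<inter> V2 \<subseteq> {u}" for u
  proof (rule ccontr)
    assume "C1 \<inter> C2 \<noteq> {}"
    then obtain e where e: "e \<in> C1" "e \<in> C2" by blast
    then have "ends e \<subseteq> {u}" "ends e \<noteq> {}" using c1(4,5) c2(4) that by blast+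
    then have "ends e = {u}" by blast
    then show False using c1(6) c2(6) e h(3) by blast
  qed
  from h(4) show thesis
  proof (elim disjE conjE exE)
    fix u assume u: "V1 \<inter> V2 = {u}" and S: "S = C1 \<union> C2"
    have "card (V1 \<union> V2) + 1 = card V1 + card V2"
      using card_Un_Int [of V1 V2] c1(1) c2(1) u by simp
    moreover have "card S = card C1 + card C2"
      unfolding S using C [of u] u c1(2) c2(2) by (intro card_Un_disjoint) auto
    ultimately have "card (V1 \<union> V2) < card S" using c1(3) c2(3) by linarith
    moreover have "ends e \<subseteq> V1 \<union> V2" if "e \<in> S" for e using that S c1(4) c2(4) by blast
    ultimately show thesis using that [of "V1 \<union> V2"] c1 c2 S by auto
  next
    fix u v V P
    assume V12: "V1 \<inter> V2 = {}" and P: "path u v V P" "V \<inter> V1 = {u}" "V \<inter> V2 = {v}"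
      and S: "S = C1 \<union> C2 \<union> P"
    note c3 = path_card [OF P(1)]
    have no: "e \<notin> P" if "ends e \<subseteq> V1 \<or> ends e \<subseteq> V2" for e
    proof
      assume e: "e \<in> P"
      then have "ends e \<subseteq> {u} \<or> ends e \<subseteq> {v}" using that P c3(4) [OF e] by blast
      then have "card (ends e) \<le> 1" using card_mono [of "{u}" "ends e"] card_mono [of "{v}" "ends e"] by auto
      then show False using c3(5) [OF e] by simp
    qed
    have "(V1 \<union> V2) \<inter> V = {u, v}" "u \<noteq> v" using P V12 by blast+
    then have "card (V1 \<union> V2 \<union> V) + 2 = card (V1 \<union> V2) + card V"
      using card_Un_Int [of "V1 \<union> V2" V] c1(1) c2(1) c3(1) by simp
    moreover have "card (V1 \<union> V2) = card V1 + card V2"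
      using V12 c1(1) c2(1) by (intro card_Un_disjoint)
    moreover have "card S = card (C1 \<union> C2) + card P"
      unfolding S using no c1(2,4) c2(2,4) c3(2) by (intro card_Un_disjoint) blast+
    moreover have "card (C1 \<union> C2) = card C1 + card C2"
      using C V12 c1(2) c2(2) by (intro card_Un_disjoint) auto
    ultimately have "card (V1 \<union> V2 \<union> V) < card S" using c1(3) c2(3) c3(3) by linarith
    moreover have "ends e \<subseteq> V1 \<union> V2 \<union> V" if "e \<in> S" for e using that S c1(4) c2(4) c3(4) by blast
    ultimately show thesis using that [of "V1 \<union> V2 \<union> V"] c1 c2 c3 S by auto
  qed
qed

section \<open>Rank functions of Dowling geometries\<close>

text \<open>A list of properties that is easily checked for a matroid with coordinates and already
  determines which sets of edges are independent: loops as a basis, simplicity, links on the lines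
  of their loops, and collinearity of triples given by products.\<close>

locale dowling_rank = rank_function \<rho> "dowling_edges n \<Gamma>" + group \<Gamma>
  for \<rho> :: "'g dedge set \<Rightarrow> nat" and n :: nat and \<Gamma> :: "('g, 'm) monoid_scheme" +
  assumes rank_loops: "\<rho> (Loop ` {1..n}) = n"
    and rank_two: "e \<in> dowling_edges n \<Gamma> \<Longrightarrow> f \<in> dowling_edges n \<Gamma> \<Longrightarrow> e \<noteq> f \<Longrightarrow> \<rho> {e, f} = 2"
    and link_clos: "Link i j g \<in> dowling_edges n \<Gamma> \<Longrightarrow> Link i j g \<in> clos {Loop i, Loop j}"
    and link_mult_clos: "i \<in> {1..n} \<Longrightarrow> j \<in> {1..n} \<Longrightarrow> m \<in> {1..n} \<Longrightarrow> i < j \<Longrightarrow> j < m \<Longrightarrow>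
      g \<in> carrier \<Gamma> \<Longrightarrow> h \<in> carrier \<Gamma> \<Longrightarrow>
      Link i m (g \<otimes>\<^bsub>\<Gamma>\<^esub> h) \<in> clos {Link i j g, Link j m h}"
begin

abbreviation "edges \<equiv> dowling_edges n \<Gamma>"

lemma ends_sub: "e \<in> edges \<Longrightarrow> ends e \<subseteq> {1..n}"
  by (auto simp: dowling_edges_def)

lemma ends_nonempty: "e \<in> edges \<Longrightarrow> ends e \<noteq> {}"
  by (auto simp: dowling_edges_def)

lemma ends_other: "e \<in> edges \<Longrightarrow> u \<in> ends e \<Longrightarrow> \<exists>w. ends e = {u, w}"
  by (auto simp: dowling_edges_def)

lemma ends_loop: assumes "e \<in> edges" "ends e = {u}" shows "e = Loop u"
proof (cases e)
  case (Link i j g)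
  then have "i < j" "{i, j} = {u}" using assms by (auto simp: dowling_edges_def)
  then show ?thesis by (simp add: doubleton_eq_iff)
qed (use assms in simp)

lemma Loop_in: "u \<in> {1..n} \<Longrightarrow> Loop u \<in> edges"
  by (auto simp: dowling_edges_def)

lemma rank_loops_sub: assumes "U \<subseteq> {1..n}" shows "\<rho> (Loop ` U) = card U"
proof -
  have card: "card (Loop ` A :: 'g dedge set) = card A" for A
    by (rule card_image) (simp add: inj_on_def)
  have "\<rho> (Loop ` {1..n}) = card (Loop ` {1..n} :: 'g dedge set)"
    by (simp only: rank_loops card) simp
  then have "\<rho> (Loop ` U) = card (Loop ` U :: 'g dedge set)"
    by (rule indep_subset) (use assms in blast)+
  then show ?thesis by (simp add: card)
qed

lemma edge_clos_loops: assumes "e \<in> edges" "ends e \<subseteq> U" shows "e \<in> clos (Loop ` U)"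
proof (cases e)
  case (Loop i)
  then show ?thesis using assms by (auto intro: in_clos)
next
  case (Link i j g)
  then have "e \<in> clos {Loop i, Loop j}" using assms link_clos by simp
  moreover have "{Loop i, Loop j} \<subseteq> Loop ` U" using assms Link by auto
  ultimately show ?thesis using clos_mono by blast
qed

lemma rank_le_ends:
  assumes "S \<subseteq> edges" "finite V" "\<And>e. e \<in> S \<Longrightarrow> ends e \<subseteq> V"
  shows "\<rho> S \<le> card V"
proof -
  have "\<rho> S \<le> \<rho> (Loop ` V)" using assms edge_clos_loops by (intro rank_le_of_subset_clos) blast
  also have "\<dots> \<le> card (Loop ` V :: 'g dedge set)" using assms by (intro rank_le_card) auto
  also have "\<dots> \<le> card V" using assms by (intro card_image_le)
  finally show ?thesis .
qed

lemma Loop_notin_clos: assumes "u \<in> {1..n}" shows "Loop u \<notin> clos (Loop ` ({1..n} - {u}))"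
proof
  assume "Loop u \<in> clos (Loop ` ({1..n} - {u}))"
  then have "\<rho> (insert (Loop u) (Loop ` ({1..n} - {u}))) = \<rho> (Loop ` ({1..n} - {u}))"
    by (simp add: clos_def)
  moreover have "insert (Loop u :: 'g dedge) (Loop ` ({1..n} - {u})) = Loop ` {1..n}"
    using assms by auto
  moreover have "\<rho> (Loop ` ({1..n} - {u})) = n - 1" using rank_loops_sub [of "{1..n} - {u}"] assms by simp
  ultimately show False using rank_loops assms by auto
qed

text \<open>Distinct edges with the same ends have rank 2, as much as the loops at these
  ends.\<close>

lemma parallel_clos:
  assumes "e \<in> edges" "f \<in> edges" "e \<noteq> f" "ends e \<subseteq> {i, j}" "ends f \<subseteq> {i, j}" "{e, f} \<subseteq> clos Y"
  shows "Loop i \<in> clos Y" "Loop j \<in> clos Y"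
proof -
  have "\<rho> {Loop i, Loop j} \<le> \<rho> {e, f}"
    using rank_two [OF assms(1-3)] rank_le_card [of "{Loop i, Loop j}"]
    by (auto simp: card_insert_if split: if_splits)
  moreover have "{e, f} \<subseteq> clos {Loop i, Loop j}"
    using edge_clos_loops [of e "{i, j}"] edge_clos_loops [of f "{i, j}"] assms by simp
  ultimately have "clos {Loop i, Loop j} \<subseteq> clos {e, f}" by (intro clos_eqI)
  also have "\<dots> \<subseteq> clos Y" using assms(6) by (rule clos_trans)
  finally show "Loop i \<in> clos Y" "Loop j \<in> clos Y" using subset_clos [of "{Loop i, Loop j}"] by auto
qed

lemma Loop_other_clos:
  assumes "e \<in> edges" "ends e = {u, w}" "e \<in> clos Y" "Loop u \<in> clos Y" shows "Loop w \<in> clos Y"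
proof (cases "u = w")
  case False
  then have "e \<noteq> Loop u" using assms(2) by auto
  moreover have "u \<in> {1..n}" using ends_sub [OF assms(1)] assms(2) by auto
  ultimately show ?thesis
    using parallel_clos [of e "Loop u" u w Y] assms Loop_in by auto
qed (use assms in simp)

lemma edge_notin_clos:
  assumes "e \<in> edges" "u \<in> ends e" shows "e \<notin> clos (Loop ` ({1..n} - {u}))"
proof
  assume e: "e \<in> clos (Loop ` ({1..n} - {u}))"
  obtain w where w: "ends e = {u, w}" using ends_other assms by blast
  have u: "u \<in> {1..n}" "w \<in> {1..n}" using ends_sub [OF assms(1)] w by auto
  have "Loop u \<in> clos (Loop ` ({1..n} - {u}))"
  proof (cases "u = w")
    case True then show ?thesis using ends_loop [OF assms(1)] w e by auto
  next
    case False
    then have "Loop w \<in> clos (Loop ` ({1..n} - {u}))" using u by (auto intro: in_clos)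
    then show ?thesis using Loop_other_clos [of e w u] assms e w by (simp add: insert_commute)
  qed
  then show False using Loop_notin_clos u by blast
qed

text \<open>The edge that has gain \<open>g\<close> when traversed from \<open>u\<close> to
  \<open>v\<close>. Links exist only in increasing direction, so the gain is inverted
  otherwise.\<close>

definition dir_link :: "nat \<Rightarrow> nat \<Rightarrow> 'g \<Rightarrow> 'g dedge" where
  "dir_link u v g = (if u < v then Link u v g else Link v u (inv\<^bsub>\<Gamma>\<^esub> g))"

lemma dir_link:
  assumes "u \<in> {1..n}" "v \<in> {1..n}" "u \<noteq> v" "g \<in> carrier \<Gamma>"
  shows "dir_link u v g \<in> edges" "ends (dir_link u v g) = {u, v}"
    "dir_link v u (inv\<^bsub>\<Gamma>\<^esub> g) = dir_link u v g" "gain_from \<Gamma> u (dir_link u v g) = g"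
  using assms by (auto simp: dir_link_def dowling_edges_def)

lemma edge_dir_link:
  assumes "e \<in> edges" "ends e = {u, v}" "u \<noteq> v"
  shows "gain_from \<Gamma> u e \<in> carrier \<Gamma>" "e = dir_link u v (gain_from \<Gamma> u e)"
  using assms by (auto simp: dowling_edges_def dir_link_def doubleton_eq_iff)

lemma gain_from_closed: "e \<in> edges \<Longrightarrow> gain_from \<Gamma> u e \<in> carrier \<Gamma>"
  by (auto simp: dowling_edges_def)

lemma third_clos:
  assumes "e \<in> edges" "f \<in> edges" "e \<noteq> f" "e \<in> clos {f, h}" shows "h \<in> clos {e, f}"
proof -
  have "e \<notin> clos {f}"
    using rank_two [OF assms(1-3)] rank_le_card [of "{f}"] by (auto simp: clos_def)
  then show ?thesis using clos_exchange [of e h "{f}"] assms(4) by (simp add: insert_commute)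
qed

lemma triangle_clos:
  assumes "i \<in> {1..n}" "j \<in> {1..n}" "m \<in> {1..n}" "i < j" "j < m" "g \<in> carrier \<Gamma>" "h \<in> carrier \<Gamma>"
    "k = g \<otimes>\<^bsub>\<Gamma>\<^esub> h"
  shows "Link i m k \<in> clos {Link i j g, Link j m h}"
    "Link j m h \<in> clos {Link i j g, Link i m k}"
    "Link i j g \<in> clos {Link j m h, Link i m k}"
proof -
  show 1: "Link i m k \<in> clos {Link i j g, Link j m h}" using link_mult_clos assms by simp
  have e: "Link i m k \<in> edges" "Link i j g \<in> edges" "Link j m h \<in> edges"
    using assms by (auto simp: dowling_edges_def)
  show "Link j m h \<in> clos {Link i j g, Link i m k}"
    using third_clos [of "Link i m k" "Link i j g" "Link j m h"] e 1 assms by (simp add: insert_commute)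
  show "Link i j g \<in> clos {Link j m h, Link i m k}"
    using third_clos [of "Link i m k" "Link j m h" "Link i j g"] e 1 assms by (simp add: insert_commute)
qed

text \<open>In each of the six orders of the vertices, one of the three edges is the product of the
  other two along the increasing triangle; which one decides the part of
  \<open>triangle_clos\<close> to use.\<close>

lemma dir_link_mult_clos:
  assumes uvw: "u \<in> {1..n}" "v \<in> {1..n}" "w \<in> {1..n}" "distinct [u, v, w]"
    and gh: "g \<in> carrier \<Gamma>" "h \<in> carrier \<Gamma>"
  shows "dir_link u w (g \<otimes>\<^bsub>\<Gamma>\<^esub> h) \<in> clos {dir_link u v g, dir_link v w h}"
proof -
  let ?k = "g \<otimes>\<^bsub>\<Gamma>\<^esub> h"
  have k: "?k \<in> carrier \<Gamma>" using gh by simp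
  have inv: "inv\<^bsub>\<Gamma>\<^esub> ?k = inv\<^bsub>\<Gamma>\<^esub> h \<otimes>\<^bsub>\<Gamma>\<^esub> inv\<^bsub>\<Gamma>\<^esub> g" using gh by (simp add: inv_mult_group)
  have m: "g = ?k \<otimes>\<^bsub>\<Gamma>\<^esub> inv\<^bsub>\<Gamma>\<^esub> h" "h = inv\<^bsub>\<Gamma>\<^esub> g \<otimes>\<^bsub>\<Gamma>\<^esub> ?k"
    "inv\<^bsub>\<Gamma>\<^esub> g = h \<otimes>\<^bsub>\<Gamma>\<^esub> inv\<^bsub>\<Gamma>\<^esub> ?k" "inv\<^bsub>\<Gamma>\<^esub> h = inv\<^bsub>\<Gamma>\<^esub> ?k \<otimes>\<^bsub>\<Gamma>\<^esub> g"
    using gh by (simp_all add: inv m_assoc) (simp_all add: m_assoc [symmetric])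
  consider "u < v" "v < w" | "u < w" "w < v" | "v < u" "u < w" | "v < w" "w < u"
    | "w < u" "u < v" | "w < v" "v < u" using uvw(4) by (auto simp: neq_iff)
  then show ?thesis
  proof cases
    case 1
    then show ?thesis using triangle_clos(1) [of u v w g h ?k] uvw gh by (simp add: dir_link_def)
  next
    case 2
    then show ?thesis using triangle_clos(3) [of u w v ?k "inv\<^bsub>\<Gamma>\<^esub> h" g] uvw gh k m(1)
      by (simp add: dir_link_def insert_commute)
  next
    case 3
    then show ?thesis using triangle_clos(2) [of v u w "inv\<^bsub>\<Gamma>\<^esub> g" ?k h] uvw gh k m(2)
      by (simp add: dir_link_def)
  next
    case 4
    then show ?thesis using triangle_clos(2) [of v w u h "inv\<^bsub>\<Gamma>\<^esub> ?k" "inv\<^bsub>\<Gamma>\<^esub> g"] uvw gh k m(3)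
      by (simp add: dir_link_def insert_commute)
  next
    case 5
    then show ?thesis using triangle_clos(3) [of w u v "inv\<^bsub>\<Gamma>\<^esub> ?k" g "inv\<^bsub>\<Gamma>\<^esub> h"] uvw gh k m(4)
      by (simp add: dir_link_def)
  next
    case 6
    then show ?thesis
      using triangle_clos(1) [of w v u "inv\<^bsub>\<Gamma>\<^esub> h" "inv\<^bsub>\<Gamma>\<^esub> g" "inv\<^bsub>\<Gamma>\<^esub> ?k"] uvw gh k inv
      by (simp add: dir_link_def insert_commute)
  qed
qed

section \<open>Gains along paths and cycles\<close>

primrec gain :: "(nat \<Rightarrow> nat) \<Rightarrow> (nat \<Rightarrow> 'g dedge) \<Rightarrow> nat \<Rightarrow> 'g" where
  "gain vs es 0 = \<one>\<^bsub>\<Gamma>\<^esub>"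
| "gain vs es (Suc t) = gain vs es t \<otimes>\<^bsub>\<Gamma>\<^esub> gain_from \<Gamma> (vs t) (es t)"

lemma gain_closed: "(\<And>t. t < k \<Longrightarrow> es t \<in> edges) \<Longrightarrow> gain vs es k \<in> carrier \<Gamma>"
  by (induction k) (auto intro: gain_from_closed)

lemma foldr_mult_append:
  "set xs \<subseteq> carrier \<Gamma> \<Longrightarrow> x \<in> carrier \<Gamma> \<Longrightarrow>
    foldr (mult \<Gamma>) (xs @ [x]) \<one>\<^bsub>\<Gamma>\<^esub> = foldr (mult \<Gamma>) xs \<one>\<^bsub>\<Gamma>\<^esub> \<otimes>\<^bsub>\<Gamma>\<^esub> x"
proof (induction xs)
  case (Cons y xs)
  have "foldr (mult \<Gamma>) xs \<one>\<^bsub>\<Gamma>\<^esub> \<in> carrier \<Gamma>" if "set xs \<subseteq> carrier \<Gamma>" for xs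
    using that by (induction xs) auto
  with Cons show ?case by (simp add: m_assoc)
qed simp

lemma foldr_gain:
  assumes "\<And>t. t < k \<Longrightarrow> es t \<in> edges"
  shows "foldr (mult \<Gamma>) (map (\<lambda>t. gain_from \<Gamma> (vs t) (es t)) [0..<k]) \<one>\<^bsub>\<Gamma>\<^esub> = gain vs es k"
  using assms
proof (induction k)
  case (Suc k)
  have "set (map (\<lambda>t. gain_from \<Gamma> (vs t) (es t)) [0..<k]) \<subseteq> carrier \<Gamma>"
    using Suc.prems gain_from_closed by auto
  moreover have "gain_from \<Gamma> (vs k) (es k) \<in> carrier \<Gamma>" using Suc.prems gain_from_closed by auto
  ultimately show ?case
    using Suc.IH Suc.prems
      foldr_mult_append [of "map (\<lambda>t. gain_from \<Gamma> (vs t) (es t)) [0..<k]" "gain_from \<Gamma> (vs k) (es k)"]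
    by simp
qed simp

lemma fpath_vertex:
  assumes "fpath k vs es" "\<And>t. t < k \<Longrightarrow> es t \<in> edges" "0 < k" "t \<le> k" shows "vs t \<in> {1..n}"
proof (cases "t = k")
  case True
  then have "vs t \<in> ends (es (t - 1))" using fpath_ends [OF assms(1), of "t - 1"] assms by simp
  then show ?thesis using ends_sub [OF assms(2), of "t - 1"] True assms by auto
next
  case False
  then show ?thesis using fpath_ends [OF assms(1), of t] ends_sub [OF assms(2), of t] assms by auto
qed

text \<open>An initial segment is replaced by a single edge with the same gain, and the next edge is
  absorbed by a collinear triple.\<close>

lemma gain_clos:
  assumes "fpath k vs es" "\<And>t. t < k \<Longrightarrow> es t \<in> edges" "0 < k"
  shows "dir_link (vs 0) (vs k) (gain vs es k) \<in> clos (es ` {..<k})"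
  using assms
proof (induction k)
  case (Suc k)
  note p = Suc.prems(1) and E = Suc.prems(2)
  have V: "vs t \<in> {1..n}" if "t \<le> Suc k" for t using fpath_vertex [OF Suc.prems that] .
  have e: "es k = dir_link (vs k) (vs (Suc k)) (gain_from \<Gamma> (vs k) (es k))"
    using edge_dir_link(2) [OF E fpath_ends [OF p]] fpath_vs_eq [OF p] by simp
  show ?case
  proof (cases "k = 0")
    case True
    then show ?thesis using e gain_from_closed [OF E, of 0] by (auto intro: in_clos simp: lessThan_Suc)
  next
    case False
    have p': "fpath k vs es" using p by (auto simp: fpath_def intro: inj_on_subset)
    have "dir_link (vs 0) (vs k) (gain vs es k) \<in> clos (es ` {..<k})"
      using Suc.IH [OF p'] E False by simp
    also have "\<dots> \<subseteq> clos (es ` {..<Suc k})" by (intro clos_mono) auto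
    finally have 1: "dir_link (vs 0) (vs k) (gain vs es k) \<in> clos (es ` {..<Suc k})" .
    have "dir_link (vs 0) (vs (Suc k)) (gain vs es (Suc k))
        \<in> clos {dir_link (vs 0) (vs k) (gain vs es k), es k}"
      using dir_link_mult_clos [of "vs 0" "vs k" "vs (Suc k)" "gain vs es k" "gain_from \<Gamma> (vs k) (es k)"]
        V e gain_closed [of k es vs] gain_from_closed E False fpath_vs_eq [OF p] by simp
    also have "\<dots> \<subseteq> clos (es ` {..<Suc k})" using 1 by (intro clos_trans) (auto intro: in_clos)
    finally show ?thesis .
  qed
qed simp

text \<open>In a balanced cycle the closing edge is exactly the edge that \<open>gain_clos\<close>
  puts into the closure of the others.\<close>

lemma balanced_dependent:
  assumes "balanced_cycle \<Gamma> C" "C \<subseteq> edges"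
  shows "\<rho> C < card C"
proof -
  obtain vs es where c: "cycle_seq vs es" "2 \<le> length es" "C = set es"
    "foldr (mult \<Gamma>) (map2 (gain_from \<Gamma>) vs es) \<one>\<^bsub>\<Gamma>\<^esub> = \<one>\<^bsub>\<Gamma>\<^esub>"
    using assms(1) by (auto simp: balanced_cycle_def)
  then have c': "length vs = length es" "distinct vs" "distinct es"
    "\<And>k. k < length es \<Longrightarrow> ends (es ! k) = {vs ! k, vs ! (Suc k mod length es)}"
    by (auto simp: cycle_seq_def)
  define k where "k = length es - 1"
  have k: "0 < k" "length es = Suc k" using c(2) by (auto simp: k_def)
  let ?vs = "\<lambda>t. vs ! t" and ?es = "\<lambda>t. es ! t"
  have p: "fpath k ?vs ?es"
    unfolding fpath_def using c' k by (auto simp: inj_on_def nth_eq_iff_index_eq)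
  have E: "es ! t \<in> edges" if "t < Suc k" for t using that assms(2) c(3) k by auto
  have Et: "\<And>t. t < k \<Longrightarrow> ?es t \<in> edges" using E by simp
  have ek: "ends (es ! k) = {vs ! k, vs ! 0}" using c'(4) [of k] k by simp
  have V: "vs ! 0 \<in> {1..n}" "vs ! k \<in> {1..n}" "vs ! 0 \<noteq> vs ! k"
    using fpath_vertex [OF p Et] fpath_vs_eq [OF p] k by auto
  let ?g = "gain ?vs ?es k" and ?h = "gain_from \<Gamma> (vs ! k) (es ! k)"
  have gh: "?g \<in> carrier \<Gamma>" "?h \<in> carrier \<Gamma>" using gain_closed [OF Et] gain_from_closed E by auto
  have "map2 (gain_from \<Gamma>) vs es = map (\<lambda>t. gain_from \<Gamma> (vs ! t) (es ! t)) [0..<Suc k]"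
    using c'(1) k by (intro nth_equalityI) (auto simp del: upt_Suc)
  then have "?g \<otimes>\<^bsub>\<Gamma>\<^esub> ?h = \<one>\<^bsub>\<Gamma>\<^esub>" using c(4) foldr_gain [of "Suc k" ?es ?vs] E by simp
  then have "?h = inv\<^bsub>\<Gamma>\<^esub> ?g" using gh by (metis inv_equality inv_inv l_inv_ex inv_unique' inv_comm)
  then have "es ! k = dir_link (vs ! 0) (vs ! k) ?g"
    using edge_dir_link(2) [of "es ! k" "vs ! k" "vs ! 0"] E ek V dir_link(3) [OF V gh(1)] by simp
  then have "es ! k \<in> clos (?es ` {..<k})" using gain_clos [OF p Et k(1)] by simp
  then have "\<rho> (insert (es ! k) (?es ` {..<k})) = \<rho> (?es ` {..<k})" by (simp add: clos_def)
  moreover have "C = insert (es ! k) (?es ` {..<k})"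
    using c(3) k by (auto simp: set_conv_nth less_Suc_eq)
  moreover have "\<rho> (?es ` {..<k}) \<le> k"
    using rank_le_card [of "?es ` {..<k}"] card_image_le [of "{..<k}" ?es] by simp
  moreover have "card C = Suc k" using c(3) c'(3) k by (simp add: distinct_card)
  ultimately show ?thesis by simp
qed

lemma circuit_dependent:
  assumes "dowling_circuit n \<Gamma> C" shows "\<rho> C < card C"
proof -
  have C: "C \<subseteq> edges" using assms by (simp add: dowling_circuit_def)
  have *: "\<rho> C < card C" if "finite V" "card V < card C" "\<And>e. e \<in> C \<Longrightarrow> ends e \<subseteq> V" for V
    using rank_le_ends [OF C that(1,3)] that(2) by simp
  consider "balanced_cycle \<Gamma> C" | "theta C" | "handcuff C"
    using assms by (auto simp: dowling_circuit_def)
  then show ?thesis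
  proof cases
    case 1
    then show ?thesis using balanced_dependent C by blast
  next
    case 2
    then show ?thesis using * by (metis theta_card)
  next
    case 3
    then show ?thesis using * by (metis handcuff_card)
  qed
qed

text \<open>The path spans an edge with the same ends as \<open>e\<close>, different from
  \<open>e\<close> because the cycle would be balanced otherwise. Two such edges span the loops at
  their ends, and these propagate along the path.\<close>

lemma unbalanced_clos:
  assumes p: "fpath k vs es" and E: "\<And>t. t < k \<Longrightarrow> es t \<in> edges" and k: "0 < k"
    and e: "e \<in> edges" "ends e = {vs 0, vs k}" "e \<notin> es ` {..<k}"
    and unb: "\<not> balanced_cycle \<Gamma> (insert e (es ` {..<k}))"
  shows "Loop ` vs ` {..k} \<subseteq> clos (insert e (es ` {..<k}))"
proof -
  let ?C = "insert e (es ` {..<k})" and ?f = "dir_link (vs 0) (vs k) (gain vs es k)"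
  have V: "vs 0 \<in> {1..n}" "vs k \<in> {1..n}" "vs 0 \<noteq> vs k"
    using fpath_vertex [OF p E k] fpath_vs_eq [OF p] k by auto
  have g: "gain vs es k \<in> carrier \<Gamma>" using gain_closed E by blast
  have "?f \<noteq> e"
  proof
    assume "?f = e"
    then have "gain_from \<Gamma> (vs k) e = inv\<^bsub>\<Gamma>\<^esub> (gain vs es k)"
      using dir_link(3,4) V g by (metis inv_closed)
    then have 1: "gain vs es k \<otimes>\<^bsub>\<Gamma>\<^esub> gain_from \<Gamma> (vs k) e = \<one>\<^bsub>\<Gamma>\<^esub>" using g by simp
    define es' where "es' t = (if t = k then e else es t)" for t
    have E': "es' t \<in> edges" if "t < Suc k" for t using that E e(1) by (simp add: es'_def)
    have "gain vs es' t = gain vs es t" if "t \<le> k" for t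
      using that by (induction t) (auto simp: es'_def)
    then have 2: "gain vs es' (Suc k) = \<one>\<^bsub>\<Gamma>\<^esub>" using 1 by (simp add: es'_def)
    have "map es [0..<k] @ [e] = map es' [0..<Suc k]" by (auto simp: es'_def)
    then have "map2 (gain_from \<Gamma>) (map vs [0..<Suc k]) (map es [0..<k] @ [e])
        = map (\<lambda>t. gain_from \<Gamma> (vs t) (es' t)) [0..<Suc k]"
      by (intro nth_equalityI) (auto simp del: upt_Suc)
    then have "foldr (mult \<Gamma>) (map2 (gain_from \<Gamma>) (map vs [0..<Suc k]) (map es [0..<k] @ [e])) \<one>\<^bsub>\<Gamma>\<^esub> = \<one>\<^bsub>\<Gamma>\<^esub>"
      using foldr_gain [of "Suc k" es' vs] E' 2 by (simp del: upt_Suc)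
    moreover have "cycle_seq (map vs [0..<Suc k]) (map es [0..<k] @ [e])"
      using e by (intro fpath_cycle_seq [OF p]) (auto simp: lessThan_atLeast0)
    ultimately have "balanced_cycle \<Gamma> ?C"
      unfolding balanced_cycle_def using k
      by (intro exI [of _ "map vs [0..<Suc k]"] exI [of _ "map es [0..<k] @ [e]"])
        (auto simp: lessThan_atLeast0 simp del: upt_Suc)
    then show False using unb by blast
  qed
  moreover have "?f \<in> clos ?C" using gain_clos [OF p E k] clos_mono [of "es ` {..<k}" ?C] by blast
  ultimately have 0: "Loop (vs 0) \<in> clos ?C"
    using parallel_clos(1) [of ?f e "vs 0" "vs k" ?C] dir_link(1,2) [OF V g] e by (auto intro: in_clos)
  have "Loop (vs t) \<in> clos ?C" if "t \<le> k" for t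
    using that
  proof (induction t)
    case (Suc t)
    then have "es t \<in> clos ?C" by (intro in_clos) auto
    then show ?case
      using Loop_other_clos [of "es t" "vs t" "vs (Suc t)" ?C] E [of t] fpath_ends [OF p, of t] Suc
      by simp
  qed (use 0 in simp)
  then show ?thesis by auto
qed

end

lemma inj_on_rotate: "inj_on (\<lambda>t. (m + t) mod Suc k) {..k :: nat}"
proof -
  have *: "s = t" if "(m + s) mod Suc k = (m + t) mod Suc k" "s \<le> t" "t \<le> k" for s t
  proof -
    have "Suc k dvd (m + t) - (m + s)"
      using that mod_eq_dvd_iff_nat [of "m + s" "m + t" "Suc k"] by simp
    then show ?thesis using that by (auto dest: dvd_imp_le)
  qed
  show ?thesis
  proof (rule inj_onI)
    fix s t assume "s \<in> {..k}" "t \<in> {..k}" "(m + s) mod Suc k = (m + t) mod Suc k"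
    then show "s = t" using * [of s t] * [of t s] by (cases "s \<le> t") auto
  qed
qed

section \<open>Circuit-free sets are independent\<close>

context dowling_rank
begin

text \<open>The condition on the vertices matters for \<open>k = 0\<close>, where no edge ties the
  path to the graph.\<close>

definition path_in :: "'g dedge set \<Rightarrow> nat \<Rightarrow> (nat \<Rightarrow> nat) \<Rightarrow> (nat \<Rightarrow> 'g dedge) \<Rightarrow> bool" where
  "path_in Y k vs es \<longleftrightarrow> fpath k vs es \<and> es ` {..<k} \<subseteq> Y \<and> vs ` {..k} \<subseteq> {1..n}"

lemma path_in_length: "path_in Y k vs es \<Longrightarrow> k < n"
  using card_mono [of "{1..n}" "vs ` {..k}"] card_image [of vs "{..k}"]
  by (auto simp: path_in_def fpath_def)

lemma path_in_rev:
  assumes "path_in Y k vs es"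
  shows "path_in Y k (\<lambda>t. vs (k - t)) (\<lambda>t. es (k - Suc t))"
proof -
  have p: "fpath k vs es" using assms by (simp add: path_in_def)
  have "ends (es (k - Suc t)) = {vs (k - t), vs (k - Suc t)}" if "t < k" for t
    using fpath_ends [OF p, of "k - Suc t"] that by (simp add: Suc_diff_Suc insert_commute)
  moreover have "inj_on (\<lambda>t. vs (k - t)) {..k}"
    using fpath_vs_eq [OF p] by (intro inj_onI) auto
  ultimately show ?thesis using assms by (auto simp: path_in_def fpath_def)
qed

lemma longest_path_end:
  assumes max: "\<And>vs es. \<not> path_in Y (Suc k) vs es" and p: "path_in Y k vs es"
    and Y: "Y \<subseteq> edges" and e: "e \<in> Y" "vs 0 \<in> ends e"
  shows "\<exists>i\<le>k. ends e = {vs 0, vs i}"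
proof (rule ccontr)
  assume neg: "\<not> ?thesis"
  obtain w where w: "ends e = {vs 0, w}" using ends_other e Y by blast
  then have w_notin: "w \<notin> vs ` {..k}" using neg by auto
  have fp: "fpath k vs es" using p by (simp add: path_in_def)
  let ?vs = "case_nat w vs" and ?es = "case_nat e es"
  have "inj_on ?vs {..Suc k}"
    using fpath_vs_eq [OF fp] w_notin by (auto simp: inj_on_def split: nat.split)
  moreover have "ends (?es t) = {?vs t, ?vs (Suc t)}" if "t < Suc k" for t
    using that w fpath_ends [OF fp] by (cases t) (auto simp: insert_commute)
  ultimately have "fpath (Suc k) ?vs ?es" by (simp add: fpath_def)
  moreover have "?es ` {..<Suc k} \<subseteq> Y"
    using p e by (auto simp: path_in_def lessThan_Suc_eq_insert_0)
  moreover have "?vs ` {..Suc k} \<subseteq> {1..n}"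
    using p ends_sub [of e] e w Y by (auto simp: path_in_def atMost_Suc_eq_insert_0)
  ultimately have "path_in Y (Suc k) ?vs ?es" by (simp add: path_in_def)
  then show False using max by blast
qed

lemma longest_path_last:
  assumes max: "\<And>vs es. \<not> path_in Y (Suc k) vs es" and p: "path_in Y k vs es"
    and Y: "Y \<subseteq> edges" and e: "e \<in> Y" "vs k \<in> ends e"
  shows "\<exists>i\<le>k. ends e = {vs k, vs i}"
  using longest_path_end [OF max path_in_rev [OF p] Y e(1)] e(2) by (auto intro: diff_le_self)

text \<open>An edge that touches the cycle touches an end of a suitable rotation of the path, which
  is again longest. So it returns to that path, and together with the edge closing the rotated path
  it produces a theta or a handcuff.\<close>

lemma closed_path_component:
  assumes max: "\<And>vs es. \<not> path_in Y (Suc k) vs es" and p: "path_in Y k vs es"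
    and Y: "Y \<subseteq> edges" and e: "e \<in> Y" "e \<notin> es ` {..<k}" "ends e = {vs 0, vs k}"
    and none: "\<not> (\<exists>S\<subseteq>Y. theta S \<or> handcuff S)"
    and d: "d \<in> Y" "d \<notin> insert e (es ` {..<k})"
  shows "ends d \<inter> vs ` {..k} = {}"
proof (rule ccontr)
  assume "ends d \<inter> vs ` {..k} \<noteq> {}"
  then obtain m where m: "m \<le> k" "vs m \<in> ends d" by auto
  have fp: "fpath k vs es" using p by (simp add: path_in_def)
  define ce where "ce t = (if t = k then e else es t)" for t
  define rot where "rot t = (m + t) mod Suc k" for t
  have rot: "rot t \<le> k" for t
  proof -
    have "rot t < Suc k" unfolding rot_def by (rule mod_less_divisor) simp
    then show ?thesis by simp
  qed
  have ce_ends: "ends (ce t) = {vs t, vs (Suc t mod Suc k)}" if "t \<le> k" for t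
    using that e(3) fpath_ends [OF fp, of t] by (auto simp: ce_def insert_commute)
  have rot_Suc: "Suc (rot t) mod Suc k = rot (Suc t)" for t
    by (simp add: rot_def mod_Suc_eq)
  have rot_inj: "rot s = rot t \<longleftrightarrow> s = t" if "s \<le> k" "t \<le> k" for s t
    unfolding rot_def using that by (intro inj_on_eq_iff [OF inj_on_rotate]) auto
  have ce_inj: "ce s = ce t \<longleftrightarrow> s = t" if "s \<le> k" "t \<le> k" for s t
  proof -
    have "es s = es t \<longleftrightarrow> s = t" if "s < k" "t < k"
      using that by (intro inj_on_eq_iff [OF fpath_inj_es [OF fp]]) auto
    then show ?thesis using that e(2) by (auto simp: ce_def)
  qed
  have ce_Y: "ce t \<in> insert e (es ` {..<k})" if "t \<le> k" for t using that by (auto simp: ce_def)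
  let ?vs = "\<lambda>t. vs (rot t)" and ?es = "\<lambda>t. ce (rot t)"
  have ends: "ends (?es t) = {?vs t, ?vs (Suc t)}" for t
    using ce_ends [OF rot] by (simp add: rot_Suc)
  moreover have "inj_on ?vs {..k}"
    using rot rot_inj fpath_vs_eq [OF fp] by (intro inj_onI) auto
  ultimately have fp': "fpath k ?vs ?es" by (simp add: fpath_def)
  have CY: "insert e (es ` {..<k}) \<subseteq> Y" using p e by (auto simp: path_in_def)
  have "?vs ` {..k} \<subseteq> {1..n}" using p rot by (auto simp: path_in_def)
  moreover have "?es ` {..<k} \<subseteq> Y" using ce_Y [OF rot] CY by blast
  ultimately have p': "path_in Y k ?vs ?es" using fp' unfolding path_in_def by blast
  have "rot 0 = m" using m by (simp add: rot_def)
  then obtain i where i: "i \<le> k" "ends d = {?vs 0, ?vs i}"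
    using longest_path_end [OF max p' Y d(1)] m by auto
  have "rot (Suc k) = rot 0" by (simp only: rot_def mod_add_self2 add_0_right)
  then have "ends (?es k) = {?vs k, ?vs 0}" using ends [of k] by simp
  moreover have "?es k \<notin> ?es ` {..<k}"
    using ce_inj [OF rot rot] rot_inj by auto
  moreover have "d \<notin> ?es ` {..<k}" "d \<noteq> ?es k" using d(2) ce_Y [OF rot] by (metis imageE)+
  ultimately obtain S where "S \<subseteq> insert d (insert (?es k) (?es ` {..<k}))" "theta S \<or> handcuff S"
    using theta_or_handcuff [OF fp' i(1) _ i(2), of 0 "?es k"] by auto
  moreover have "insert d (insert (?es k) (?es ` {..<k})) \<subseteq> Y"
    using d(1) ce_Y [OF rot] CY by blast
  ultimately show False using none by blast
qed

text \<open>\<open>C\<close> spans the loops on \<open>V\<close>, and \<open>Y - C\<close> lives on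
  the other vertices, so the ranks add up. Submodularity is applied to the loops on \<open>V\<close>
  and the loops off \<open>V\<close>, each enlarged by \<open>Y - C\<close>.\<close>

lemma component_rank:
  assumes "finite Y" "C \<subseteq> Y" "V \<subseteq> {1..n}" "card C = card V" "Loop ` V \<subseteq> clos C"
    and "\<rho> (Y - C) = card (Y - C)" "Y \<subseteq> edges" "\<And>d. d \<in> Y - C \<Longrightarrow> ends d \<inter> V = {}"
  shows "\<rho> Y = card Y"
proof -
  let ?Z = "Y - C" and ?R = "{1..n} - V"
  have "?Z \<subseteq> clos (Loop ` ?R)"
  proof
    fix d assume d: "d \<in> ?Z"
    then have "ends d \<subseteq> ?R" using ends_sub [of d] assms(7) assms(8) [OF d] by blast
    then show "d \<in> clos (Loop ` ?R)" using edge_clos_loops [of d ?R] d assms(7) by blast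
  qed
  then have "?Z \<union> Loop ` ?R \<subseteq> clos (Loop ` ?R)" using subset_clos by (rule Un_least)
  then have "\<rho> (?Z \<union> Loop ` ?R) \<le> \<rho> (Loop ` ?R)" by (rule rank_le_of_subset_clos)
  also have "\<dots> = n - card V"
    using rank_loops_sub [of ?R] assms(3) by (simp add: card_Diff_subset finite_subset)
  finally have 1: "\<rho> (?Z \<union> Loop ` ?R) \<le> n - card V" .
  have "n = \<rho> (Loop ` {1..n})" using rank_loops by simp
  also have "\<dots> \<le> \<rho> ((Loop ` V \<union> ?Z) \<union> (?Z \<union> Loop ` ?R))" by (intro rank_mono) auto
  finally have 2: "n \<le> \<rho> ((Loop ` V \<union> ?Z) \<union> (?Z \<union> Loop ` ?R))" .
  have 3: "\<rho> ?Z \<le> \<rho> ((Loop ` V \<union> ?Z) \<inter> (?Z \<union> Loop ` ?R))" by (intro rank_mono) auto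
  have 4: "card V \<le> n" using card_mono [OF _ assms(3)] by simp
  have "Loop ` V \<subseteq> clos Y" using assms(5) clos_mono [OF assms(2)] by (rule subset_trans)
  moreover have "?Z \<subseteq> clos Y" using Diff_subset subset_clos by (rule subset_trans)
  ultimately have "Loop ` V \<union> ?Z \<subseteq> clos Y" by (rule Un_least)
  then have "\<rho> (Loop ` V \<union> ?Z) \<le> \<rho> Y" by (rule rank_le_of_subset_clos)
  then have "card V + card ?Z \<le> \<rho> Y"
    using submodular [of "Loop ` V \<union> ?Z" "?Z \<union> Loop ` ?R"] 1 2 3 4 assms(6) by linarith
  moreover have "card Y = card C + card ?Z"
    using assms(1,2) card_mono [OF assms(1,2)] by (simp add: card_Diff_subset finite_subset)
  ultimately show ?thesis using rank_le_card [OF assms(1)] assms(4) by simp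
qed

text \<open>When every end of an edge lies on a second edge, a longest path finds the cycle to
  remove: the further edges at its two ends coincide by \<open>theta_or_handcuff\<close>, and the
  unbalanced cycle closed in this way is a whole component by
  \<open>closed_path_component\<close>.\<close>

lemma circuit_free_independent:
  assumes "Y \<subseteq> edges" and "\<not> (\<exists>C\<subseteq>Y. dowling_circuit n \<Gamma> C)"
  shows "\<rho> Y = card Y"
  using assms
proof (induction "card Y" arbitrary: Y rule: less_induct)
  case less
  note Y = less.prems(1)
  have finY: "finite Y" using Y finite_E finite_subset by blast
  have IH: "\<rho> Z = card Z" if "Z \<subset> Y" for Z
    using less.hyps [of Z] psubset_card_mono [OF finY that] less.prems that by blast
  have no_bal: "\<not> balanced_cycle \<Gamma> S" if "S \<subseteq> Y" for S
    using less.prems that by (auto simp: dowling_circuit_def)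
  have none: "\<not> (\<exists>S\<subseteq>Y. theta S \<or> handcuff S)"
    using less.prems no_bal unfolding dowling_circuit_def by (meson order_trans)
  show ?case
  proof (cases "\<exists>v e. e \<in> Y \<and> v \<in> ends e \<and> (\<forall>f\<in>Y. v \<in> ends f \<longrightarrow> f = e)")
    case True
    then obtain v e where ve: "e \<in> Y" "v \<in> ends e" "\<And>f. f \<in> Y \<Longrightarrow> v \<in> ends f \<Longrightarrow> f = e" by blast
    have "Y - {e} \<subseteq> clos (Loop ` ({1..n} - {v}))"
    proof
      fix f assume f: "f \<in> Y - {e}"
      then have "ends f \<subseteq> {1..n} - {v}" using ends_sub [of f] Y ve(3) by blast
      then show "f \<in> clos (Loop ` ({1..n} - {v}))" using edge_clos_loops f Y by blast
    qed
    then have "e \<notin> clos (Y - {e})"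
      using edge_notin_clos [of e v] ve Y clos_trans by blast
    then have "\<rho> (insert e (Y - {e})) = Suc (\<rho> (Y - {e}))" by (rule rank_insert_notin)
    moreover have "\<rho> (Y - {e}) = card (Y - {e})" by (rule IH) (use ve in blast)
    ultimately show ?thesis
      unfolding insert_Diff [OF ve(1)] using card.remove [OF finY ve(1)] by linarith
  next
    case False
    then have other: "\<exists>f\<in>Y. v \<in> ends f \<and> f \<noteq> e" if "e \<in> Y" "v \<in> ends e" for v e
      using that by blast
    have other': "\<exists>f\<in>Y. v \<in> ends f \<and> f \<noteq> e" if "g \<in> Y" "v \<in> ends g" for v e g
      using that other [of g v] by (cases "g = e") auto
    show ?thesis
    proof (cases "Y = {}")
      case False
      then obtain e0 v0 where e0: "e0 \<in> Y" "v0 \<in> ends e0" using ends_nonempty Y by blast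
      \<comment> \<open>Otherwise all edges at \<open>v0\<close> are loops, but there are two of
        them and only one loop per vertex.\<close>
      have one: "\<exists>vs es. path_in Y 1 vs es"
      proof (rule ccontr)
        assume "\<not> ?thesis"
        then have no: "\<And>vs es. \<not> path_in Y (Suc 0) vs es" by simp
        have "v0 \<in> {1..n}" using e0 ends_sub Y by blast
        then have p0: "path_in Y 0 (\<lambda>_. v0) (\<lambda>_. e0)" by (simp add: path_in_def fpath_def)
        have loop: "g = Loop v0" if g: "g \<in> Y" "v0 \<in> ends g" for g
        proof -
          have "ends g = {v0}" using longest_path_end [OF no p0 Y g(1)] g(2) by simp
          then show ?thesis using ends_loop [of g v0] Y g(1) by blast
        qed
        obtain f where f: "f \<in> Y" "v0 \<in> ends f" "f \<noteq> e0" using other [OF e0] by blast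
        then show False using loop [OF f(1,2)] loop [OF e0] by simp
      qed
      define k where "k = (GREATEST k. \<exists>vs es. path_in Y k vs es)"
      have bound: "k \<le> n" if "\<exists>vs es. path_in Y k vs es" for k
        using that path_in_length less_imp_le by blast
      have "\<exists>vs es. path_in Y k vs es"
        unfolding k_def by (rule GreatestI_nat [where P = "\<lambda>k. \<exists>vs es. path_in Y k vs es", OF one bound])
      then obtain vs es where p: "path_in Y k vs es" by blast
      have greatest: "k' \<le> k" if "\<exists>vs es. path_in Y k' vs es" for k'
        unfolding k_def
        by (rule Greatest_le_nat [where P = "\<lambda>k. \<exists>vs es. path_in Y k vs es", OF that bound])
      have max: "\<not> path_in Y (Suc k) vs es" for vs es
        using greatest [of "Suc k"] by (meson Suc_n_not_le_n)
      have k: "0 < k" using greatest [OF one] by simp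
      have fp: "fpath k vs es" and esY: "es ` {..<k} \<subseteq> Y" and V: "vs ` {..k} \<subseteq> {1..n}"
        using p unfolding path_in_def by blast+
      have "es 0 \<in> Y" "vs 0 \<in> ends (es 0)" using esY k fpath_ends [OF fp, of 0] by auto
      then obtain e where e: "e \<in> Y" "vs 0 \<in> ends e" "e \<noteq> es 0" using other by blast
      have "es (k - 1) \<in> Y" "vs k \<in> ends (es (k - 1))" using esY k fpath_ends [OF fp, of "k - 1"] by auto
      then obtain f where f: "f \<in> Y" "vs k \<in> ends f" "f \<noteq> es (k - 1)" using other by blast
      have e_notin: "e \<notin> es ` {..<k}"
      proof
        assume "e \<in> es ` {..<k}"
        then obtain t where t: "t < k" "e = es t" by auto
        then have "vs 0 = vs t \<or> vs 0 = vs (Suc t)" using e fpath_ends [OF fp, of t] by auto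
        then show False using t e(3) fpath_vs_eq [OF fp] by auto
      qed
      have f_notin: "f \<notin> es ` {..<k}"
      proof
        assume "f \<in> es ` {..<k}"
        then obtain t where t: "t < k" "f = es t" by auto
        then have "vs k = vs t \<or> vs k = vs (Suc t)" using f fpath_ends [OF fp, of t] by auto
        then have "k = Suc t" using t fpath_vs_eq [OF fp] by auto
        then show False using t f(3) by simp
      qed
      obtain i where i: "i \<le> k" "ends e = {vs 0, vs i}"
        using longest_path_end [OF max p Y e(1,2)] by blast
      obtain j where j: "j \<le> k" "ends f = {vs k, vs j}"
        using longest_path_last [OF max p Y f(1,2)] by blast
      have "e = f"
      proof (rule ccontr)
        assume "e \<noteq> f"
        then obtain S where "S \<subseteq> insert e (insert f (es ` {..<k}))" "theta S \<or> handcuff S"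
          using theta_or_handcuff [OF fp i(1) j(1) i(2) e_notin j(2) f_notin] by blast
        then show False using none e f esY by (meson insert_subset order_trans)
      qed
      then have "vs k \<in> {vs 0, vs i}" using f i by auto
      then have "i = k" using fpath_vs_eq [OF fp] i k by auto
      then have ends_e: "ends e = {vs 0, vs k}" using i by simp
      let ?C = "insert e (es ` {..<k})" and ?V = "vs ` {..k}"
      have CY: "?C \<subseteq> Y" using e esY by blast
      have C: "Loop ` ?V \<subseteq> clos ?C"
        using unbalanced_clos [OF fp _ k _ ends_e e_notin no_bal [OF CY]] CY Y by blast
      have comp: "ends d \<inter> ?V = {}" if "d \<in> Y - ?C" for d
        using closed_path_component [OF max p Y e(1) e_notin ends_e none] that by blast
      have "card ?C = Suc k"
        using e_notin card_image [OF fpath_inj_es [OF fp]] by simp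
      moreover have "card ?V = Suc k" using fp card_image [of vs "{..k}"] by (simp add: fpath_def)
      moreover have "\<rho> (Y - ?C) = card (Y - ?C)" by (rule IH) (use e in blast)
      ultimately show ?thesis using component_rank [OF finY CY V _ C _ Y comp] by simp
    qed simp
  qed
qed

theorem independent_iff:
  assumes "Y \<subseteq> edges"
  shows "\<rho> Y = card Y \<longleftrightarrow> \<not> (\<exists>C\<subseteq>Y. dowling_circuit n \<Gamma> C)"
proof
  assume Y: "\<rho> Y = card Y"
  have "finite Y" using assms finite_E finite_subset by blast
  then have C: "\<rho> C = card C" if "C \<subseteq> Y" for C using indep_subset [OF Y] that by blast
  show "\<not> (\<exists>C\<subseteq>Y. dowling_circuit n \<Gamma> C)"
  proof (intro notI, elim exE conjE)
    fix C assume "C \<subseteq> Y" "dowling_circuit n \<Gamma> C"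
    then show False using C [of C] circuit_dependent [of C] by simp
  qed
qed (use circuit_free_independent assms in blast)

end

section \<open>Coordinates\<close>

locale joint_frame = frame +
  assumes B_sub_X: "B \<subseteq> X" and l2: "2 \<le> l"
    and tight: "card X = card B + (l - 1) * (card B choose 2)"
begin

lemma B_line: assumes "b \<in> B" shows "b \<in> line {b}"
proof -
  have b: "b \<in> X" using assms B_sub_X by blast
  have "supp b \<subseteq> {b}" using in_clos_iff [OF b, of "{b}"] assms in_clos by auto
  moreover have "supp b \<noteq> {}" using card_supp [OF b] by auto
  ultimately have "supp b = {b}" by blast
  then show ?thesis using b by (simp add: line_def)
qed

lemma line_joint: assumes "b \<in> B" shows "line {b} = {b}"
proof -
  have "card (line {b}) \<le> Suc 0" using n_joint_le [OF assms] by (simp add: n_def)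
  then show ?thesis using B_line [OF assms] card_le_Suc0_iff_eq [OF finite_line] by blast
qed

lemma n_joint: "b \<in> B \<Longrightarrow> n {b} = 1"
  by (simp add: n_def line_joint)

lemma n_pair: assumes "b \<in> B" "c \<in> B" "b \<noteq> c" shows "n {b, c} = l - 1"
proof (rule tight_lines(2) [OF tight])
  show "n S \<le> l - 1" if S: "S \<in> pairs" for S
  proof -
    have "S \<subseteq> B" "card S = 2" using S by (simp_all add: pairs_def)
    then obtain b c where "S = {b, c}" "b \<noteq> c" "b \<in> B" "c \<in> B" by (auto simp: card_2_iff)
    then show ?thesis using n_line_le [of b c] n_joint by simp
  qed
  show "{b, c} \<in> pairs" using assms by (rule pairsI)
qed

lemma line_neq: "x \<in> line S \<Longrightarrow> y \<in> line S' \<Longrightarrow> S \<noteq> S' \<Longrightarrow> x \<noteq> y"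
  by (auto simp: line_def)

lemma rank_pair: "x \<in> X \<Longrightarrow> y \<in> X \<Longrightarrow> x \<noteq> y \<Longrightarrow> \<rho> {x, y} = 2"
  using simple [of x y] by simp

lemma dependent_triple:
  assumes "x \<in> X" "y \<in> X" "x \<noteq> y" shows "z \<in> clos {x, y} \<longleftrightarrow> \<rho> {x, y, z} \<le> 2"
  using rank_pair [OF assms] by (simp add: clos_iff insert_commute)

text \<open>Existence is \<open>perspective\<close>, as the line of \<open>i\<close> and
  \<open>m\<close> has l - 1 interior points and both joints. Two third points would span
  \<open>i\<close> and \<open>m\<close>, hence also \<open>j\<close>, and rank 3 would fit into the
  line of \<open>x\<close> and \<open>y\<close>.\<close>

lemma third_point:
  assumes B: "i \<in> B" "j \<in> B" "m \<in> B" "distinct [i, j, m]" and x: "x \<in> line {i, j}" and y: "y \<in> line {j, m}"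
  shows "\<exists>!z. z \<in> line {i, m} \<and> \<rho> {x, y, z} \<le> 2"
proof -
  note x' = lineD [OF x] and y' = lineD [OF y]
  have "{i, j} \<noteq> {j, m}" using B by (auto simp: doubleton_eq_iff)
  then have xy: "x \<noteq> y" using line_neq x y by blast
  have xy_clos: "x \<in> clos {x, y}" "y \<in> clos {x, y}" by (simp_all add: in_clos)
  have "\<exists>z\<in>line {i, m}. z \<in> clos {y, x}"
    using B x y n_pair [of i m] n_joint l2
    by (intro perspective [of j i m]) (auto simp: insert_commute)
  then obtain z where z: "z \<in> line {i, m}" "z \<in> clos {x, y}" by (auto simp: insert_commute)
  show ?thesis
  proof (intro ex1I [of _ z] conjI)
    show "z \<in> line {i, m}" by (rule z(1))
    show "\<rho> {x, y, z} \<le> 2" using z(2) dependent_triple x'(1) y'(1) xy by simp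
    fix w assume w: "w \<in> line {i, m} \<and> \<rho> {x, y, w} \<le> 2"
    show "w = z"
    proof (rule ccontr)
      assume "w \<noteq> z"
      moreover have "w \<in> clos {x, y}" using w dependent_triple x'(1) y'(1) xy by simp
      ultimately have im: "i \<in> clos {x, y}" "m \<in> clos {x, y}"
        using pair_in_clos [of w z i m "{x, y}"] w z B lineD [of w] lineD [of z] by auto
      then have "j \<in> clos {x, y}"
        using edge_in_clos [of x i j "{x, y}"] x' B xy_clos by auto
      with im have "{i, j, m} \<subseteq> clos {x, y}" by blast
      then have "\<rho> {i, j, m} \<le> \<rho> {x, y}" by (rule rank_le_of_subset_clos)
      moreover have "\<rho> {i, j, m} = 3" using rank_sub_B [of "{i, j, m}"] B by auto
      ultimately show False using rank_pair x'(1) y'(1) xy by simp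
    qed
  qed
qed

text \<open>\<open>x\<close>, \<open>s\<close> and \<open>t\<close> lie in two flats of rank at most
  3, one spanned by the edges \<open>y\<close>, \<open>z\<close>, \<open>w\<close> at
  \<open>m\<close>, the other by \<open>i\<close>, \<open>j\<close>, \<open>k\<close>. Jointly these
  have rank 4, so submodularity leaves rank at most 2 for the intersection.\<close>

lemma tetrahedron_triangles:
  assumes B: "i \<in> B" "j \<in> B" "m \<in> B" "k \<in> B" "distinct [i, j, m, k]"
    and x: "x \<in> line {i, j}" and y: "y \<in> line {j, m}" and z: "z \<in> line {i, m}"
    and w: "w \<in> line {m, k}" and t: "t \<in> line {i, k}" and s: "s \<in> line {j, k}"
    and D: "\<rho> {x, y, z} \<le> 2" "\<rho> {z, w, t} \<le> 2" "\<rho> {y, w, s} \<le> 2"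
  shows "\<rho> {x, s, t} \<le> 2"
proof -
  note l = lineD [OF x] lineD [OF y] lineD [OF z] lineD [OF w] lineD [OF t] lineD [OF s]
  have "{j, m} \<noteq> {i, m}" "{i, m} \<noteq> {m, k}" "{j, m} \<noteq> {m, k}" using B(5) by (auto simp: doubleton_eq_iff)
  then have ne: "y \<noteq> z" "z \<noteq> w" "y \<noteq> w" using line_neq y z w by blast+
  let ?Y = "{y, z, w}" and ?T = "{i, j, k}"
  have "x \<in> clos {y, z}" using dependent_triple [of y z x] l ne D(1) by (simp add: insert_commute)
  moreover have "t \<in> clos {z, w}" using dependent_triple [of z w t] l ne D(2) by (simp add: insert_commute)
  moreover have "s \<in> clos {y, w}" using dependent_triple [of y w s] l ne D(3) by (simp add: insert_commute)
  ultimately have xst: "x \<in> clos ?Y" "t \<in> clos ?Y" "s \<in> clos ?Y"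
    using clos_mono [of "{y, z}" ?Y] clos_mono [of "{z, w}" ?Y] clos_mono [of "{y, w}" ?Y] by auto
  have "\<rho> (?Y \<union> {x, s, t}) \<le> \<rho> ?Y"
    using xst by (intro rank_le_of_subset_clos) (auto simp: in_clos)
  also have "\<dots> \<le> 3" using rank_le_card [of ?Y] by (auto simp: card_insert_if split: if_splits)
  finally have 1: "\<rho> (?Y \<union> {x, s, t}) \<le> 3" .
  have "?T \<union> {x, s, t} \<subseteq> clos ?T"
    using l B in_clos_iff [of x ?T] in_clos_iff [of s ?T] in_clos_iff [of t ?T] by (auto simp: in_clos)
  then have "\<rho> (?T \<union> {x, s, t}) \<le> \<rho> ?T" by (rule rank_le_of_subset_clos)
  also have "\<dots> \<le> 3" using rank_le_card [of ?T] by (auto simp: card_insert_if split: if_splits)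
  finally have 2: "\<rho> (?T \<union> {x, s, t}) \<le> 3" .
  let ?U = "(?Y \<union> {x, s, t}) \<union> (?T \<union> {x, s, t})"
  have "y \<in> clos ?U" "i \<in> clos ?U" "j \<in> clos ?U" "k \<in> clos ?U" by (auto intro: in_clos)
  moreover then have "m \<in> clos ?U" using edge_in_clos [OF lineD [OF y], of ?U] B(5) by simp
  ultimately have "{i, j, m, k} \<subseteq> clos ?U" by blast
  then have "\<rho> {i, j, m, k} \<le> \<rho> ?U" by (rule rank_le_of_subset_clos)
  moreover have "\<rho> {i, j, m, k} = 4" using rank_sub_B [of "{i, j, m, k}"] B by auto
  ultimately have 3: "4 \<le> \<rho> ?U" by simp
  have "\<rho> {x, s, t} \<le> \<rho> ((?Y \<union> {x, s, t}) \<inter> (?T \<union> {x, s, t}))" by (intro rank_mono) auto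
  then show ?thesis using submodular [of "?Y \<union> {x, s, t}" "?T \<union> {x, s, t}"] 1 2 3 by linarith
qed

lemma triangle_system:
  assumes b: "bij_betw b {1..card B} B" and B4: "4 \<le> card B"
  shows "triangle_system {1..card B} (\<lambda>i j. line {b i, b j}) (\<lambda>x y z. \<rho> {x, y, z} \<le> 2) 1 2 3 4"
proof
  have bB: "b i \<in> B" if "i \<in> {1..card B}" for i using b that by (auto simp: bij_betw_def)
  have b_eq: "b i = b j \<longleftrightarrow> i = j" if "i \<in> {1..card B}" "j \<in> {1..card B}" for i j
    using b that by (auto simp: bij_betw_def inj_on_eq_iff)
  show "line {b i, b j} = line {b j, b i}" for i j by (simp add: insert_commute)
  show "line {b i, b j} \<noteq> {}" if "i \<in> {1..card B}" "j \<in> {1..card B}" "i \<noteq> j" for i j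
    using n_pair [OF bB [OF that(1)] bB [OF that(2)]] b_eq [OF that(1,2)] that(3) l2 by (auto simp: n_def)
  show "\<rho> {y, x, z} \<le> 2" "\<rho> {x, z, y} \<le> 2" if "\<rho> {x, y, z} \<le> 2" for x y z
    using that by (simp_all add: insert_commute)
  show "\<exists>!z. z \<in> line {b i, b m} \<and> \<rho> {x, y, z} \<le> 2"
    if "i \<in> {1..card B}" "j \<in> {1..card B}" "m \<in> {1..card B}" "distinct [i, j, m]"
      "x \<in> line {b i, b j}" "y \<in> line {b j, b m}" for i j m x y
    using that(4) b_eq that(1-3) by (intro third_point [OF bB bB bB _ that(5,6)] that(1-3)) auto
  show "\<rho> {x, s, t} \<le> 2"
    if "i \<in> {1..card B}" "j \<in> {1..card B}" "m \<in> {1..card B}" "k \<in> {1..card B}" "distinct [i, j, m, k]"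
      "x \<in> line {b i, b j}" "y \<in> line {b j, b m}" "z \<in> line {b i, b m}" "w \<in> line {b m, b k}"
      "t \<in> line {b i, b k}" "s \<in> line {b j, b k}"
      "\<rho> {x, y, z} \<le> 2" "\<rho> {z, w, t} \<le> 2" "\<rho> {y, w, s} \<le> 2" for i j m k x y z w t s
  proof (rule tetrahedron_triangles [OF bB bB bB bB _ that(6-14)])
    show "distinct [b i, b j, b m, b k]" using that(1-5) b_eq by simp
  qed (use that in blast)+
qed (use B4 in auto)

text \<open>The inverses of the maps \<open>\<gamma> i j\<close> place the edges of the graph on the
  points of \<open>X\<close>. Pulled back along this map, the rank function satisfies
  \<open>dowling_rank\<close>, which identifies the independent sets.\<close>

lemma isomorphic_DG:
  assumes b: "bij_betw b {1..card B} B" and "group \<Gamma>"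
    and \<gamma>: "\<And>i j. i \<in> {1..card B} \<Longrightarrow> j \<in> {1..card B} \<Longrightarrow> i < j \<Longrightarrow>
      bij_betw (\<gamma> i j) (line {b i, b j}) (carrier \<Gamma>)"
    and mult: "\<And>i j m x y z. i \<in> {1..card B} \<Longrightarrow> j \<in> {1..card B} \<Longrightarrow> m \<in> {1..card B} \<Longrightarrow> i < j \<Longrightarrow> j < m \<Longrightarrow>
      x \<in> line {b i, b j} \<Longrightarrow> y \<in> line {b j, b m} \<Longrightarrow> z \<in> line {b i, b m} \<Longrightarrow>
      \<rho> {x, y, z} \<le> 2 \<Longrightarrow> \<gamma> i m z = \<gamma> i j x \<otimes>\<^bsub>\<Gamma>\<^esub> \<gamma> j m y"
  shows "isomorphic \<lparr>ground = X, indep = {Y. Y \<subseteq> X \<and> \<rho> Y = card Y}\<rparr> (DG (card B) \<Gamma>)"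
proof -
  let ?r = "card B" and ?E = "dowling_edges (card B) \<Gamma>"
  have bB: "b i \<in> B" if "i \<in> {1..?r}" for i using b that by (auto simp: bij_betw_def)
  have b_eq: "b i = b j \<longleftrightarrow> i = j" if "i \<in> {1..?r}" "j \<in> {1..?r}" for i j
    using b that by (auto simp: bij_betw_def inj_on_eq_iff)
  define el where "el e = (case e of Loop i \<Rightarrow> b i | Link i j g \<Rightarrow> inv_into (line {b i, b j}) (\<gamma> i j) g)" for e
  have el_Link: "el (Link i j g) \<in> line {b i, b j}" "\<gamma> i j (el (Link i j g)) = g"
    if "i \<in> {1..?r}" "j \<in> {1..?r}" "i < j" "g \<in> carrier \<Gamma>" for i j g
    using \<gamma> [OF that(1-3)] that(4) unfolding el_def bij_betw_def
    by (auto intro: inv_into_into f_inv_into_f)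
  have el_\<gamma>: "el (Link i j (\<gamma> i j x)) = x"
    if "i \<in> {1..?r}" "j \<in> {1..?r}" "i < j" "x \<in> line {b i, b j}" for i j x
    using \<gamma> [OF that(1-3)] that(4) by (simp add: el_def bij_betw_def)
  have el_Loop: "el (Loop i) = b i" for i by (simp add: el_def)
  have edge_cases: "(\<exists>i. i \<in> {1..?r} \<and> e = Loop i) \<or>
      (\<exists>i j g. i \<in> {1..?r} \<and> j \<in> {1..?r} \<and> i < j \<and> g \<in> carrier \<Gamma> \<and> e = Link i j g)" if "e \<in> ?E" for e
    using that by (auto simp: dowling_edges_def)
  have supp_el: "el e \<in> line (b ` ends e)" if "e \<in> ?E" for e
    using edge_cases [OF that] el_Link(1) el_Loop B_line bB by auto
  have ends_r: "ends e \<subseteq> {1..?r}" if "e \<in> ?E" for e using edge_cases [OF that] by auto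
  have inj_el: "inj_on el ?E"
  proof (rule inj_onI)
    fix e f assume ef: "e \<in> ?E" "f \<in> ?E" "el e = el f"
    then have "b ` ends e = b ` ends f" using supp_el lineD(2) by metis
    moreover have "inj_on b {1..?r}" using b by (simp add: bij_betw_def)
    ultimately have ends: "ends e = ends f" using inj_on_image_eq_iff ends_r ef(1,2) by metis
    show "e = f"
    proof (cases e)
      case e: (Loop i)
      show ?thesis
      proof (cases f)
        case (Link j k g)
        then have "j < k" "{i} = {j, k}" using edge_cases [OF ef(2)] e ends by auto
        then show ?thesis by (auto simp: doubleton_eq_iff)
      qed (use e ends in simp)
    next
      case e: (Link i j g)
      then have ij: "i < j" "i \<in> {1..?r}" "j \<in> {1..?r}" "g \<in> carrier \<Gamma>" using edge_cases [OF ef(1)] by auto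
      show ?thesis
      proof (cases f)
        case (Loop k)
        then have "{i, j} = {k}" using e ends by simp
        then show ?thesis using ij by (auto simp: doubleton_eq_iff)
      next
        case f: (Link i' j' h)
        then have ij': "i' < j'" "h \<in> carrier \<Gamma>" using edge_cases [OF ef(2)] by auto
        have "{i, j} = {i', j'}" using e f ends by simp
        then have "i = i'" "j = j'" using ij(1) ij'(1) by (auto simp: doubleton_eq_iff)
        then show ?thesis
          using el_Link(2) [OF ij(2,3,1,4)] el_Link(2) [OF ij(2,3,1) ij'(2)] ef(3) e f by metis
      qed
    qed
  qed
  have el_X: "el e \<in> X" if "e \<in> ?E" for e using lineD(1) [OF supp_el [OF that]] .
  have "X \<subseteq> el ` ?E"
  proof
    fix x assume x: "x \<in> X"
    have B: "B = b ` {1..?r}" using b by (simp add: bij_betw_def)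
    show "x \<in> el ` ?E"
    proof (cases "card (supp x) = 1")
      case True
      then obtain c where c: "supp x = {c}" by (rule card_1_singletonE)
      then have "c \<in> B" using supp_sub_B [of x] by simp
      then obtain i where i: "i \<in> {1..?r}" "c = b i" using B by blast
      have "x \<in> line {c}" using x c by (simp add: line_def)
      then have "x = b i" using line_joint [OF \<open>c \<in> B\<close>] i by simp
      then have "x = el (Loop i)" by (simp add: el_Loop)
      moreover have "Loop i \<in> ?E" using i by (simp add: dowling_edges_def)
      ultimately show ?thesis by blast
    next
      case False
      then have "card (supp x) = 2" using card_supp [OF x] by auto
      then obtain c d where cd: "supp x = {c, d}" "c \<noteq> d" by (auto simp: card_2_iff)
      then have "c \<in> B" "d \<in> B" using supp_sub_B [of x] by auto
      then obtain i j where ij: "i \<in> {1..?r}" "c = b i" "j \<in> {1..?r}" "d = b j" using B by blast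
      have *: "x \<in> el ` ?E" if "i \<in> {1..?r}" "j \<in> {1..?r}" "i < j" "supp x = {b i, b j}" for i j
      proof -
        have xl: "x \<in> line {b i, b j}" using x that(4) by (simp add: line_def)
        then have "\<gamma> i j x \<in> carrier \<Gamma>" using \<gamma> [OF that(1-3)] by (auto simp: bij_betw_def)
        then have "Link i j (\<gamma> i j x) \<in> ?E" using that by (simp add: dowling_edges_def)
        then show ?thesis using el_\<gamma> [OF that(1-3) xl] by (metis imageI)
      qed
      have "i \<noteq> j" using ij cd(2) by auto
      then show ?thesis using * [of i j] * [of j i] ij cd(1) by (auto simp: insert_commute neq_iff)
    qed
  qed
  then have bij_el: "bij_betw el ?E X" using inj_el el_X by (auto simp: bij_betw_def)
  have finE: "finite ?E" using bij_betw_finite [OF bij_el] finite_X by simp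
  interpret R: rank_function "\<lambda>Y. \<rho> (el ` (Y \<inter> ?E))" ?E
    using finE by (rule rank_function_pullback)
  interpret \<Gamma>: group \<Gamma> by (rule assms(2))
  have closI: "e \<in> R.clos Y" if "e \<in> ?E" "Y \<subseteq> ?E" "el e \<in> clos (el ` Y)" for e Y
  proof -
    have "insert e Y \<inter> ?E = insert e Y" "Y \<inter> ?E = Y" using that by auto
    then show ?thesis using that(3) by (simp add: R.clos_def clos_def)
  qed
  have Loop_E: "Loop i \<in> ?E" if "i \<in> {1..?r}" for i using that by (simp add: dowling_edges_def)
  interpret D: dowling_rank "\<lambda>Y. \<rho> (el ` (Y \<inter> ?E))" ?r \<Gamma>
  proof
    have "Loop ` {1..?r} \<inter> ?E = Loop ` {1..?r}" using Loop_E by blast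
    moreover have "el ` Loop ` {1..?r} = B" using b by (simp add: image_image el_Loop bij_betw_def)
    ultimately show "\<rho> (el ` (Loop ` {1..?r} \<inter> ?E)) = ?r" using indep_B by simp
    show "\<rho> (el ` ({e, f} \<inter> ?E)) = 2" if "e \<in> ?E" "f \<in> ?E" "e \<noteq> f" for e f
    proof -
      have "el e \<noteq> el f" using inj_el that by (simp add: inj_on_eq_iff)
      moreover have "{e, f} \<inter> ?E = {e, f}" using that by auto
      ultimately show ?thesis using rank_pair el_X that by simp
    qed
    show "Link i j g \<in> R.clos {Loop i, Loop j}" if "Link i j g \<in> ?E" for i j g
    proof (rule closI [OF that])
      have ij: "i \<in> {1..?r}" "j \<in> {1..?r}" using ends_r [OF that] by auto
      then show "{Loop i, Loop j} \<subseteq> ?E" using Loop_E by simp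
      have "el (Link i j g) \<in> line {b i, b j}" using supp_el [OF that] by simp
      then have "el (Link i j g) \<in> clos {b i, b j}"
        using in_clos_iff [of "el (Link i j g)" "{b i, b j}"] bB ij lineD by auto
      then show "el (Link i j g) \<in> clos (el ` {Loop i, Loop j})" by (simp add: el_Loop)
    qed
    show "Link i m (g \<otimes>\<^bsub>\<Gamma>\<^esub> h) \<in> R.clos {Link i j g, Link j m h}"
      if "i \<in> {1..?r}" "j \<in> {1..?r}" "m \<in> {1..?r}" "i < j" "j < m" "g \<in> carrier \<Gamma>" "h \<in> carrier \<Gamma>"
      for i j m g h
    proof (rule closI)
      show "Link i m (g \<otimes>\<^bsub>\<Gamma>\<^esub> h) \<in> ?E" "{Link i j g, Link j m h} \<subseteq> ?E"
        using that by (auto simp: dowling_edges_def)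
      let ?x = "el (Link i j g)" and ?y = "el (Link j m h)"
      have xy: "?x \<in> line {b i, b j}" "?y \<in> line {b j, b m}" "\<gamma> i j ?x = g" "\<gamma> j m ?y = h"
        using el_Link that by auto
      have d: "distinct [b i, b j, b m]" using b_eq that by simp
      \<comment> \<open>The third point has the product as its gain, so it is the image of the link
        with that gain.\<close>
      have "\<exists>!z. z \<in> line {b i, b m} \<and> \<rho> {?x, ?y, z} \<le> 2"
        using third_point [OF bB bB bB d xy(1,2)] that(1-3) by blast
      then obtain z where z: "z \<in> line {b i, b m}" "\<rho> {?x, ?y, z} \<le> 2" by blast
      have "\<gamma> i m z = g \<otimes>\<^bsub>\<Gamma>\<^esub> h" using mult [OF that(1-5) xy(1,2) z] xy(3,4) by simp
      then have "z = el (Link i m (g \<otimes>\<^bsub>\<Gamma>\<^esub> h))" using el_\<gamma> [of i m z] that z(1) by simp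
      moreover have "{b i, b j} \<noteq> {b j, b m}" using d by (auto simp: doubleton_eq_iff)
      then have "?x \<noteq> ?y" using line_neq xy(1,2) by blast
      then have "z \<in> clos {?x, ?y}" using dependent_triple xy(1,2) lineD z(2) by blast
      ultimately show "el (Link i m (g \<otimes>\<^bsub>\<Gamma>\<^esub> h)) \<in> clos (el ` {Link i j g, Link j m h})" by simp
    qed
  qed
  have "isomorphic (DG ?r \<Gamma>) \<lparr>ground = X, indep = {Y. Y \<subseteq> X \<and> \<rho> Y = card Y}\<rparr>"
    unfolding isomorphic_def
  proof (intro exI [of _ el] conjI allI impI)
    show "bij_betw el (ground (DG ?r \<Gamma>)) (ground \<lparr>ground = X, indep = {Y. Y \<subseteq> X \<and> \<rho> Y = card Y}\<rparr>)"
      using bij_el by (simp add: DG_def)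
    fix Y assume "Y \<subseteq> ground (DG ?r \<Gamma>)"
    then have Y: "Y \<subseteq> ?E" by (simp add: DG_def)
    then have "Y \<inter> ?E = Y" "card (el ` Y) = card Y" "el ` Y \<subseteq> X"
      using inj_el el_X card_image inj_on_subset by blast+
    then show "Y \<in> indep (DG ?r \<Gamma>) \<longleftrightarrow>
        el ` Y \<in> indep \<lparr>ground = X, indep = {Y. Y \<subseteq> X \<and> \<rho> Y = card Y}\<rparr>"
      using D.independent_iff [OF Y] Y by (simp add: DG_def)
  qed
  then show ?thesis by (rule isomorphic_sym)
qed

end

section \<open>The choice of the group in small and in large rank\<close>

lemma ex_group_of_order:
  assumes "0 < k" shows "\<exists>\<Gamma> :: nat monoid. group \<Gamma> \<and> carrier \<Gamma> = {..<k}"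
proof -
  let ?G = "\<lparr>carrier = {..<k}, mult = \<lambda>x y. (x + y) mod k, one = 0\<rparr> :: nat monoid"
  have "group ?G"
  proof (rule groupI)
    show "\<exists>y\<in>carrier ?G. y \<otimes>\<^bsub>?G\<^esub> x = \<one>\<^bsub>?G\<^esub>" if "x \<in> carrier ?G" for x
      using that assms by (intro bexI [of _ "(k - x) mod k"]) (auto simp: mod_add_left_eq)
  qed (use assms in \<open>auto simp: mod_add_left_eq mod_add_right_eq add.assoc\<close>)
  then show ?thesis by (intro exI [of _ ?G]) simp
qed

text \<open>There are no increasing triples of vertices, so arbitrary bijections of the lines with a
  cyclic group satisfy the multiplication rule vacuously.\<close>

lemma (in joint_frame) ex_DG_rank_le_2:
  assumes "card B \<le> 2"
  shows "\<exists>\<Gamma> :: nat monoid. group \<Gamma> \<and> order \<Gamma> = l - 1 \<and>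
    isomorphic \<lparr>ground = X, indep = {Y. Y \<subseteq> X \<and> \<rho> Y = card Y}\<rparr> (DG (card B) \<Gamma>)"
proof -
  obtain b where b: "bij_betw b {1..card B} B"
    using finite_B ex_bij_betw_nat_finite_1 by blast
  obtain \<Gamma> :: "nat monoid" where G: "group \<Gamma>" "carrier \<Gamma> = {..<l - 1}"
    using ex_group_of_order [of "l - 1"] l2 by auto
  have bB: "b i \<in> B" if "i \<in> {1..card B}" for i using b that by (auto simp: bij_betw_def)
  have "\<exists>\<gamma>. bij_betw \<gamma> (line {b i, b j}) (carrier \<Gamma>)"
    if ij: "i \<in> {1..card B}" "j \<in> {1..card B}" "i < j" for i j
  proof -
    have "b i \<noteq> b j" using b ij by (auto simp: bij_betw_def inj_on_eq_iff)
    then have "card (line {b i, b j}) = l - 1" using n_pair bB ij by (simp add: n_def)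
    then show ?thesis using G(2) finite_line by (intro finite_same_card_bij) auto
  qed
  then obtain \<gamma> where \<gamma>: "\<And>i j. i \<in> {1..card B} \<Longrightarrow> j \<in> {1..card B} \<Longrightarrow> i < j \<Longrightarrow>
      bij_betw (\<gamma> i j) (line {b i, b j}) (carrier \<Gamma>)" by metis
  have "isomorphic \<lparr>ground = X, indep = {Y. Y \<subseteq> X \<and> \<rho> Y = card Y}\<rparr> (DG (card B) \<Gamma>)"
    by (rule isomorphic_DG [OF b G(1) \<gamma>]) (use assms in auto)
  moreover have "order \<Gamma> = l - 1" by (simp add: order_def G(2))
  ultimately show ?thesis using G(1) by blast
qed

lemma (in joint_frame) ex_DG_rank_ge_4:
  assumes "4 \<le> card B"
  shows "\<exists>\<Gamma> :: 'a monoid. group \<Gamma> \<and> order \<Gamma> = l - 1 \<and>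
    isomorphic \<lparr>ground = X, indep = {Y. Y \<subseteq> X \<and> \<rho> Y = card Y}\<rparr> (DG (card B) \<Gamma>)"
proof -
  obtain b where b: "bij_betw b {1..card B} B"
    using finite_B ex_bij_betw_nat_finite_1 by blast
  interpret T: triangle_system "{1..card B}" "\<lambda>i j. line {b i, b j}" "\<lambda>x y z. \<rho> {x, y, z} \<le> 2" 1 2 3 4
    using triangle_system [OF b assms] .
  note T = T.group_of_triangles
  have "b 1 \<in> B" "b 2 \<in> B" "b 1 \<noteq> b 2" using b assms by (auto simp: bij_betw_def inj_on_eq_iff)
  then have "n {b 1, b 2} = l - 1" by (rule n_pair)
  then have "order T.G = l - 1" unfolding order_def T(2) n_def .
  moreover have "isomorphic \<lparr>ground = X, indep = {Y. Y \<subseteq> X \<and> \<rho> Y = card Y}\<rparr> (DG (card B) T.G)"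
    by (rule isomorphic_DG [OF b T(1,3,4)])
  ultimately show ?thesis using T(1) by blast
qed

lemma frame_bound:
  assumes "frame \<rho> E B X l" shows "card X \<le> card B + (l - 1) * (card B choose 2)"
proof -
  interpret frame \<rho> E B X l by (rule assms)
  show ?thesis using card_X_le_free card_X_le l_pos by (cases "l = 1") auto
qed

text \<open>The group built from triangles has points of the matroid as its elements. With these in
  \<open>nat\<close>, small and large rank give a group of the same type.\<close>

lemma frame_tight:
  fixes \<rho> :: "nat set \<Rightarrow> nat"
  assumes "frame \<rho> E B X l" and l: "l \<noteq> 1" and r: "card B \<noteq> 3"
    and eq: "card X = card B + (l - 1) * (card B choose 2)"
  shows "\<exists>\<Gamma> :: nat monoid. group \<Gamma> \<and> order \<Gamma> = l - 1 \<and>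
    isomorphic \<lparr>ground = X, indep = {Y. Y \<subseteq> X \<and> \<rho> Y = card Y}\<rparr> (DG (card B) \<Gamma>)"
proof -
  interpret frame \<rho> E B X l by (rule assms(1))
  have l2: "2 \<le> l" using l l_pos by simp
  have "\<exists>B'\<subseteq>X. card B' = card B \<and> \<rho> B' = card B' \<and> (\<forall>x\<in>X. \<exists>S\<subseteq>B'. card S \<le> 2 \<and> x \<in> clos S)"
  proof (cases "4 \<le> card B")
    case True
    then show ?thesis using tight_frame [OF l2 _ eq] by blast
  next
    case False
    \<comment> \<open>With at most two elements, any basis contained in \<open>X\<close> is itself a
      frame.\<close>
    obtain I where I: "I \<subseteq> X" "\<rho> I = card I" "X \<subseteq> clos I" using basis_exists finite_X by blast
    have "card I = card B" using I rank_X rank_mono [of I X] rank_le_of_subset_clos [of X I] by auto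
    then show ?thesis using I False r by (intro exI [of _ I]) auto
  qed
  then obtain B' where B': "B' \<subseteq> X" "card B' = card B" "\<rho> B' = card B'"
    "\<And>x. x \<in> X \<Longrightarrow> \<exists>S\<subseteq>B'. card S \<le> 2 \<and> x \<in> clos S" by blast
  interpret J: joint_frame \<rho> E B' X l
    using B' finite_subset [OF B'(1) finite_X] finite_X rank_X simple short_lines l_pos l2 eq
    by unfold_locales auto
  show ?thesis
    using J.ex_DG_rank_ge_4 J.ex_DG_rank_le_2 r B'(2) by (cases "4 \<le> card B") auto
qed


section \<open>Frame matroids\<close>

text \<open>Contracting elements of the framing basis that are skew to \<open>X\<close> does not change the
  restriction to \<open>X\<close>, so the framing basis may be assumed to have as many elements as the rank of
  \<open>X\<close>.\<close>

lemma (in matroid) framed_restriction: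
  assumes framed: "framed_by M B\<^sub>0" and X: "X \<subseteq> ground M"
    and simple: "\<And>x y. x \<in> X \<Longrightarrow> y \<in> X \<Longrightarrow> rank_of M {x, y} = card {x, y}"
    and short: "\<And>C S. C \<subseteq> X \<Longrightarrow> S \<subseteq> X \<Longrightarrow>
      (\<And>x y. x \<in> S \<Longrightarrow> y \<in> S \<Longrightarrow> x \<noteq> y \<Longrightarrow> rank_of M (C \<union> {x, y}) = rank_of M C + 2) \<Longrightarrow>
      rank_of M (C \<union> S) \<le> rank_of M C + 2 \<Longrightarrow> card S \<le> l + 1"
    and "0 < l"
  shows "\<exists>\<rho> B. frame \<rho> (ground M) B X l \<and> card B = rank_of M X \<and> (\<forall>Y\<subseteq>X. \<rho> Y = rank_of M Y)"
proof -
  interpret rank_function "rank_of M" "ground M" by (rule rank_function_rank_of)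
  let ?r = "rank_of M"
  have B0: "finite B\<^sub>0" "?r B\<^sub>0 = card B\<^sub>0"
    using framed indep_iff_rank by (auto simp: framed_by_def basis_def)
  have cl: "cl M S \<subseteq> clos S" for S by (auto simp: cl_def clos_def)
  \<comment> \<open>The subsets of the framing basis that are skew to \<open>X\<close>. By
    maximality of the chosen \<open>Z\<close>, all framing elements lie in the closure of
    \<open>X \<union> Z\<close>.\<close>
  define Zs where "Zs = {Z. Z \<subseteq> B\<^sub>0 \<and> ?r (X \<union> Z) = ?r X + card Z}"
  have "finite Zs" "Zs \<noteq> {}" using B0(1) by (auto simp: Zs_def)
  then obtain Z where Z: "Z \<in> Zs" "\<And>Z'. Z' \<in> Zs \<Longrightarrow> Z \<subseteq> Z' \<Longrightarrow> Z = Z'"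
    using finite_has_maximal [of Zs] by blast
  then have Z': "Z \<subseteq> B\<^sub>0" "?r (X \<union> Z) = ?r X + card Z" by (auto simp: Zs_def)
  have finZ: "finite Z" using Z'(1) B0(1) finite_subset by blast
  have rZ: "?r Z = card Z" using rank_function.indep_subset [OF rank_function_rank_of B0(2,1) Z'(1)] .
  define \<rho> where "\<rho> Y = ?r (Y \<union> Z) - ?r Z" for Y
  define B where "B = B\<^sub>0 - Z"
  have BZ: "B \<union> Z = B\<^sub>0" using Z'(1) by (auto simp: B_def)
  have cardB: "card B = card B\<^sub>0 - card Z" using Z'(1) finZ by (simp add: B_def card_Diff_subset)
  \<comment> \<open>A set skew to \<open>X\<close> is skew to every subset of \<open>X\<close>, by
    submodularity for \<open>Y \<union> Z\<close> and \<open>X\<close>.\<close>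
  have eq: "\<rho> Y = ?r Y" if "Y \<subseteq> X" for Y
  proof -
    have "(Y \<union> Z) \<union> X = X \<union> Z" using that by auto
    moreover have "?r Y \<le> ?r ((Y \<union> Z) \<inter> X)" using that by (intro rank_mono) auto
    ultimately have "?r X + card Z + ?r Y \<le> ?r (Y \<union> Z) + ?r X"
      using submodular [of "Y \<union> Z" X] Z'(2) by simp
    moreover have "?r (Y \<union> Z) \<le> ?r Y + card Z"
      using submodular [of Y Z] rZ by simp
    ultimately show ?thesis by (simp add: \<rho>_def rZ)
  qed
  have X_clos: "\<exists>S\<subseteq>B\<^sub>0. card S \<le> 2 \<and> x \<in> clos S" if "x \<in> X" for x
    using framed X that cl unfolding framed_by_def by blast
  have "B\<^sub>0 \<subseteq> clos (X \<union> Z)"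
  proof
    fix b assume b: "b \<in> B\<^sub>0"
    show "b \<in> clos (X \<union> Z)"
    proof (rule ccontr)
      assume nb: "b \<notin> clos (X \<union> Z)"
      then have "?r (insert b (X \<union> Z)) = Suc (?r X + card Z)" using rank_insert_notin Z'(2) by simp
      moreover have bZ: "b \<notin> Z" using nb in_clos by blast
      ultimately have "insert b Z \<in> Zs" using b Z'(1) finZ by (simp add: Zs_def)
      then show False using Z(2) bZ by blast
    qed
  qed
  then have 1: "?r B\<^sub>0 \<le> ?r (X \<union> Z)" by (rule rank_le_of_subset_clos)
  have "X \<subseteq> clos B\<^sub>0" using X_clos clos_mono by blast
  moreover have "Z \<subseteq> clos B\<^sub>0" using Z'(1) subset_clos by (rule subset_trans)
  ultimately have "X \<union> Z \<subseteq> clos B\<^sub>0" by (rule Un_least)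
  then have "?r (X \<union> Z) \<le> ?r B\<^sub>0" by (rule rank_le_of_subset_clos)
  with 1 have r: "?r (X \<union> Z) = card B\<^sub>0" using B0 by simp
  interpret R: rank_function \<rho> "ground M"
    unfolding \<rho>_def by (rule rank_function_quotient)
  have "frame \<rho> (ground M) B X l"
  proof
    show "finite B" using B0(1) by (simp add: B_def)
    show "\<rho> B = card B" using B0 cardB BZ rZ by (simp add: \<rho>_def)
    show "finite X" using X finite_ground finite_subset by blast
    show "\<rho> X = card B" using r cardB rZ by (simp add: \<rho>_def)
    show "\<rho> {x, y} = card {x, y}" if "x \<in> X" "y \<in> X" for x y
      using eq [of "{x, y}"] simple that by simp
    show "\<exists>S\<subseteq>B. card S \<le> 2 \<and> x \<in> R.clos S" if x: "x \<in> X" for x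
    proof -
      obtain S where S: "S \<subseteq> B\<^sub>0" "card S \<le> 2" "x \<in> clos S" using X_clos x by blast
      have "card (S - Z) \<le> 2" using S B0(1) card_mono [of S "S - Z"] finite_subset by fastforce
      moreover have "x \<in> R.clos (S - Z)"
      proof -
        have "x \<in> clos ((S - Z) \<union> Z)" using S(3) clos_mono [of S "(S - Z) \<union> Z"] by blast
        then show ?thesis by (simp add: R.clos_def clos_def \<rho>_def)
      qed
      moreover have "S - Z \<subseteq> B" using S(1) by (auto simp: B_def)
      ultimately show ?thesis by blast
    qed
    show "card S \<le> l + 1"
      if C: "C \<subseteq> X" and S: "S \<subseteq> X"
        and p: "\<And>x y. x \<in> S \<Longrightarrow> y \<in> S \<Longrightarrow> x \<noteq> y \<Longrightarrow> \<rho> (C \<union> {x, y}) = \<rho> C + 2"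
        and a: "\<rho> (C \<union> S) \<le> \<rho> C + 2" for C S
    proof (rule short [OF C S])
      show "?r (C \<union> {x, y}) = ?r C + 2" if "x \<in> S" "y \<in> S" "x \<noteq> y" for x y
      proof -
        have "C \<union> {x, y} \<subseteq> X" using C S that by auto
        then show ?thesis using p [OF that] eq [of "C \<union> {x, y}"] eq [OF C] by simp
      qed
      have "C \<union> S \<subseteq> X" using C S by simp
      then show "?r (C \<union> S) \<le> ?r C + 2" using a eq [of "C \<union> S"] eq [OF C] by simp
    qed
    show "0 < l" by (rule assms(5))
  qed
  moreover have "card B = ?r X" using r Z'(2) cardB by simp
  ultimately show ?thesis using eq by blast
qed

lemma rank_of_isomorphic:
  assumes f: "bij_betw f (ground M) X"
    and indep: "\<And>Y. Y \<subseteq> ground M \<Longrightarrow> Y \<in> indep M \<longleftrightarrow> f ` Y \<in> indep N"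
    and Y: "Y \<subseteq> ground M"
  shows "rank_of M Y = rank_of N (f ` Y)"
proof -
  have card: "card (f ` I) = card I" if "I \<subseteq> ground M" for I
    using f that by (meson bij_betw_def card_image inj_on_subset)
  have "card ` {I \<in> indep M. I \<subseteq> Y} = card ` {J \<in> indep N. J \<subseteq> f ` Y}"
  proof (intro subset_antisym subsetI)
    fix k assume "k \<in> card ` {I \<in> indep M. I \<subseteq> Y}"
    then obtain I where I: "I \<in> indep M" "I \<subseteq> Y" "k = card I" by blast
    then have "f ` I \<in> indep N" "card (f ` I) = k" "f ` I \<subseteq> f ` Y" using indep [of I] card [of I] Y by auto
    then show "k \<in> card ` {J \<in> indep N. J \<subseteq> f ` Y}" by blast
  next
    fix k assume "k \<in> card ` {J \<in> indep N. J \<subseteq> f ` Y}"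
    then obtain J where J: "J \<in> indep N" "J \<subseteq> f ` Y" "k = card J" by blast
    then obtain I where I: "I \<subseteq> Y" "J = f ` I" by (auto simp: subset_image_iff)
    then have "I \<in> indep M" "card I = k" using indep [of I] card [of I] J Y by auto
    then show "k \<in> card ` {I \<in> indep M. I \<subseteq> Y}" using I(1) by blast
  qed
  then show ?thesis by (simp add: rank_of_def)
qed

theorem theorem4p1:
  fixes M :: "'a indep_system" and l r :: nat
  assumes "0 < l" and "0 < r"
    and "matroid M" and "simple_matroid M" and "matroid_rank M = r" and "frame_matroid M"
    and "\<not> has_minor M (uniform 2 (l + 2))"
  shows "card (ground M) \<le> r + (l - 1) * (r choose 2) \<and>
    (l \<noteq> 1 \<and> r \<noteq> 3 \<and> card (ground M) = r + (l - 1) * (r choose 2) \<longrightarrow>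
      (\<exists>\<Gamma> :: nat monoid. group \<Gamma> \<and> order \<Gamma> = l - 1 \<and> isomorphic M (DG r \<Gamma>)))"
proof -
  interpret M: matroid M by (rule assms(3))
  obtain N :: "nat indep_system" and B\<^sub>0 X where N: "matroid N" "framed_by N B\<^sub>0" "X \<subseteq> ground N"
    and iso: "isomorphic M (restriction N X)"
    using assms(6) by (auto simp: frame_matroid_def)
  interpret N: matroid N by (rule N(1))
  obtain f where f: "bij_betw f (ground M) X"
    and f': "\<And>Y. Y \<subseteq> ground M \<Longrightarrow> Y \<in> indep M \<longleftrightarrow> f ` Y \<in> indep (restriction N X)"
    using iso by (auto simp: isomorphic_def restriction_def)
  have fX: "f ` Y \<subseteq> X" if "Y \<subseteq> ground M" for Y using f that by (auto simp: bij_betw_def)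
  have indep: "Y \<in> indep M \<longleftrightarrow> f ` Y \<in> indep N" if "Y \<subseteq> ground M" for Y
    using f' [OF that] fX [OF that] by (simp add: restriction_def)
  have rank: "rank_of M Y = rank_of N (f ` Y)" if "Y \<subseteq> ground M" for Y
    using rank_of_isomorphic [OF f] indep that by blast
  have pre: "\<exists>Y\<subseteq>ground M. f ` Y = Z" if "Z \<subseteq> X" for Z
  proof -
    have "Z \<subseteq> f ` ground M" using that f by (simp add: bij_betw_def)
    then show ?thesis unfolding subset_image_iff by blast
  qed
  have inj: "inj_on f (ground M)" using f by (simp add: bij_betw_def)
  have simple: "rank_of N {x, y} = card {x, y}" if xy: "x \<in> X" "y \<in> X" for x y
  proof -
    obtain a b where ab: "a \<in> ground M" "b \<in> ground M" "x = f a" "y = f b"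
      using xy f by (auto simp: bij_betw_def)
    then have "{a, b} \<in> indep M" using assms(4) by (simp add: simple_matroid_def)
    then have "{x, y} \<in> indep N" using indep [of "{a, b}"] ab by simp
    then show ?thesis by (simp add: N.indep_iff_rank)
  qed
  \<comment> \<open>The excluded minor concerns \<open>M\<close> only, not the framed matroid
    \<open>N\<close>; so \<open>C\<close> and l + 2 points of a longer line are pulled back to
    \<open>M\<close> along \<open>f\<close>.\<close>
  have short: "card S \<le> l + 1"
    if C: "C \<subseteq> X" and S: "S \<subseteq> X"
      and p: "\<And>x y. x \<in> S \<Longrightarrow> y \<in> S \<Longrightarrow> x \<noteq> y \<Longrightarrow> rank_of N (C \<union> {x, y}) = rank_of N C + 2"
      and a: "rank_of N (C \<union> S) \<le> rank_of N C + 2" for C S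
  proof (rule ccontr)
    assume "\<not> card S \<le> l + 1"
    then have "l + 2 \<le> card S" by simp
    then obtain S1 where S1: "S1 \<subseteq> S" "card S1 = l + 2" by (rule obtain_subset_with_card_n)
    obtain C' where C': "C' \<subseteq> ground M" "f ` C' = C" using pre [OF C] by blast
    obtain S' where S': "S' \<subseteq> ground M" "f ` S' = S1" using pre [of S1] S S1 by blast
    have card: "card S' = l + 2"
      using card_image [OF inj_on_subset [OF inj S'(1)]] S'(2) S1(2) by simp
    have "has_minor M (uniform 2 (l + 2))"
    proof (rule M.has_uniform_minorI [OF C'(1) S'(1) card])
      show "2 < l + 2" using assms(1) by simp
      have rC: "rank_of M C' = rank_of N C" using rank [OF C'(1)] C'(2) by simp
      show "rank_of M (C' \<union> {x, y}) = rank_of M C' + 2" if xy: "x \<in> S'" "y \<in> S'" "x \<noteq> y" for x y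
      proof -
        have "f x \<noteq> f y" using inj_onD [OF inj, of x y] xy S'(1) by blast
        moreover have "f x \<in> S" "f y \<in> S" using xy S'(2) S1(1) by auto
        moreover have "rank_of M (C' \<union> {x, y}) = rank_of N (C \<union> {f x, f y})"
          using rank [of "C' \<union> {x, y}"] C' S'(1) xy by (auto simp: image_Un)
        ultimately show ?thesis using p [of "f x" "f y"] rC by simp
      qed
      have "rank_of M (C' \<union> S') = rank_of N (C \<union> S1)"
        using rank [of "C' \<union> S'"] C' S' by (simp add: image_Un)
      also have "\<dots> \<le> rank_of N (C \<union> S)"
        using rank_function.rank_mono [OF N.rank_function_rank_of, of "C \<union> S1" "C \<union> S"] S1(1) by blast
      finally show "rank_of M (C' \<union> S') \<le> rank_of M C' + 2" using a rC by simp
    qed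
    then show False using assms(7) by blast
  qed
  have "\<exists>\<rho> B. frame \<rho> (ground N) B X l \<and> card B = rank_of N X \<and> (\<forall>Y\<subseteq>X. \<rho> Y = rank_of N Y)"
    by (rule N.framed_restriction [OF N(2,3)]) (fact simple short assms(1))+
  then obtain \<rho> B where F: "frame \<rho> (ground N) B X l" and cardB: "card B = rank_of N X"
    and \<rho>: "\<And>Y. Y \<subseteq> X \<Longrightarrow> \<rho> Y = rank_of N Y" by blast
  have "f ` ground M = X" using f by (simp add: bij_betw_def)
  then have r: "card B = r" using cardB rank [of "ground M"] assms(5) by (simp add: matroid_rank_def)
  have cardX: "card X = card (ground M)" using bij_betw_same_card [OF f] by simp
  \<comment> \<open>On subsets of \<open>X\<close> the rank after the contraction agrees with the
    rank in \<open>N\<close>, so both define the same matroid.\<close>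
  have "restriction N X = \<lparr>ground = X, indep = {Y. Y \<subseteq> X \<and> \<rho> Y = card Y}\<rparr>"
  proof -
    have "finite X" using N(3) N.finite_ground finite_subset by blast
    then have "Y \<in> indep N \<longleftrightarrow> \<rho> Y = card Y" if "Y \<subseteq> X" for Y
      using that N.indep_iff_rank [of Y] \<rho> [OF that] finite_subset [OF that] by simp
    then show ?thesis by (auto simp: restriction_def)
  qed
  then show ?thesis
    using frame_bound [OF F] frame_tight [OF F] r cardX iso isomorphic_trans by metis
qed

end
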